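(* Let $P$ be a simplicial hyperbolic $d$-polytope. Then the relation $$\sum_{j=k}^{d-1}(-1)^j\binom{j+1}{k+1}\alpha_j(P)=(-1)^d\left(\alpha_k(P)-f_k(P)\right)$$ holds for $k=d-1$ (when $d\ge1$) and for $k=d-2$ (when $d\ge 2$). Moreover, if $d=3$, it holds for all $0\le k\le 2$.
   Context: A hyperbolic $d$-polytope is a bounded intersection, with nonempty interior, of finitely many closed half-spaces in hyperbolic space $\mathbb{H}^d$; its faces are defined as for Euclidean polytopes, and it is simplicial if all its facets are (hyperbolic) simplices. $f_i(P)$ is the number of $i$-faces. For a nonempty face $F$ of $P$, the interior angle $\alpha(F,P)$ is the fraction of a sufficiently small hyperbolic $(d-1)$-sphere (set of points equidistant from its center), centered at a point of the relative interior of $F$, that lies in $P$; $\alpha_i(P)$ is the sum of $\alpha(F,P)$ over all $i$-faces $F$ of $P$, $0\le i\le d$. *)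

theory Defs
  imports "HOL-Analysis.Analysis"
begin

text \<open>
  Hyperbolic space of dimension \<open>d = DIM('a)\<close> is the projective (Beltrami--Klein) model: the open
  unit ball of the Euclidean space \<open>'a\<close>. In this model geodesics are Euclidean chords, hyperplanes
  are the nonempty traces of Euclidean hyperplanes, and the hyperbolic topology is the Euclidean
  one. Hence, for subsets of the ball, hyperbolic convexity, faces, simplices, dimension and
  (relative) interior are those of the library. Distances and spheres are not Euclidean;
  they are taken with respect to \<open>hdist\<close>.
\<close>

abbreviation hyp_space :: "'a::euclidean_space set" where
  "hyp_space \<equiv> ball 0 1"

definition hdist :: "'a::euclidean_space \<Rightarrow> 'a \<Rightarrow> real" where
  "hdist x y = arcosh ((1 - x \<bullet> y) / (sqrt (1 - x \<bullet> x) * sqrt (1 - y \<bullet> y)))"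

definition hsphere :: "'a::euclidean_space \<Rightarrow> real \<Rightarrow> 'a set" where
  "hsphere x r = {y \<in> hyp_space. hdist x y = r}"

definition hbounded :: "'a::euclidean_space set \<Rightarrow> bool" where
  "hbounded S \<longleftrightarrow> S \<subseteq> hyp_space \<and> (\<exists>c\<in>hyp_space. \<exists>R. \<forall>x\<in>S. hdist c x \<le> R)"

text \<open>
  The condition \<open>\<bar>b\<bar> < norm a\<close> says that the Euclidean hyperplane \<open>a \<bullet> x = b\<close> meets the open
  unit ball, i.e. that the half-space is bounded by a hyperplane of hyperbolic space.
\<close>

definition hyp_halfspace :: "'a::euclidean_space set \<Rightarrow> bool" where
  "hyp_halfspace H \<longleftrightarrow> (\<exists>a b. \<bar>b\<bar> < norm a \<and> H = {x \<in> hyp_space. a \<bullet> x \<le> b})"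

definition hyp_polytope :: "'a::euclidean_space set \<Rightarrow> bool" where
  "hyp_polytope P \<longleftrightarrow>
     (\<exists>\<H>. finite \<H> \<and> (\<forall>H\<in>\<H>. hyp_halfspace H) \<and> P = hyp_space \<inter> \<Inter>\<H>) \<and>
     hbounded P \<and> interior P \<noteq> {}"

definition simplicial_hyp_polytope :: "'a::euclidean_space set \<Rightarrow> bool" where
  "simplicial_hyp_polytope P \<longleftrightarrow>
     hyp_polytope P \<and> (\<forall>F. F facet_of P \<longrightarrow> (\<exists>n. n simplex F))"

definition faces_dim :: "nat \<Rightarrow> 'a::euclidean_space set \<Rightarrow> 'a set set" where
  "faces_dim i P = {F. F face_of P \<and> aff_dim F = int i}"

definition f_num :: "nat \<Rightarrow> 'a::euclidean_space set \<Rightarrow> nat" where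
  "f_num i P = card (faces_dim i P)"

text \<open>
  The size of a part of a hyperbolic sphere is its \<open>(d-1)\<close>-dimensional Hausdorff measure with
  respect to the hyperbolic distance (counting measure if \<open>d = 1\<close>). The usual normalising
  constant is omitted, since only quotients of measures are used. The empty set is treated
  separately because \<open>0 ^ 0 = 1\<close>.
\<close>

definition hdiam :: "'a::euclidean_space set \<Rightarrow> ennreal" where
  "hdiam E = (SUP x\<in>E. SUP y\<in>E. ennreal (hdist x y))"

definition hausdorff_pre :: "nat \<Rightarrow> real \<Rightarrow> 'a::euclidean_space set \<Rightarrow> ennreal" where
  "hausdorff_pre s \<delta> A =
     (INF E \<in> {E :: nat \<Rightarrow> 'a set. A \<subseteq> (\<Union>i. E i) \<and>
                 (\<forall>i. E i \<subseteq> hyp_space \<and> hdiam (E i) \<le> ennreal \<delta>)}.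
        \<Sum>i. if E i = {} then 0 else hdiam (E i) ^ s)"

definition hausdorff_hyp :: "nat \<Rightarrow> 'a::euclidean_space set \<Rightarrow> ennreal" where
  "hausdorff_hyp s A = (SUP \<delta>\<in>{0<..}. hausdorff_pre s \<delta> A)"

definition sphere_fraction :: "'a::euclidean_space set \<Rightarrow> 'a \<Rightarrow> real \<Rightarrow> real" where
  "sphere_fraction P x r =
     enn2real (hausdorff_hyp (DIM('a) - 1) (hsphere x r \<inter> P)) /
     enn2real (hausdorff_hyp (DIM('a) - 1) (hsphere x r))"

text \<open>
  The fraction is the same for all sufficiently small radii and for all centers in the
  relative interior of the face; the interior angle is this common value.
\<close>

definition interior_angle :: "'a::euclidean_space set \<Rightarrow> 'a set \<Rightarrow> real" where
  "interior_angle F P =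
     (THE \<alpha>. \<forall>x\<in>rel_interior F. \<forall>\<^sub>F r in at_right 0. sphere_fraction P x r = \<alpha>)"

definition angle_sum :: "nat \<Rightarrow> 'a::euclidean_space set \<Rightarrow> real" where
  "angle_sum i P = (\<Sum>F\<in>faces_dim i P. interior_angle F P)"

definition angle_relation :: "nat \<Rightarrow> 'a::euclidean_space set \<Rightarrow> bool" where
  "angle_relation k P \<longleftrightarrow>
     (\<Sum>j = k..DIM('a) - 1. (-1) ^ j * real ((j + 1) choose (k + 1)) * angle_sum j P) =
     (-1) ^ DIM('a) * (angle_sum k P - real (f_num k P))"

end

theory Submission
  imports Defs
begin

text \<open>
  Every facet angle is \<open>1 / 2\<close>, because the antipodal map exchanges the two sides of a hyperplane; and
  in a simplicial polytope counting incident ridges and facets gives \<open>d f\<^bsub>d-1\<^esub> = 2 f\<^bsub>d-2\<^esub>\<close>. These two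
  facts are the relations for \<open>k = d - 1\<close> and \<open>k = d - 2\<close>. For \<open>d = 3\<close> and \<open>k = 0\<close>, a vertex \<open>v\<close> on \<open>n\<close>
  facets satisfies \<open>2 \<alpha>(v) = \<Sum> \<alpha>(e) - n / 2 + 1\<close>, the sum ranging over the edges at \<open>v\<close>. This is the
  integral over the sphere of directions of an identity between indicator functions of tangent
  cones, which amounts to saying that a generic direction sees exactly two silhouette edges at \<open>v\<close>
  unless it, or its opposite, points into the polytope.

  Angles are evaluated by moving the center to the origin with an isometry (a Lorentz boost). There
  hyperbolic spheres are Euclidean spheres, and a polytope becomes a polyhedral cone near the
  origin.
\<close>

section \<open>Isometries of the Klein model\<close>

text \<open>The obstacle is that the size of a spherical region is an outer measure built from
  \<open>hdist\<close> alone. Finiteness, positivity, measurability of half-spaces and nullity of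
  hyperplane sections all come from comparing it with the Lebesgue volume of cones. This comparison
  is only up to constants, which is enough for these facts. Independence of the radius needs an
  exact factor. It is available because a dilation between concentric spheres multiplies small
  distances by a ratio that tends to a constant, and Hausdorff measure only sees small distances.

  A second difficulty is that the angle at an edge or facet is defined at its relative interior,
  while the vertex identity compares cones at \<open>v\<close>. The angle of a cone does not change
  when the center of the sphere slides along the linear space contained in the cone, so every such
  angle may be evaluated at \<open>v\<close>.

  For \<open>k = d - 2\<close> no ridge angle has to be known: the terms with \<alpha>_{d-2} cancel,
  and a pure counting identity remains once facet angles are 1/2.\<close>

definition cofactor :: "'a::euclidean_space \<Rightarrow> real" where
  "cofactor a = sqrt (1 - a \<bullet> a)"

text \<open>Relativistic velocity addition, the hyperbolic translation that carries 0 to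
  \<open>a\<close>. In the numerator the component of \<open>z\<close> along \<open>a\<close> is
  kept and the orthogonal one is shrunk by \<open>s = cofactor a\<close>, because
  \<open>s + (1 - s^2) / (1 + s) = 1\<close>.\<close>

definition boost :: "'a::euclidean_space \<Rightarrow> 'a \<Rightarrow> 'a" where
  "boost a z = (1 / (1 + a \<bullet> z)) *\<^sub>R (a + cofactor a *\<^sub>R z + ((a \<bullet> z) / (1 + cofactor a)) *\<^sub>R a)"

lemma inner_self_less_1: "a \<in> hyp_space \<Longrightarrow> a \<bullet> a < 1"
  by (simp add: dot_square_norm abs_square_less_1)

lemma hyp_space_iff: "a \<in> hyp_space \<longleftrightarrow> a \<bullet> a < 1"
  by (simp add: dot_square_norm abs_square_less_1)

lemma cofactor_pos: "a \<in> hyp_space \<Longrightarrow> 0 < cofactor a"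
  using inner_self_less_1[of a] by (simp add: cofactor_def)

lemma cofactor_sq: "a \<in> hyp_space \<Longrightarrow> a \<bullet> a = 1 - cofactor a ^ 2"
  using inner_self_less_1[of a] by (simp add: cofactor_def)

lemma inner_hyp_less_1:
  assumes "a \<in> hyp_space" "z \<in> hyp_space"
  shows "\<bar>a \<bullet> z\<bar> < 1"
proof -
  have "\<bar>a \<bullet> z\<bar> \<le> norm a * norm z" by (rule Cauchy_Schwarz_ineq2)
  also have "\<dots> < 1 * 1" using assms by (intro mult_strict_mono') auto
  finally show ?thesis by simp
qed

text \<open>In homogeneous coordinates \<open>(1, z)\<close> is sent to the pair of denominator and
  numerator of \<open>boost a z\<close>, which is \<open>cofactor a\<close> times a Lorentz
  transformation. The identity is the resulting scaling of the Lorentz form.\<close>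

lemma inner_boost_numerators:
  fixes a z w :: "'a::euclidean_space"
  assumes a: "a \<in> hyp_space"
  defines "s \<equiv> cofactor a"
  shows "(a + s *\<^sub>R z + ((a \<bullet> z) / (1 + s)) *\<^sub>R a) \<bullet> (a + s *\<^sub>R w + ((a \<bullet> w) / (1 + s)) *\<^sub>R a) =
         (1 + a \<bullet> z) * (1 + a \<bullet> w) - s\<^sup>2 * (1 - z \<bullet> w)"
proof -
  define c where "c = 1 / (1 + s)"
  have s0: "s > 0" unfolding s_def by (rule cofactor_pos[OF a])
  have aa: "a \<bullet> a = 1 - s\<^sup>2" unfolding s_def by (rule cofactor_sq[OF a])
  have cs: "c * s = 1 - c" using s0 by (simp add: c_def field_simps)
  have c: "x / (1 + s) = c * x" for x by (simp add: c_def)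
  have caa: "c * (a \<bullet> a) = 1 - s"
    using s0 by (simp add: c_def aa field_simps power2_eq_square)
  have "(a + s *\<^sub>R z + (c * (a \<bullet> z)) *\<^sub>R a) \<bullet> (a + s *\<^sub>R w + (c * (a \<bullet> w)) *\<^sub>R a) =
     a \<bullet> a + (a \<bullet> w) * (s + c * (a \<bullet> a)) + (a \<bullet> z) * (s + c * (a \<bullet> a)) + s\<^sup>2 * (z \<bullet> w)
     + (a \<bullet> z) * (a \<bullet> w) * (c * s + c * s + c * (c * (a \<bullet> a)))"
    by (simp add: inner_add_left inner_add_right inner_commute algebra_simps power2_eq_square)
  also have "\<dots> = 1 - s\<^sup>2 + (a \<bullet> w) + (a \<bullet> z) + s\<^sup>2 * (z \<bullet> w)
     + (a \<bullet> z) * (a \<bullet> w) * (c * s + c * s + c * (1 - s))"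
    by (simp only: caa, simp only: aa, simp)
  also have "c * s + c * s + c * (1 - s) = 1" using cs by (simp add: algebra_simps)
  finally show ?thesis unfolding c by (simp add: algebra_simps)
qed

lemma one_minus_inner_boost:
  assumes "a \<in> hyp_space" "z \<in> hyp_space" "w \<in> hyp_space"
  shows "1 - boost a z \<bullet> boost a w = (cofactor a)\<^sup>2 * (1 - z \<bullet> w) / ((1 + a \<bullet> z) * (1 + a \<bullet> w))"
proof -
  have "1 + a \<bullet> z > 0" "1 + a \<bullet> w > 0"
    using inner_hyp_less_1[of a z] inner_hyp_less_1[of a w] assms by auto
  then show ?thesis
    unfolding boost_def inner_scaleR_left inner_scaleR_right inner_boost_numerators[OF assms(1)]
    by (simp add: diff_divide_distrib)
qed

lemma boost_in_hyp:
  assumes "a \<in> hyp_space" "z \<in> hyp_space"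
  shows "boost a z \<in> hyp_space"
proof -
  have "1 + a \<bullet> z > 0" using inner_hyp_less_1[of a z] assms by auto
  then have "(cofactor a)\<^sup>2 * (1 - z \<bullet> z) / ((1 + a \<bullet> z) * (1 + a \<bullet> z)) > 0"
    using cofactor_pos[OF assms(1)] inner_self_less_1[OF assms(2)] by simp
  then have "boost a z \<bullet> boost a z < 1"
    using one_minus_inner_boost[OF assms assms(2)] by linarith
  then show ?thesis unfolding hyp_space_iff .
qed

text \<open>The argument of \<open>arcosh\<close> is homogeneous of degree 0 in the homogeneous
  coordinates of each point, so the factors by which the boost rescales the Lorentz form
  cancel.\<close>

lemma hdist_boost:
  assumes "a \<in> hyp_space" "z \<in> hyp_space" "w \<in> hyp_space"
  shows "hdist (boost a z) (boost a w) = hdist z w"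
proof -
  define p where "p = 1 + a \<bullet> z"
  define q where "q = 1 + a \<bullet> w"
  define s where "s = cofactor a"
  have pq: "p > 0" "q > 0" using inner_hyp_less_1[of a z] inner_hyp_less_1[of a w] assms
    by (auto simp: p_def q_def)
  have s: "s > 0" unfolding s_def using assms by (intro cofactor_pos)
  have 1: "sqrt (1 - boost a z \<bullet> boost a z) = s * sqrt (1 - z \<bullet> z) / p"
    using one_minus_inner_boost[OF assms(1,2,2)] pq s
    by (simp add: p_def[symmetric] s_def[symmetric] real_sqrt_divide real_sqrt_mult)
  have 2: "sqrt (1 - boost a w \<bullet> boost a w) = s * sqrt (1 - w \<bullet> w) / q"
    using one_minus_inner_boost[OF assms(1,3,3)] pq s
    by (simp add: q_def[symmetric] s_def[symmetric] real_sqrt_divide real_sqrt_mult)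
  have 3: "1 - boost a z \<bullet> boost a w = s\<^sup>2 * (1 - z \<bullet> w) / (p * q)"
    using one_minus_inner_boost[OF assms] by (simp add: p_def q_def s_def)
  have "(1 - boost a z \<bullet> boost a w) / (sqrt (1 - boost a z \<bullet> boost a z) * sqrt (1 - boost a w \<bullet> boost a w))
    = (1 - z \<bullet> w) / (sqrt (1 - z \<bullet> z) * sqrt (1 - w \<bullet> w))"
  proof -
    have "s\<^sup>2 * (1 - z \<bullet> w) / (p * q) / (s * A / p * (s * B / q)) = (1 - z \<bullet> w) / (A * B)" for A B
      using pq s by (simp add: power2_eq_square)
    then show ?thesis unfolding 1 2 3 .
  qed
  then show ?thesis by (simp add: hdist_def)
qed

lemma boost_0 [simp]: "boost a 0 = a"
  by (simp add: boost_def)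

lemma boost_uminus_boost:
  assumes "a \<in> hyp_space" "z \<in> hyp_space"
  shows "boost (- a) (boost a z) = z"
proof -
  define s where "s = cofactor a"
  define c where "c = 1 / (1 + s)"
  define p where "p = 1 + a \<bullet> z"
  have s0: "s > 0" unfolding s_def by (rule cofactor_pos[OF assms(1)])
  have aa: "a \<bullet> a = 1 - s\<^sup>2" unfolding s_def by (rule cofactor_sq[OF assms(1)])
  have cs: "c * s = 1 - c" using s0 by (simp add: c_def field_simps)
  have caa: "c * (a \<bullet> a) = 1 - s"
    using s0 by (simp add: c_def aa field_simps power2_eq_square)
  have p: "p > 0" using inner_hyp_less_1[OF assms] by (auto simp: p_def)
  have sm: "cofactor (- a) = s" by (simp add: cofactor_def s_def)
  define N where "N = a + s *\<^sub>R z + (c * (a \<bullet> z)) *\<^sub>R a"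
  have bN: "boost a z = (1/p) *\<^sub>R N" by (simp add: boost_def N_def p_def c_def s_def)
  have aN: "a \<bullet> N = p - s\<^sup>2"
  proof -
    have "a \<bullet> N = a \<bullet> a + (a \<bullet> z) * (s + c * (a \<bullet> a))"
      by (simp add: N_def inner_add_right algebra_simps)
    then show ?thesis by (simp only: caa, simp only: aa, simp add: p_def)
  qed
  have den: "1 - a \<bullet> boost a z = s\<^sup>2 / p" using p by (simp add: bN aN field_simps)
  \<comment> \<open>Up to a scalar, the right-hand side is the numerator of the inverse boost at
    \<open>N / p\<close>; recognizing it as a multiple of \<open>z\<close> is the whole
    claim.\<close>
  have "s\<^sup>2 *\<^sub>R z = - p *\<^sub>R a + s *\<^sub>R N + (c * (p - s\<^sup>2)) *\<^sub>R a"
  proof -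
    have "- p *\<^sub>R a + s *\<^sub>R N + (c * (p - s\<^sup>2)) *\<^sub>R a =
       s\<^sup>2 *\<^sub>R z + (- p + s + s * c * (p - 1) + c * p - c * s * s) *\<^sub>R a"
      by (simp add: N_def p_def algebra_simps power2_eq_square)
    also have "- p + s + s * c * (p - 1) + c * p - c * s * s = 0"
    proof -
      have "- p + s + s * c * (p - 1) + c * p - c * s * s
        = - p + s + (c * s) * (p - 1) + c * p - (c * s) * s" by (simp add: algebra_simps)
      also have "\<dots> = c * s + c - 1" unfolding cs
        using cs by (simp add: algebra_simps)
      finally show ?thesis using cs by simp
    qed
    finally show ?thesis by simp
  qed
  then have z: "z = (1 / s\<^sup>2) *\<^sub>R (- p *\<^sub>R a + s *\<^sub>R N + (c * (p - s\<^sup>2)) *\<^sub>R a)"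
    using s0 by (metis (no_types, lifting) divide_self_if power_not_zero scaleR_one scaleR_scaleR times_divide_eq_left mult_1 less_irrefl)
  have "boost (-a) (boost a z) = (p / s\<^sup>2) *\<^sub>R (- a + s *\<^sub>R (1/p) *\<^sub>R N + (c * ((p - s\<^sup>2) / p)) *\<^sub>R a)"
    unfolding boost_def[of "-a"] sm inner_minus_left add_uminus_conv_diff den
    by (simp add: bN aN c_def)
  also have "\<dots> = (1 / s\<^sup>2) *\<^sub>R p *\<^sub>R (- a + s *\<^sub>R (1/p) *\<^sub>R N + (c * ((p - s\<^sup>2) / p)) *\<^sub>R a)"
    by simp
  also have "p *\<^sub>R (- a + s *\<^sub>R (1/p) *\<^sub>R N + (c * ((p - s\<^sup>2) / p)) *\<^sub>R a) = - p *\<^sub>R a + s *\<^sub>R N + (c * (p - s\<^sup>2)) *\<^sub>R a"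
  proof -
    have "p * (c * ((p - s\<^sup>2) / p)) = c * (p - s\<^sup>2)" using p by simp
    then show ?thesis using p by (simp only: scaleR_add_right scaleR_scaleR) simp
  qed
  finally show ?thesis using z by simp
qed

lemma boost_boost_uminus:
  assumes "a \<in> hyp_space" "z \<in> hyp_space"
  shows "boost a (boost (- a) z) = z"
  using boost_uminus_boost[of "- a" z] assms by simp

text \<open>Multiplying by the positive denominator makes the pulled-back half-space affine in
  \<open>z\<close>. The explicit coefficients later bound the radius below which a strict inequality
  persists.\<close>

lemma inner_boost_le_iff:
  assumes "a \<in> hyp_space" "z \<in> hyp_space"
  shows "h \<bullet> boost a z \<le> b \<longleftrightarrow>
    (h \<bullet> a - b) + (cofactor a *\<^sub>R h + ((h \<bullet> a) / (1 + cofactor a) - b) *\<^sub>R a) \<bullet> z \<le> 0"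
proof -
  have p: "1 + a \<bullet> z > 0" using inner_hyp_less_1[OF assms] by auto
  have "h \<bullet> boost a z \<le> b \<longleftrightarrow> h \<bullet> (a + cofactor a *\<^sub>R z + ((a \<bullet> z) / (1 + cofactor a)) *\<^sub>R a) \<le> b * (1 + a \<bullet> z)"
    using p by (simp add: boost_def divide_le_eq)
  then show ?thesis by (simp add: algebra_simps inner_add_right inner_commute)
qed

text \<open>Up to the factor \<open>cofactor a\<close>, the normal at the origin of the pull-back
  under \<open>boost a\<close> of a hyperplane through \<open>a\<close> with normal
  \<open>h\<close>. Self-adjointness (\<open>inner_tilt\<close>) lets it be moved from normals to
  directions.\<close>

definition tilt :: "'a::euclidean_space \<Rightarrow> 'a \<Rightarrow> 'a" where
  "tilt a h = h - ((h \<bullet> a) / (1 + cofactor a)) *\<^sub>R a"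

lemma inner_tilt: "tilt a h \<bullet> z = h \<bullet> tilt a z"
  by (simp add: tilt_def inner_diff_left inner_diff_right inner_commute)

text \<open>\<open>tilt a\<close> is the identity orthogonally to \<open>a\<close> and
  multiplication by \<open>cofactor a\<close> along \<open>a\<close>, hence injective.\<close>

lemma tilt_eq_0_iff:
  assumes "a \<in> hyp_space"
  shows "tilt a h = 0 \<longleftrightarrow> h = 0"
proof
  assume "tilt a h = 0"
  then have h: "h = ((h \<bullet> a) / (1 + cofactor a)) *\<^sub>R a" by (simp add: tilt_def)
  then have "h \<bullet> a = (h \<bullet> a) / (1 + cofactor a) * (a \<bullet> a)"
    by (metis inner_scaleR_left)
  also have "\<dots> = (h \<bullet> a) * (1 - cofactor a)"
    using cofactor_pos[OF assms] by (simp add: cofactor_sq[OF assms] field_simps power2_eq_square)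
  finally have "(h \<bullet> a) * cofactor a = 0" by (simp add: algebra_simps)
  then have "h \<bullet> a = 0" using cofactor_pos[OF assms] by simp
  with h show "h = 0" by simp
qed (simp add: tilt_def)

lemma inner_boost_le_iff_tilt:
  assumes "a \<in> hyp_space" "z \<in> hyp_space" and b: "h \<bullet> a = b"
  shows "h \<bullet> boost a z \<le> b \<longleftrightarrow> tilt a h \<bullet> z \<le> 0"
proof -
  define s where "s = cofactor a"
  have s: "s > 0" using cofactor_pos[OF assms(1)] by (simp add: s_def)
  have "b / (1 + s) - b = - s * (b / (1 + s))"
    using s by (simp add: field_simps)
  then have "s *\<^sub>R h + (b / (1 + s) - b) *\<^sub>R a = s *\<^sub>R tilt a h"
    unfolding tilt_def b s_def[symmetric] by (simp add: scaleR_diff_right)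
  then show ?thesis
    unfolding inner_boost_le_iff[OF assms(1,2)] b s_def[symmetric] using s
    by (simp add: mult_le_0_iff)
qed

section \<open>Hyperbolic distance on spheres around the origin\<close>

lemma hdist_0:
  assumes "y \<in> hyp_space"
  shows "cosh (hdist 0 y) = 1 / cofactor y" "hdist 0 y \<ge> 0"
proof -
  have "cofactor y \<le> 1" "0 < cofactor y" using cofactor_pos[OF assms]
    by (auto simp: cofactor_def)
  then have "1 / cofactor y \<ge> 1" by simp
  then show "cosh (hdist 0 y) = 1 / cofactor y" "hdist 0 y \<ge> 0"
    by (auto simp: hdist_def cofactor_def)
qed

lemma hsphere_0:
  assumes "r > 0"
  shows "hsphere (0::'a::euclidean_space) r = sphere 0 (tanh r)"
proof -
  have t: "0 < tanh r" "tanh r < 1" using assms by (auto simp: tanh_real_lt_1)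
  have 1: "hdist 0 y = r \<longleftrightarrow> norm y = tanh r" if y: "y \<in> hyp_space" for y :: 'a
  proof -
    have "hdist 0 y = r \<longleftrightarrow> cosh (hdist 0 y) = cosh r"
      using hdist_0(2)[OF y] assms
      by (metis arcosh_cosh_real less_imp_le)
    also have "\<dots> \<longleftrightarrow> cofactor y = 1 / cosh r"
      unfolding hdist_0(1)[OF y] using cofactor_pos[OF y] cosh_real_pos[of r] by (auto simp: field_simps)
    also have "\<dots> \<longleftrightarrow> (cofactor y)\<^sup>2 = (1 / cosh r)\<^sup>2"
      using cofactor_pos[OF y] cosh_real_pos[of r]
      by (intro power2_eq_iff_nonneg[symmetric]) auto
    also have "\<dots> \<longleftrightarrow> (norm y)\<^sup>2 = 1 - (1 / cosh r)\<^sup>2"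
      using cofactor_sq[OF y] by (auto simp: dot_square_norm)
    also have "1 - (1 / cosh r)\<^sup>2 = (tanh r)\<^sup>2"
    proof -
      have "cosh r \<noteq> 0" using cosh_real_pos[of r] by simp
      then have "1 - (1 / cosh r)\<^sup>2 = ((cosh r)\<^sup>2 - 1) / (cosh r)\<^sup>2"
        by (simp add: power_divide diff_divide_distrib)
      then show ?thesis by (simp add: cosh_square_eq tanh_def power_divide)
    qed
    also have "(norm y)\<^sup>2 = (tanh r)\<^sup>2 \<longleftrightarrow> norm y = tanh r"
      using t by (intro power2_eq_iff_nonneg) auto
    finally show ?thesis .
  qed
  have "y \<in> hsphere 0 r \<longleftrightarrow> y \<in> sphere 0 (tanh r)" for y :: 'a
  proof (cases "y \<in> hyp_space")
    case True
    then show ?thesis using 1[OF True] by (simp add: hsphere_def dist_norm)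
  next
    case False
    then show ?thesis using t by (auto simp: hsphere_def dist_norm)
  qed
  then show ?thesis by blast
qed

text \<open>On a sphere around 0 the two square roots agree, and
  \<open>cosh t = 1 + 2 * sinh (t / 2) ^ 2\<close> makes the distance a function of the chord alone.
  All metric estimates on spheres rest on this formula.\<close>

lemma hdist_on_sphere:
  fixes x y :: "'a::euclidean_space"
  assumes "norm x = \<rho>" "norm y = \<rho>" "0 < \<rho>" "\<rho> < 1"
  shows "sinh (hdist x y / 2) = dist x y / (2 * sqrt (1 - \<rho>\<^sup>2))" and "hdist x y \<ge> 0"
proof -
  define s where "s = sqrt (1 - \<rho>\<^sup>2)"
  have r2: "\<rho>\<^sup>2 < 1" using assms by (simp add: abs_square_less_1)
  have s: "s > 0" "s\<^sup>2 = 1 - \<rho>\<^sup>2" using r2 by (auto simp: s_def)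
  have xx: "x \<bullet> x = \<rho>\<^sup>2" "y \<bullet> y = \<rho>\<^sup>2" using assms by (auto simp: dot_square_norm)
  have d: "(dist x y)\<^sup>2 = 2 * \<rho>\<^sup>2 - 2 * (x \<bullet> y)"
    unfolding dist_norm power2_norm_eq_inner
    by (simp add: inner_diff_left inner_diff_right xx inner_commute)
  define Q where "Q = (1 - x \<bullet> y) / (sqrt (1 - x \<bullet> x) * sqrt (1 - y \<bullet> y))"
  have Q: "Q = 1 + 2 * (dist x y / (2 * s))\<^sup>2"
  proof -
    have "Q = (1 - x \<bullet> y) / s\<^sup>2" unfolding Q_def xx s_def[symmetric] by (simp add: power2_eq_square)
    also have "\<dots> = 1 + ((dist x y)\<^sup>2 / 2) / s\<^sup>2"
      using s by (simp add: d field_simps)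
    finally show ?thesis by (simp add: power_divide power_mult_distrib)
  qed
  then have Q1: "Q \<ge> 1" by simp
  have D: "cosh (hdist x y) = Q" "hdist x y \<ge> 0" using Q1 by (auto simp: hdist_def Q_def[symmetric])
  show "hdist x y \<ge> 0" by (rule D)
  have "cosh (2 * (hdist x y / 2)) = 2 * (sinh (hdist x y / 2))\<^sup>2 + 1"
    unfolding cosh_double_cosh by (simp add: cosh_square_eq)
  then have "(sinh (hdist x y / 2))\<^sup>2 = (dist x y / (2 * s))\<^sup>2" using D(1) Q by simp
  then show "sinh (hdist x y / 2) = dist x y / (2 * sqrt (1 - \<rho>\<^sup>2))"
    unfolding s_def[symmetric] using D(2) s
    by (subst (asm) power2_eq_iff_nonneg) auto
qed

section \<open>Hyperbolic Hausdorff measure\<close>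

definition diam_term :: "nat \<Rightarrow> 'a::euclidean_space set \<Rightarrow> ennreal" where
  "diam_term s E = (if E = {} then 0 else hdiam E ^ s)"

definition hcovers :: "real \<Rightarrow> 'a::euclidean_space set \<Rightarrow> (nat \<Rightarrow> 'a set) set" where
  "hcovers \<delta> A = {E. A \<subseteq> (\<Union>i. E i) \<and> (\<forall>i. E i \<subseteq> hyp_space \<and> hdiam (E i) \<le> ennreal \<delta>)}"

lemma hausdorff_pre_eq: "hausdorff_pre s \<delta> A = (INF E\<in>hcovers \<delta> A. \<Sum>i. diam_term s (E i))"
  by (simp add: hausdorff_pre_def hcovers_def diam_term_def)

lemma hdiam_mono: "E \<subseteq> F \<Longrightarrow> hdiam E \<le> hdiam F"
  unfolding hdiam_def by (intro SUP_subset_mono) auto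

lemma hdist_le_hdiam: "x \<in> E \<Longrightarrow> y \<in> E \<Longrightarrow> ennreal (hdist x y) \<le> hdiam E"
  unfolding hdiam_def by (intro SUP_upper2[of x] SUP_upper2[of y]) auto

lemma hdiam_leI: "(\<And>x y. x \<in> E \<Longrightarrow> y \<in> E \<Longrightarrow> ennreal (hdist x y) \<le> c) \<Longrightarrow> hdiam E \<le> c"
  unfolding hdiam_def by (intro SUP_least) auto

lemma hdiam_empty [simp]: "hdiam {} = 0"
  by (simp add: hdiam_def bot_ennreal)

lemma diam_term_empty [simp]: "diam_term s {} = 0"
  by (simp add: diam_term_def)

lemma hcovers_mono: "A \<subseteq> B \<Longrightarrow> hcovers \<delta> B \<subseteq> hcovers \<delta> A"
  by (auto simp: hcovers_def)

lemma hcovers_mono_delta: "\<delta> \<le> \<delta>' \<Longrightarrow> hcovers \<delta> B \<subseteq> hcovers \<delta>' B"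
  unfolding hcovers_def using ennreal_leI order_trans by blast

lemma hausdorff_pre_mono: "A \<subseteq> B \<Longrightarrow> hausdorff_pre s \<delta> A \<le> hausdorff_pre s \<delta> B"
  unfolding hausdorff_pre_eq by (rule INF_superset_mono[OF hcovers_mono]) auto

lemma hausdorff_pre_antimono: "\<delta> \<le> \<delta>' \<Longrightarrow> hausdorff_pre s \<delta>' A \<le> hausdorff_pre s \<delta> A"
  unfolding hausdorff_pre_eq by (rule INF_superset_mono[OF hcovers_mono_delta]) auto

lemma hausdorff_hyp_mono: "A \<subseteq> B \<Longrightarrow> hausdorff_hyp s A \<le> hausdorff_hyp s B"
  unfolding hausdorff_hyp_def by (intro SUP_mono') (auto intro: hausdorff_pre_mono)

lemma hausdorff_pre_le_hyp: "\<delta> > 0 \<Longrightarrow> hausdorff_pre s \<delta> A \<le> hausdorff_hyp s A"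
  unfolding hausdorff_hyp_def by (intro SUP_upper) auto

lemma hausdorff_pre_empty: "hausdorff_pre s \<delta> {} = 0"
proof -
  have "(\<lambda>_. {}) \<in> hcovers \<delta> {}" by (simp add: hcovers_def)
  then have "hausdorff_pre s \<delta> ({} :: 'a set) \<le> (\<Sum>i. diam_term s ((\<lambda>_. {} :: 'a set) i))" for s
    unfolding hausdorff_pre_eq by (rule INF_lower)
  then show ?thesis by simp
qed

lemma hausdorff_hyp_empty [simp]: "hausdorff_hyp s {} = 0"
  by (simp add: hausdorff_hyp_def hausdorff_pre_empty bot_ennreal)

lemma hausdorff_pre_countable_subadd:
  "hausdorff_pre s \<delta> (\<Union>n. A n) \<le> (\<Sum>n. hausdorff_pre s \<delta> (A n))"
proof (rule ennreal_le_epsilon)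
  fix e :: real assume e: "0 < e" and fin: "(\<Sum>n. hausdorff_pre s \<delta> (A n)) < top"
  then have *: "\<And>n. hausdorff_pre s \<delta> (A n) < hausdorff_pre s \<delta> (A n) + e * (1/2)^Suc n"
    by (auto simp add: less_top dest!: ennreal_suminf_lessD)
  have "\<exists>E \<in> hcovers \<delta> (A n). (\<Sum>i. diam_term s (E i)) \<le> hausdorff_pre s \<delta> (A n) + e * (1/2)^Suc n" for n
    using *[of n] unfolding hausdorff_pre_eq[of s \<delta> "A n"] INF_less_iff by (meson less_imp_le)
  then obtain B where B: "\<And>n. B n \<in> hcovers \<delta> (A n)"
    and Ble: "\<And>n. (\<Sum>i. diam_term s (B n i)) \<le> hausdorff_pre s \<delta> (A n) + e * (1/2)^Suc n"
    by metis
  define C where "C = case_prod B o prod_decode"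
  have "C \<in> hcovers \<delta> (\<Union>n. A n)"
  proof -
    have "(\<Union>n. A n) \<subseteq> (\<Union>i. C i)"
    proof
      fix x assume "x \<in> (\<Union>n. A n)"
      then obtain n where "x \<in> A n" by auto
      then obtain i where "x \<in> B n i" using B[of n] by (auto simp: hcovers_def)
      then have "x \<in> C (prod_encode (n, i))" by (simp add: C_def)
      then show "x \<in> (\<Union>i. C i)" by blast
    qed
    then show ?thesis using B by (auto simp: hcovers_def C_def split: prod.splits)
  qed
  then have "hausdorff_pre s \<delta> (\<Union>n. A n) \<le> (\<Sum>i. diam_term s (C i))"
    unfolding hausdorff_pre_eq by (rule INF_lower)
  also have "\<dots> = (\<Sum>n. \<Sum>i. diam_term s (B n i))"
    using suminf_ennreal_2dimen[of "\<lambda>n. \<Sum>i. diam_term s (B n i)" "\<lambda>(n,i). diam_term s (B n i)"]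
    by (simp add: C_def split_def)
  also have "\<dots> \<le> (\<Sum>n. hausdorff_pre s \<delta> (A n) + e * (1/2) ^ Suc n)"
    by (intro suminf_le allI Ble) auto
  also have "... = (\<Sum>n. hausdorff_pre s \<delta> (A n)) + (\<Sum>n. ennreal e * ennreal ((1/2) ^ Suc n))"
    using \<open>0 < e\<close> by (subst suminf_add[symmetric])
                     (auto simp del: ennreal_suminf_cmult simp add: ennreal_mult[symmetric])
  also have "\<dots> = (\<Sum>n. hausdorff_pre s \<delta> (A n)) + e"
    unfolding ennreal_suminf_cmult
    by (subst suminf_ennreal_eq[OF zero_le_power power_half_series]) auto
  finally show "hausdorff_pre s \<delta> (\<Union>n. A n) \<le> (\<Sum>n. hausdorff_pre s \<delta> (A n)) + e" .
qed

lemma hausdorff_hyp_countable_subadd: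
  "hausdorff_hyp s (\<Union>n. A n) \<le> (\<Sum>n. hausdorff_hyp s (A n))"
proof -
  have "hausdorff_pre s \<delta> (\<Union>n. A n) \<le> (\<Sum>n. hausdorff_hyp s (A n))" if "\<delta> > 0" for \<delta>
    by (rule order_trans[OF hausdorff_pre_countable_subadd])
       (auto intro!: suminf_le hausdorff_pre_le_hyp that)
  then show ?thesis unfolding hausdorff_hyp_def[of s "\<Union>n. A n"] by (intro SUP_least) auto
qed

lemma hausdorff_hyp_subadd: "hausdorff_hyp s (A \<union> B) \<le> hausdorff_hyp s A + hausdorff_hyp s B"
proof -
  define F where "F = (\<lambda>n::nat. if n = 0 then A else if n = 1 then B else {})"
  have "(\<Union>n. F n) = A \<union> B" by (auto simp: F_def split: if_splits)
  moreover have "(\<Sum>n. hausdorff_hyp s (F n)) = (\<Sum>n\<in>{0,1}. hausdorff_hyp s (F n))"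
    by (rule suminf_finite) (auto simp: F_def)
  ultimately show ?thesis using hausdorff_hyp_countable_subadd[of s F] by (simp add: F_def)
qed

lemma le_cmult_INF_ennreal:
  fixes f :: "'i \<Rightarrow> ennreal"
  assumes "c > 0" "\<And>i. i \<in> I \<Longrightarrow> x \<le> ennreal c * f i"
  shows "x \<le> ennreal c * (INF i\<in>I. f i)"
proof -
  have "x / ennreal c \<le> (INF i\<in>I. f i)"
    using assms by (intro INF_greatest divide_le_posI_ennreal) auto
  then have "ennreal c * (x / ennreal c) \<le> ennreal c * (INF i\<in>I. f i)"
    by (rule mult_left_mono) simp
  moreover have "ennreal c * (x / ennreal c) = x"
    using assms(1) by (simp add: ennreal_times_divide mult.commute[of _ x] mult_divide_eq_ennreal)
  ultimately show ?thesis by simp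
qed

text \<open>A Lipschitz bound at distances up to \<open>\<delta>0\<close> suffices because Hausdorff
  measure is determined by arbitrarily fine covers. Hence the constant may approach the
  infinitesimal distortion of the map.\<close>

lemma hausdorff_hyp_lipschitz:
  assumes L: "L > 0" and \<delta>0: "\<delta>0 > 0" and f: "f ` A \<subseteq> hyp_space"
    and lip: "\<And>x y. x \<in> A \<Longrightarrow> y \<in> A \<Longrightarrow> hdist x y \<le> \<delta>0 \<Longrightarrow> hdist (f x) (f y) \<le> L * hdist x y"
  shows "hausdorff_hyp s (f ` A) \<le> ennreal (L ^ s) * hausdorff_hyp s A"
proof -
  have "hausdorff_pre s \<delta> (f ` A) \<le> ennreal (L ^ s) * hausdorff_hyp s A" if \<delta>: "\<delta> > 0" for \<delta>
  proof -
    \<comment> \<open>Pieces of this diameter obey the local Lipschitz bound, and their images have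
      diameter at most \<open>\<delta>\<close>.\<close>
    define \<delta>' where "\<delta>' = min \<delta>0 (\<delta> / L)"
    have \<delta>': "\<delta>' > 0" "\<delta>' \<le> \<delta>0" "L * \<delta>' \<le> \<delta>"
      using \<delta> \<delta>0 L by (auto simp: \<delta>'_def min_def field_simps)
    have "hausdorff_pre s \<delta> (f ` A) \<le> ennreal (L ^ s) * hausdorff_pre s \<delta>' A"
      unfolding hausdorff_pre_eq[of s \<delta>']
    proof (rule le_cmult_INF_ennreal)
      fix E assume E: "E \<in> hcovers \<delta>' A"
      define F where "F i = f ` (E i \<inter> A)" for i
      have d: "hdiam (F i) \<le> ennreal L * hdiam (E i)" for i
      proof (rule hdiam_leI)
        fix u v assume "u \<in> F i" "v \<in> F i"
        then obtain x y where xy: "x \<in> E i" "x \<in> A" "u = f x" "y \<in> E i" "y \<in> A" "v = f y"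
          by (auto simp: F_def)
        have h: "ennreal (hdist x y) \<le> hdiam (E i)" using xy by (intro hdist_le_hdiam) auto
        also have "hdiam (E i) \<le> ennreal \<delta>'" using E by (auto simp: hcovers_def)
        finally have "hdist x y \<le> \<delta>'" using \<delta>' by simp
        then have "hdist u v \<le> L * hdist x y" using lip[of x y] xy \<delta>' by auto
        then have "ennreal (hdist u v) \<le> ennreal (L * hdist x y)" by (rule ennreal_leI)
        also have "\<dots> = ennreal L * ennreal (hdist x y)" using L by (intro ennreal_mult') auto
        also have "\<dots> \<le> ennreal L * hdiam (E i)" using h by (rule mult_left_mono) auto
        finally show "ennreal (hdist u v) \<le> ennreal L * hdiam (E i)" .
      qed
      have "F \<in> hcovers \<delta> (f ` A)"
      proof -
        have "hdiam (F i) \<le> ennreal \<delta>" for i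
        proof -
          have "hdiam (F i) \<le> ennreal L * ennreal \<delta>'"
            using E by (intro order_trans[OF d] mult_left_mono) (auto simp: hcovers_def)
          also have "\<dots> = ennreal (L * \<delta>')" using L by (intro ennreal_mult'[symmetric]) auto
          also have "\<dots> \<le> ennreal \<delta>" using \<delta>' by (intro ennreal_leI)
          finally show ?thesis .
        qed
        moreover have "f ` A \<subseteq> (\<Union>i. F i)" using E by (fastforce simp: F_def hcovers_def)
        moreover have "F i \<subseteq> hyp_space" for i using f by (auto simp: F_def)
        ultimately show ?thesis by (auto simp: hcovers_def)
      qed
      then have "hausdorff_pre s \<delta> (f ` A) \<le> (\<Sum>i. diam_term s (F i))"
        unfolding hausdorff_pre_eq by (rule INF_lower)
      also have "\<dots> \<le> (\<Sum>i. ennreal (L ^ s) * diam_term s (E i))"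
      proof (intro suminf_le)
        fix i
        have "hdiam (F i) ^ s \<le> (ennreal L * hdiam (E i)) ^ s" by (intro power_mono_ennreal d)
        also have "\<dots> = ennreal (L ^ s) * hdiam (E i) ^ s"
          using L by (simp add: power_mult_distrib ennreal_power)
        finally show "diam_term s (F i) \<le> ennreal (L ^ s) * diam_term s (E i)"
          by (auto simp: diam_term_def F_def)
      qed auto
      finally show "hausdorff_pre s \<delta> (f ` A) \<le> ennreal (L ^ s) * (\<Sum>i. diam_term s (E i))" by simp
    qed (use L in simp)
    also have "\<dots> \<le> ennreal (L ^ s) * hausdorff_hyp s A"
      by (intro mult_left_mono hausdorff_pre_le_hyp \<delta>') simp
    finally show ?thesis .
  qed
  then show ?thesis unfolding hausdorff_hyp_def[of s "f ` A"] by (intro SUP_least) auto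
qed

lemma hausdorff_hyp_isometry:
  assumes f: "\<And>x. x \<in> A \<Longrightarrow> f x \<in> hyp_space" and A: "A \<subseteq> hyp_space"
    and iso: "\<And>x y. x \<in> A \<Longrightarrow> y \<in> A \<Longrightarrow> hdist (f x) (f y) = hdist x y"
    and g: "\<And>x. x \<in> A \<Longrightarrow> g (f x) = x"
  shows "hausdorff_hyp s (f ` A) = hausdorff_hyp s A"
proof (rule antisym)
  show "hausdorff_hyp s (f ` A) \<le> hausdorff_hyp s A"
    using hausdorff_hyp_lipschitz[of 1 1 f A s] f iso by (simp add: image_subset_iff)
  have "g ` f ` A = A" using g by (force simp: image_image)
  then show "hausdorff_hyp s A \<le> hausdorff_hyp s (f ` A)"
    using hausdorff_hyp_lipschitz[of 1 1 g "f ` A" s] A iso g by (simp add: image_iff) force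
qed

text \<open>Hausdorff measure is a metric outer measure: no piece of a cover finer than the gap
  meets both sets, so the cover splits into two.\<close>

lemma hausdorff_hyp_separated:
  assumes \<eta>: "\<eta> > 0" and sep: "\<And>x y. x \<in> A \<Longrightarrow> y \<in> B \<Longrightarrow> hdist x y \<ge> \<eta>"
  shows "hausdorff_hyp s A + hausdorff_hyp s B \<le> hausdorff_hyp s (A \<union> B)"
proof -
  have pre: "hausdorff_pre s \<delta> A + hausdorff_pre s \<delta> B \<le> hausdorff_pre s \<delta> (A \<union> B)"
    if \<delta>: "\<delta> > 0" "\<delta> < \<eta>" for \<delta>
    unfolding hausdorff_pre_eq[of s \<delta> "A \<union> B"]
  proof (rule INF_greatest)
    fix E assume E: "E \<in> hcovers \<delta> (A \<union> B)"
    define F where "F i = (if E i \<inter> A = {} then {} else E i)" for i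
    define G where "G i = (if E i \<inter> B = {} then {} else E i)" for i
    have F: "F \<in> hcovers \<delta> A" and G: "G \<in> hcovers \<delta> B"
      using E by (fastforce simp: hcovers_def F_def G_def)+
    have disj: "E i \<inter> A = {} \<or> E i \<inter> B = {}" for i
    proof (rule ccontr)
      assume "\<not> ?thesis"
      then obtain x y where xy: "x \<in> E i" "x \<in> A" "y \<in> E i" "y \<in> B" by auto
      have "ennreal (hdist x y) \<le> ennreal \<delta>"
        using hdist_le_hdiam[OF xy(1,3)] E by (auto simp: hcovers_def intro: order_trans)
      then have "hdist x y \<le> \<delta>" using \<delta> by simp
      with sep[OF xy(2,4)] \<delta> show False by simp
    qed
    have "hausdorff_pre s \<delta> A + hausdorff_pre s \<delta> B \<le> (\<Sum>i. diam_term s (F i)) + (\<Sum>i. diam_term s (G i))"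
      using F G unfolding hausdorff_pre_eq by (intro add_mono INF_lower)
    also have "\<dots> = (\<Sum>i. diam_term s (F i) + diam_term s (G i))"
      by (rule suminf_add) auto
    also have "\<dots> \<le> (\<Sum>i. diam_term s (E i))"
      using disj by (intro suminf_le) (auto simp: F_def G_def)
    finally show "hausdorff_pre s \<delta> A + hausdorff_pre s \<delta> B \<le> (\<Sum>i. diam_term s (E i))" .
  qed
  have "hausdorff_hyp s A + hausdorff_hyp s B = (SUP \<delta>\<in>{0<..}. hausdorff_pre s \<delta> A + hausdorff_pre s \<delta> B)"
    unfolding hausdorff_hyp_def
  proof (rule SUP_add_directed_ennreal[symmetric])
    fix i j :: real assume "i \<in> {0<..}" "j \<in> {0<..}"
    then show "\<exists>k\<in>{0<..}. hausdorff_pre s i A + hausdorff_pre s j B \<le> hausdorff_pre s k A + hausdorff_pre s k B"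
      by (intro bexI[of _ "min i j"] add_mono hausdorff_pre_antimono) auto
  qed
  also have "\<dots> \<le> hausdorff_hyp s (A \<union> B)"
  proof (rule SUP_least)
    fix \<delta> :: real assume d: "\<delta> \<in> {0<..}"
    define k where "k = min \<delta> (\<eta> / 2)"
    have k: "k > 0" "k < \<eta>" "k \<le> \<delta>" using d \<eta> by (auto simp: k_def)
    have "hausdorff_pre s \<delta> A + hausdorff_pre s \<delta> B \<le> hausdorff_pre s k A + hausdorff_pre s k B"
      by (intro add_mono hausdorff_pre_antimono k)
    also have "\<dots> \<le> hausdorff_pre s k (A \<union> B)" by (rule pre[OF k(1,2)])
    also have "\<dots> \<le> hausdorff_hyp s (A \<union> B)" by (rule hausdorff_pre_le_hyp[OF k(1)])
    finally show "hausdorff_pre s \<delta> A + hausdorff_pre s \<delta> B \<le> hausdorff_hyp s (A \<union> B)" .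
  qed
  finally show ?thesis .
qed

section \<open>Hausdorff measure on spheres\<close>

lemma sinh_ge_self:
  fixes x :: real
  assumes "x \<ge> 0"
  shows "x \<le> sinh x"
proof -
  have "sinh 0 - 0 \<le> sinh x - x"
  proof (rule DERIV_nonneg_imp_nondecreasing[OF assms, of "\<lambda>x. sinh x - x"])
    fix t :: real
    have "((\<lambda>x. sinh x - x) has_real_derivative (cosh t - 1)) (at t)"
      by (auto intro!: derivative_eq_intros)
    then show "\<exists>y. ((\<lambda>x. sinh x - x) has_real_derivative y) (at t) \<and> 0 \<le> y"
      using cosh_real_ge_1[of t] by auto
  qed
  then show ?thesis by simp
qed

text \<open>The derivative of \<open>sinh\<close> at 0 is 1, so chord and hyperbolic distance are
  nearly proportional at small scale. \<open>e = 1\<close> serves for comparison up to a factor;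
  letting \<open>e\<close> tend to 0 gives exact scaling.\<close>

lemma sinh_le_near_0:
  fixes e :: real
  assumes "e > 0"
  obtains \<delta> where "\<delta> > 0" "\<And>x. 0 \<le> x \<Longrightarrow> x \<le> \<delta> \<Longrightarrow> sinh x \<le> (1 + e) * x"
proof -
  have "((sinh :: real \<Rightarrow> real) has_field_derivative 1) (at 0)"
    by (auto intro!: derivative_eq_intros)
  then have "((\<lambda>x::real. sinh x / x) \<longlongrightarrow> 1) (at 0)"
    by (simp add: has_field_derivative_iff)
  from LIM_D[OF this assms] obtain d where
    d': "0 < d \<and> (\<forall>x::real. x \<noteq> 0 \<and> norm (x - 0) < d \<longrightarrow> norm (sinh x / x - 1) < e)" ..
  then have d: "d > 0" ..
  show ?thesis
  proof (rule that)
    show "d / 2 > 0" using d by simp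
    fix x :: real assume x: "0 \<le> x" "x \<le> d / 2"
    show "sinh x \<le> (1 + e) * x"
    proof (cases "x = 0")
      case True
      then show ?thesis by simp
    next
      case False
      then have x0: "x > 0" using x by simp
      have "x < d" using x d by linarith
      then have "x \<noteq> 0 \<and> norm (x - 0) < d" using x0 by simp
      then have "norm (sinh x / x - 1) < e" using conjunct2[OF d'] by (simp only: simp_thms)
      then have "sinh x / x < 1 + e" unfolding real_norm_def by linarith
      then have "sinh x < (1 + e) * x" using x0 by (simp only: pos_divide_less_eq)
      then show ?thesis by (rule less_imp_le)
    qed
  qed
qed

text \<open>Makes the volume of a conic shell at most linear in its thickness.\<close>

lemma power_diff_le:
  fixes a b :: real
  assumes "0 \<le> b" "b \<le> a"
  shows "a ^ n - b ^ n \<le> real n * a ^ (n - 1) * (a - b)"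
proof -
  have "a ^ n - b ^ n = (a - b) * (\<Sum>i<n. b ^ (n - Suc i) * a ^ i)"
    by (rule power_diff_sumr2)
  also have "\<dots> \<le> (a - b) * (\<Sum>i<n. a ^ (n - 1))"
  proof (intro mult_left_mono sum_mono)
    fix i assume "i \<in> {..<n}"
    then have "b ^ (n - Suc i) * a ^ i \<le> a ^ (n - Suc i) * a ^ i" "n - Suc i + i = n - 1"
      using assms by (auto intro!: mult_right_mono power_mono)
    then show "b ^ (n - Suc i) * a ^ i \<le> a ^ (n - 1)"
      by (metis power_add)
  qed (use assms in auto)
  finally show ?thesis by (simp add: mult_ac)
qed

section \<open>Comparison of chordal and hyperbolic distance\<close>

locale hyp_sphere =
  fixes \<rho> :: real
  assumes rho: "0 < \<rho>" "\<rho> < 1"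
begin

abbreviation \<sigma> :: real where "\<sigma> \<equiv> sqrt (1 - \<rho>\<^sup>2)"

lemma sigma_pos: "\<sigma> > 0"
  using rho by (simp add: abs_square_less_1)

lemma sphere_subset_hyp: "sphere 0 \<rho> \<subseteq> hyp_space"
  using rho by auto

lemma sinh_half_hdist:
  assumes "x \<in> sphere 0 \<rho>" "y \<in> sphere 0 \<rho>"
  shows "sinh (hdist x y / 2) = dist x y / (2 * \<sigma>)"
  using hdist_on_sphere(1)[of x \<rho> y] assms rho by auto

lemma hdist_nonneg_sphere:
  assumes "x \<in> sphere 0 \<rho>" "y \<in> sphere 0 \<rho>"
  shows "hdist x y \<ge> 0"
  using hdist_on_sphere(2)[of x \<rho> y] assms rho by auto

lemma hdist_le_dist:
  assumes "x \<in> sphere 0 \<rho>" "y \<in> sphere 0 \<rho>"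
  shows "hdist x y \<le> dist x y / \<sigma>"
  using sinh_ge_self[of "hdist x y / 2"] sinh_half_hdist[OF assms] hdist_nonneg_sphere[OF assms]
  by simp

lemma dist_le_hdist:
  obtains \<delta> where "\<delta> > 0"
    "\<And>x y::'a::euclidean_space. x \<in> sphere 0 \<rho> \<Longrightarrow> y \<in> sphere 0 \<rho> \<Longrightarrow> hdist x y \<le> \<delta> \<Longrightarrow> dist x y \<le> 2 * \<sigma> * hdist x y"
proof -
  obtain \<delta> :: real where \<delta>: "\<delta> > 0" "\<And>x. 0 \<le> x \<Longrightarrow> x \<le> \<delta> \<Longrightarrow> sinh x \<le> (1 + 1) * x"
    using sinh_le_near_0[of 1] by auto
  have "dist x y \<le> 2 * \<sigma> * hdist x y"
    if "x \<in> sphere 0 \<rho>" "y \<in> sphere 0 \<rho>" "hdist x y \<le> \<delta>" for x y :: 'a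
  proof -
    have "dist x y / (2 * \<sigma>) \<le> hdist x y"
      using \<delta>(2)[of "hdist x y / 2"] hdist_nonneg_sphere[OF that(1,2)] that(3)
      unfolding sinh_half_hdist[OF that(1,2)] by simp
    then show ?thesis using sigma_pos by (simp add: divide_le_eq mult_ac)
  qed
  then show ?thesis using \<delta>(1) that by blast
qed

text \<open>Turns a Euclidean gap into the hyperbolic gap that
  \<open>hausdorff_hyp_separated\<close> asks for.\<close>

lemma hdist_ge_of_dist_ge:
  assumes "\<epsilon> > 0"
  obtains \<eta> where "\<eta> > 0"
    "\<And>x y::'a::euclidean_space. x \<in> sphere 0 \<rho> \<Longrightarrow> y \<in> sphere 0 \<rho> \<Longrightarrow> dist x y \<ge> \<epsilon> \<Longrightarrow> hdist x y \<ge> \<eta>"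
proof -
  obtain \<delta> where \<delta>: "\<delta> > 0"
    "\<And>x y::'a. x \<in> sphere 0 \<rho> \<Longrightarrow> y \<in> sphere 0 \<rho> \<Longrightarrow> hdist x y \<le> \<delta> \<Longrightarrow> dist x y \<le> 2 * \<sigma> * hdist x y"
    using dist_le_hdist by blast
  define \<eta> where "\<eta> = min \<delta> (\<epsilon> / (2 * \<sigma>))"
  have "hdist x y \<ge> \<eta>"
    if xy: "x \<in> sphere 0 \<rho>" "y \<in> sphere 0 \<rho>" "dist x y \<ge> \<epsilon>" for x y :: 'a
  proof (rule ccontr)
    assume "\<not> ?thesis"
    then have *: "hdist x y < \<delta>" "hdist x y < \<epsilon> / (2 * \<sigma>)" by (auto simp: \<eta>_def)
    then have "dist x y \<le> 2 * \<sigma> * hdist x y" using \<delta>(2)[OF xy(1,2)] by simp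
    also have "\<dots> < 2 * \<sigma> * (\<epsilon> / (2 * \<sigma>))" using *(2) sigma_pos by (intro mult_strict_left_mono) auto
    also have "\<dots> = \<epsilon>" using sigma_pos by simp
    finally show False using xy(3) by simp
  qed
  moreover have "\<eta> > 0" using \<delta>(1) assms sigma_pos by (simp add: \<eta>_def)
  ultimately show ?thesis using that by blast
qed

end

section \<open>Upper bounds by volumes of cones\<close>

lemma measure_ball_scale:
  fixes c :: "'a::euclidean_space"
  assumes "r \<ge> 0"
  shows "measure lebesgue (ball c r) = r ^ DIM('a) * measure lebesgue (ball (0 :: 'a) 1)"
  using content_ball_conv_unit_ball[OF assms, of c] by simp

lemma measure_ball_unit_pos: "measure lebesgue (ball (0 :: 'a::euclidean_space) 1) > 0"
  using content_ball_pos[of 1 "0::'a"] by simp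

lemma measure_cone_ball:
  fixes K :: "'a::euclidean_space set"
  assumes K: "K \<in> sets lebesgue" and cone: "\<And>x t. x \<in> K \<Longrightarrow> t > 0 \<Longrightarrow> t *\<^sub>R x \<in> K" and R: "R > 0"
  shows "measure lebesgue (K \<inter> ball 0 R) = R ^ DIM('a) * measure lebesgue (K \<inter> ball 0 1)"
proof -
  have "(\<lambda>x. R *\<^sub>R x + 0) ` (K \<inter> ball 0 1) = K \<inter> ball 0 R"
  proof (intro equalityI subsetI)
    fix y assume y: "y \<in> K \<inter> ball 0 R"
    then have "(1/R) *\<^sub>R y \<in> K \<inter> ball 0 1" using R by (auto intro!: cone)
    moreover have "y = R *\<^sub>R ((1/R) *\<^sub>R y) + 0" using R by simp
    ultimately show "y \<in> (\<lambda>x. R *\<^sub>R x + 0) ` (K \<inter> ball 0 1)" by blast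
  next
    fix y assume "y \<in> (\<lambda>x. R *\<^sub>R x + 0) ` (K \<inter> ball 0 1)"
    then obtain x where x: "x \<in> K" "norm x < 1" "y = R *\<^sub>R x" by auto
    then have "norm y < R * 1" using R by (simp del: mult_1_right)
    then show "y \<in> K \<inter> ball 0 R" using x cone R by auto
  qed
  then show ?thesis
    using measure_lebesgue_affine[of R 0 "K \<inter> ball 0 1"] R by simp
qed

lemma power_DIM: "x ^ DIM('a::euclidean_space) = (x::real) * x ^ (DIM('a) - 1)"
  by (metis DIM_positive Suc_pred' power_Suc)

context hyp_sphere
begin

text \<open>The volume of the cone over a set bounds its Hausdorff measure: a maximal \<open>\<delta>\<close>-separated
  subset carries disjoint balls of radius \<open>\<delta> / 2\<close> inside a conic shell of thickness \<open>2 * \<delta>\<close>.\<close>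

lemma card_separated_le:
  fixes X K :: "'a::euclidean_space set"
  assumes K: "K \<in> sets lebesgue" and cone: "\<And>x t. x \<in> K \<Longrightarrow> t > 0 \<Longrightarrow> t *\<^sub>R x \<in> K"
    and X: "finite X" "X \<subseteq> sphere 0 \<rho>" and \<delta>: "0 < \<delta>" "\<delta> < \<rho>" "\<delta> \<le> 1"
    and nbhd: "\<And>x. x \<in> X \<Longrightarrow> ball x \<delta> \<subseteq> K"
    and sep: "\<And>x y. x \<in> X \<Longrightarrow> y \<in> X \<Longrightarrow> x \<noteq> y \<Longrightarrow> dist x y \<ge> \<delta>"
  shows "real (card X) * \<delta> ^ (DIM('a) - 1) \<le>
    4 ^ DIM('a) * real DIM('a) / measure lebesgue (ball (0 :: 'a) 1) * measure lebesgue (K \<inter> ball 0 1)"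
proof -
  let ?d = "DIM('a)"
  define b where "b = measure lebesgue (ball (0 :: 'a) 1)"
  define m where "m = measure lebesgue (K \<inter> ball 0 1)"
  have b: "b > 0" unfolding b_def by (rule measure_ball_unit_pos)
  have m: "m \<ge> 0" by (simp add: m_def)
  have lm: "K \<inter> ball 0 R \<in> lmeasurable" for R
    using fmeasurable_Int_fmeasurable[OF lmeasurable_ball K, of 0 R] by (simp only: Int_commute)
  let ?U = "\<Union>x\<in>X. ball x (\<delta> / 2)"
  let ?S = "K \<inter> ball 0 (\<rho> + \<delta>) - K \<inter> ball 0 (\<rho> - \<delta>)"
  have "?U \<subseteq> ?S"
  proof
    fix y assume "y \<in> ?U"
    then obtain x where x: "x \<in> X" "dist x y < \<delta> / 2" by auto
    have nx: "norm x = \<rho>" using X x by auto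
    have "y \<in> ball x \<delta>" using x \<delta> by simp
    then have "y \<in> K" using nbhd x by blast
    moreover have "norm y < \<rho> + \<delta>" "\<rho> - \<delta> < norm y"
      using x(2) nx \<delta> norm_triangle_ineq2[of x y] norm_triangle_ineq2[of y x]
      by (auto simp: dist_norm norm_minus_commute)
    ultimately show "y \<in> ?S" by auto
  qed
  have "real (card X) * ((\<delta> / 2) ^ ?d * b) = (\<Sum>x\<in>X. measure lebesgue (ball x (\<delta> / 2)))"
  proof -
    have "measure lebesgue (ball x (\<delta> / 2)) = (\<delta> / 2) ^ ?d * b" for x :: 'a
      unfolding b_def by (rule measure_ball_scale) (use \<delta> in simp)
    then show ?thesis by (simp only: sum_constant)
  qed
  also have "\<dots> = measure lebesgue ?U"
  proof (rule measure_UNION'[symmetric])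
    show "pairwise (\<lambda>i j. disjnt (ball i (\<delta> / 2)) (ball j (\<delta> / 2))) X"
      unfolding pairwise_def
    proof (intro ballI impI)
      fix x y assume "x \<in> X" "y \<in> X" "x \<noteq> y"
      then have "dist x y \<ge> \<delta>" by (rule sep)
      then show "disjnt (ball x (\<delta> / 2)) (ball y (\<delta> / 2))"
        unfolding disjnt_def by (intro disjoint_ballI) simp
    qed
  qed (use X in simp_all)
  also have "\<dots> \<le> measure lebesgue ?S"
  proof (rule measure_mono_fmeasurable[OF \<open>?U \<subseteq> ?S\<close>])
    show "?S \<in> lmeasurable" using lm by (intro fmeasurable.Diff) auto
    have "open ?U" by (intro open_UN) simp
    then show "?U \<in> sets lebesgue" by simp
  qed
  also have "\<dots> = measure lebesgue (K \<inter> ball 0 (\<rho> + \<delta>)) - measure lebesgue (K \<inter> ball 0 (\<rho> - \<delta>))"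
    using lm[of "\<rho> + \<delta>"] lm[of "\<rho> - \<delta>"] \<delta>
    by (intro measure_Diff) (auto simp: fmeasurable_def)
  also have "\<dots> = ((\<rho> + \<delta>) ^ ?d - (\<rho> - \<delta>) ^ ?d) * m"
    using measure_cone_ball[OF K cone, of "\<rho> + \<delta>"] measure_cone_ball[OF K cone, of "\<rho> - \<delta>"] \<delta> rho
    by (simp add: m_def algebra_simps)
  also have "\<dots> \<le> (real ?d * (\<rho> + \<delta>) ^ (?d - 1) * (2 * \<delta>)) * m"
    using power_diff_le[of "\<rho> - \<delta>" "\<rho> + \<delta>" ?d] \<delta> m by (intro mult_right_mono) auto
  also have "\<dots> \<le> (real ?d * 2 ^ (?d - 1) * (2 * \<delta>)) * m"
    using rho \<delta> m by (intro mult_right_mono mult_left_mono power_mono) auto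
  also have "\<dots> = real ?d * 2 ^ ?d * \<delta> * m"
    by (simp add: power_DIM[where 'a='a, of "2::real"])
  finally have "real (card X) * (\<delta> ^ ?d / 2 ^ ?d * b) \<le> real ?d * 2 ^ ?d * \<delta> * m"
    by (simp add: power_divide)
  then have "real (card X) * \<delta> ^ ?d * b \<le> real ?d * (2 ^ ?d * 2 ^ ?d) * \<delta> * m"
    by (simp add: field_simps)
  \<comment> \<open>One factor comes from the radius \<delta>/2 of the disjoint balls, the other
    from the shell, whose outer radius is at most 2 and whose thickness is 2\<delta>.\<close>
  also have "(2::real) ^ ?d * 2 ^ ?d = 4 ^ ?d" by (subst power_mult_distrib[symmetric]) simp
  also have "\<delta> ^ ?d = \<delta> * \<delta> ^ (?d - 1)"
    by (rule power_DIM)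
  \<comment> \<open>The thickness of the shell accounts for one power of \<delta>; cancelling it
    leaves the dimension of the sphere as exponent.\<close>
  finally have "\<delta> * (real (card X) * \<delta> ^ (?d - 1) * b) \<le> \<delta> * (real ?d * 4 ^ ?d * m)"
    by (simp add: mult_ac)
  then have "real (card X) * \<delta> ^ (?d - 1) * b \<le> real ?d * 4 ^ ?d * m"
    using \<delta> by simp
  then show ?thesis using b unfolding b_def[symmetric] m_def[symmetric] by (simp add: field_simps)
qed


text \<open>A largest \<delta>-separated subset of \<open>A\<close> is also a \<delta>-net, so balls
  around it cover \<open>A\<close>, and \<open>card_separated_le\<close> bounds their number. The
  constant depends on neither \<open>A\<close>, \<open>K\<close> nor \<open>\<eta>\<close>:
  \<open>K = UNIV\<close> gives finiteness, thin cones around a hyperplane give smallness.\<close>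

lemma hausdorff_sphere_le_cone:
  obtains C where "C > 0"
    "\<And>(A::'a::euclidean_space set) K \<eta>. A \<subseteq> sphere 0 \<rho> \<Longrightarrow> K \<in> sets lebesgue \<Longrightarrow>
      (\<And>x t. x \<in> K \<Longrightarrow> t > 0 \<Longrightarrow> t *\<^sub>R x \<in> K) \<Longrightarrow> \<eta> > 0 \<Longrightarrow> (\<And>x. x \<in> A \<Longrightarrow> ball x \<eta> \<subseteq> K) \<Longrightarrow>
      hausdorff_hyp (DIM('a) - 1) A \<le> ennreal (C * measure lebesgue (K \<inter> ball 0 1))"
proof -
  let ?d = "DIM('a)"
  define C1 where "C1 = 4 ^ ?d * real ?d / measure lebesgue (ball (0 :: 'a) 1)"
  define C where "C = (2 / \<sigma>) ^ (?d - 1) * C1"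
  have C1: "C1 > 0" using measure_ball_unit_pos[where 'a='a] by (simp add: C1_def)
  have C: "C > 0" using C1 sigma_pos by (simp add: C_def)
  show ?thesis
  proof (rule that[OF C])
    fix A K :: "'a set" and \<eta> :: real
    assume A: "A \<subseteq> sphere 0 \<rho>" and K: "K \<in> sets lebesgue"
      and cone: "\<And>x t. x \<in> K \<Longrightarrow> t > 0 \<Longrightarrow> t *\<^sub>R x \<in> K" and \<eta>: "\<eta> > 0"
      and nbhd: "\<And>x. x \<in> A \<Longrightarrow> ball x \<eta> \<subseteq> K"
    define m where "m = measure lebesgue (K \<inter> ball 0 1)"
    have m: "m \<ge> 0" by (simp add: m_def)
    have "hausdorff_pre (?d - 1) \<delta>' A \<le> ennreal (C * m)" if \<delta>': "\<delta>' > 0" for \<delta>'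
    proof -
      \<comment> \<open>The entries keep the balls inside \<open>K\<close>, keep \<delta> below
        \<rho> and 1, and make pieces of Euclidean diameter 2\<delta> have hyperbolic diameter at
        most \<delta>'.\<close>
      define \<delta> where "\<delta> = Min {\<eta>, \<rho> / 2, 1, \<delta>' * \<sigma> / 2}"
      have d0: "0 < \<delta>" unfolding \<delta>_def using \<eta> rho \<delta>' sigma_pos by simp
      have "\<delta> \<le> \<eta>" "\<delta> \<le> \<rho> / 2" "\<delta> \<le> 1" "\<delta> \<le> \<delta>' * \<sigma> / 2"
        unfolding \<delta>_def by (auto intro: Min_le)
      then have d: "\<delta> \<le> \<eta>" "\<delta> < \<rho>" "\<delta> \<le> 1" "2 * \<delta> / \<sigma> \<le> \<delta>'"
        using rho sigma_pos by (auto simp: field_simps)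
      define sep where "sep X \<longleftrightarrow> finite X \<and> X \<subseteq> A \<and> (\<forall>x\<in>X. \<forall>y\<in>X. x \<noteq> y \<longrightarrow> dist x y \<ge> \<delta>)" for X :: "'a set"
      have bound: "real (card X) * \<delta> ^ (?d - 1) \<le> C1 * m" if "sep X" for X
        unfolding C1_def m_def using that A nbhd d d0
        by (intro card_separated_le[OF K cone]) (auto simp: sep_def subset_eq)
      \<comment> \<open>The volume bound limits the size of separated sets, so one of greatest
        cardinality exists.\<close>
      have "\<exists>X. sep X \<and> (\<forall>Y. sep Y \<longrightarrow> card Y \<le> card X)"
      proof -
        have "\<forall>Y. sep Y \<longrightarrow> card Y < Suc (nat \<lceil>C1 * m / \<delta> ^ (?d - 1)\<rceil>)"
        proof (intro allI impI)
          fix Y assume "sep Y"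
          then have "real (card Y) \<le> C1 * m / \<delta> ^ (?d - 1)"
            using bound[of Y] d0 by (simp add: pos_le_divide_eq)
          then show "card Y < Suc (nat \<lceil>C1 * m / \<delta> ^ (?d - 1)\<rceil>)" by linarith
        qed
        moreover have "sep {}" by (simp add: sep_def)
        ultimately show ?thesis
          using ex_has_greatest_nat[of sep "{}" card] by blast
      qed
      then obtain X where X: "sep X" and max: "\<And>Y. sep Y \<Longrightarrow> card Y \<le> card X" by blast
      have fin: "finite X" "X \<subseteq> A" using X by (auto simp: sep_def)
      have cov: "\<exists>x\<in>X. dist x y < \<delta>" if y: "y \<in> A" for y
      proof (rule ccontr)
        assume "\<not> ?thesis"
        then have far: "\<And>x. x \<in> X \<Longrightarrow> dist x y \<ge> \<delta>" by auto
        then have "y \<notin> X" using d0 by force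
        have "sep (insert y X)" using X y far by (auto simp: sep_def dist_commute)
        then show False using max[of "insert y X"] fin \<open>y \<notin> X\<close> by simp
      qed
      obtain f where f: "bij_betw f {0..<card X} X"
        using fin ex_bij_betw_nat_finite by blast
      define E where "E i = (if i < card X then A \<inter> ball (f i) \<delta> else {})" for i
      have Ed: "hdiam (E i) \<le> ennreal (2 * \<delta> / \<sigma>)" for i
      proof (rule hdiam_leI)
        fix x y assume "x \<in> E i" "y \<in> E i"
        then have xy: "x \<in> A" "y \<in> A" "dist (f i) x < \<delta>" "dist (f i) y < \<delta>"
          by (auto simp: E_def split: if_splits)
        then have "dist x y \<le> 2 * \<delta>" using dist_triangle3[of x y "f i"] by simp
        then have "dist x y / \<sigma> \<le> 2 * \<delta> / \<sigma>" using sigma_pos by (simp add: divide_right_mono)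
        then show "ennreal (hdist x y) \<le> ennreal (2 * \<delta> / \<sigma>)"
          using hdist_le_dist[of x y] subsetD[OF A xy(1)] subsetD[OF A xy(2)] by (intro ennreal_leI) linarith
      qed
      have "E \<in> hcovers (2 * \<delta> / \<sigma>) A"
      proof -
        have "A \<subseteq> (\<Union>i. E i)"
        proof
          fix y assume y: "y \<in> A"
          then obtain x where x: "x \<in> X" "dist x y < \<delta>" using cov by blast
          have "x \<in> f ` {0..<card X}" using f x(1) by (simp only: bij_betw_def)
          then obtain i where "i < card X" "f i = x" by auto
          then have "y \<in> E i" using x y by (simp add: E_def)
          then show "y \<in> (\<Union>i. E i)" by blast
        qed
        moreover have "E i \<subseteq> hyp_space" for i
          using A sphere_subset_hyp by (auto simp: E_def split: if_splits)
        ultimately show ?thesis using Ed by (auto simp: hcovers_def)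
      qed
      then have "hausdorff_pre (?d - 1) (2 * \<delta> / \<sigma>) A \<le> (\<Sum>i. diam_term (?d - 1) (E i))"
        unfolding hausdorff_pre_eq by (rule INF_lower)
      also have "\<dots> = (\<Sum>i\<in>{..<card X}. diam_term (?d - 1) (E i))"
        by (rule suminf_finite) (auto simp: E_def)
      also have "\<dots> \<le> (\<Sum>i\<in>{..<card X}. ennreal (2 * \<delta> / \<sigma>) ^ (?d - 1))"
        using Ed by (intro sum_mono) (auto simp: diam_term_def intro!: power_mono_ennreal)
      also have "\<dots> = ennreal (real (card X) * (2 * \<delta> / \<sigma>) ^ (?d - 1))"
        using d0 sigma_pos
        by (simp add: ennreal_power ennreal_mult ennreal_of_nat_eq_real_of_nat)
      also have "\<dots> \<le> ennreal (C * m)"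
      proof (rule ennreal_leI)
        have "real (card X) * (2 * \<delta> / \<sigma>) ^ (?d - 1) = (2 / \<sigma>) ^ (?d - 1) * (real (card X) * \<delta> ^ (?d - 1))"
          by (simp add: power_mult_distrib power_divide)
        also have "\<dots> \<le> (2 / \<sigma>) ^ (?d - 1) * (C1 * m)"
          using bound[OF X] sigma_pos by (intro mult_left_mono) auto
        finally show "real (card X) * (2 * \<delta> / \<sigma>) ^ (?d - 1) \<le> C * m" by (simp add: C_def)
      qed
      finally show ?thesis using hausdorff_pre_antimono[OF d(4), of "?d - 1" A] by (rule order_trans[rotated])
    qed
    then show "hausdorff_hyp (?d - 1) A \<le> ennreal (C * measure lebesgue (K \<inter> ball 0 1))"
      unfolding hausdorff_hyp_def m_def by (intro SUP_least) auto
  qed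
qed

lemma hausdorff_sphere_finite:
  assumes "A \<subseteq> sphere (0::'a::euclidean_space) \<rho>"
  shows "hausdorff_hyp (DIM('a) - 1) A < top"
proof -
  obtain C where "C > 0" and C:
    "\<And>(A::'a set) K \<eta>. A \<subseteq> sphere 0 \<rho> \<Longrightarrow> K \<in> sets lebesgue \<Longrightarrow>
      (\<And>x t. x \<in> K \<Longrightarrow> t > 0 \<Longrightarrow> t *\<^sub>R x \<in> K) \<Longrightarrow> \<eta> > 0 \<Longrightarrow> (\<And>x. x \<in> A \<Longrightarrow> ball x \<eta> \<subseteq> K) \<Longrightarrow>
      hausdorff_hyp (DIM('a) - 1) A \<le> ennreal (C * measure lebesgue (K \<inter> ball 0 1))"
    using hausdorff_sphere_le_cone[where 'a='a] by blast
  have "hausdorff_hyp (DIM('a) - 1) A \<le> ennreal (C * measure lebesgue (UNIV \<inter> ball (0::'a) 1))"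
    by (rule C[of A UNIV 1]) (use assms in auto)
  also have "\<dots> < top" by simp
  finally show ?thesis .
qed

definition band :: "'a::euclidean_space \<Rightarrow> real \<Rightarrow> 'a set" where
  "band n \<epsilon> = {x \<in> sphere 0 \<rho>. \<bar>n \<bullet> x\<bar> \<le> \<epsilon>}"

text \<open>The closed cones \<open>K k\<close> decrease to a subset of a hyperplane, so their
  volumes in the unit ball tend to 0, while a thin enough band lies well inside
  \<open>K k\<close>.\<close>

lemma hausdorff_band_small:
  fixes n :: "'a::euclidean_space"
  assumes n: "n \<noteq> 0" and e: "e > 0"
  obtains \<epsilon> where "\<epsilon> > 0" "hausdorff_hyp (DIM('a) - 1) (band n \<epsilon>) \<le> ennreal e"
proof -
  obtain C where "C > 0" and C:
    "\<And>(A::'a set) K \<eta>. A \<subseteq> sphere 0 \<rho> \<Longrightarrow> K \<in> sets lebesgue \<Longrightarrow>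
      (\<And>x t. x \<in> K \<Longrightarrow> t > 0 \<Longrightarrow> t *\<^sub>R x \<in> K) \<Longrightarrow> \<eta> > 0 \<Longrightarrow> (\<And>x. x \<in> A \<Longrightarrow> ball x \<eta> \<subseteq> K) \<Longrightarrow>
      hausdorff_hyp (DIM('a) - 1) A \<le> ennreal (C * measure lebesgue (K \<inter> ball 0 1))"
    using hausdorff_sphere_le_cone[where 'a='a] by blast
  define K where "K k = {x. \<bar>n \<bullet> x\<bar> \<le> norm x / real (Suc k)}" for k
  have closedK: "closed (K k)" for k
    unfolding K_def by (intro closed_Collect_le continuous_intros) auto
  have Kmeas: "K k \<inter> ball 0 1 \<in> sets lebesgue" for k
    using closedK[of k] by (intro sets.Int) auto
  have lim: "(\<lambda>k. measure lebesgue (K k \<inter> ball 0 1)) \<longlonglongrightarrow> measure lebesgue (\<Inter>k. K k \<inter> ball 0 1)"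
  proof (rule Lim_measure_decseq)
    show "decseq (\<lambda>k. K k \<inter> ball 0 1)"
    proof (intro decseq_SucI subsetI)
      fix k x assume x: "x \<in> K (Suc k) \<inter> ball 0 1"
      have "norm x / real (Suc (Suc k)) \<le> norm x / real (Suc k)"
        by (intro divide_left_mono) auto
      with x show "x \<in> K k \<inter> ball 0 1" by (auto simp: K_def)
    qed
    show "emeasure lebesgue (K i \<inter> ball 0 1) \<noteq> \<infinity>" for i
    proof -
      have "emeasure lebesgue (K i \<inter> ball 0 1) \<le> emeasure lebesgue (ball (0::'a) 1)"
        by (intro emeasure_mono) auto
      also have "\<dots> < \<infinity>" using lmeasurable_ball[of "0::'a" 1] by (auto simp: fmeasurable_def)
      finally show ?thesis by simp
    qed
  qed (use Kmeas in auto)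
  have "(\<Inter>k. K k \<inter> ball 0 1) \<subseteq> {x. n \<bullet> x = 0}"
  proof
    fix x assume x: "x \<in> (\<Inter>k. K k \<inter> ball 0 1)"
    have "\<bar>n \<bullet> x\<bar> \<le> norm x / real (Suc k)" for k using x by (auto simp: K_def)
    moreover have "(\<lambda>k. norm x / real (Suc k)) \<longlonglongrightarrow> 0"
      using LIMSEQ_Suc[OF lim_const_over_n[of "norm x"]] by simp
    ultimately have "\<bar>n \<bullet> x\<bar> \<le> 0" by (intro LIMSEQ_le_const) auto
    then show "x \<in> {x. n \<bullet> x = 0}" by simp
  qed
  moreover have "negligible {x. n \<bullet> x = 0}" using n by (intro negligible_hyperplane) auto
  ultimately have "measure lebesgue (\<Inter>k. K k \<inter> ball 0 1) = 0"
    using negligible_subset negligible_imp_measure0 by blast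
  then have "(\<lambda>k. C * measure lebesgue (K k \<inter> ball 0 1)) \<longlonglongrightarrow> 0"
    using tendsto_mult_left[OF lim, of C] by simp
  then have "eventually (\<lambda>k. C * measure lebesgue (K k \<inter> ball 0 1) < e) sequentially"
    using e by (rule order_tendstoD)
  then obtain k where k: "C * measure lebesgue (K k \<inter> ball 0 1) < e"
    by (auto simp: eventually_sequentially)
  \<comment> \<open>Moving a point of the band by less than \<eta> leaves
    \<open>\<bar>n \<bullet> y\<bar>\<close> at most 2\<epsilon> and the norm at least \<rho>/2; the
    factor 4 makes these two bounds match the defining inequality of \<open>K k\<close>.\<close>
  define \<epsilon> where "\<epsilon> = \<rho> / (4 * real (Suc k))"
  define \<eta> where "\<eta> = min (\<rho> / 2) (\<epsilon> / norm n)"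
  have \<epsilon>: "\<epsilon> > 0" using rho by (simp add: \<epsilon>_def)
  have \<eta>: "\<eta> > 0" "\<eta> \<le> \<rho> / 2" "norm n * \<eta> \<le> \<epsilon>"
    using rho n \<epsilon> by (auto simp: \<eta>_def min_def field_simps)
  have "hausdorff_hyp (DIM('a) - 1) (band n \<epsilon>) \<le> ennreal (C * measure lebesgue (K k \<inter> ball 0 1))"
  proof (rule C[OF _ _ _ \<eta>(1)])
    show "band n \<epsilon> \<subseteq> sphere 0 \<rho>" by (auto simp: band_def)
    show "K k \<in> sets lebesgue" using closedK[of k] by auto
  next
    fix x and t :: real assume "x \<in> K k" "t > 0"
    then have "t * \<bar>n \<bullet> x\<bar> \<le> t * (norm x / real (Suc k))"
      by (intro mult_left_mono) (auto simp: K_def)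
    then show "t *\<^sub>R x \<in> K k" using \<open>t > 0\<close>
      by (simp add: K_def abs_mult)
  next
    fix x assume x: "x \<in> band n \<epsilon>"
    show "ball x \<eta> \<subseteq> K k"
    proof
      fix y assume "y \<in> ball x \<eta>"
      then have y: "norm (y - x) \<le> \<eta>" by (simp add: dist_norm norm_minus_commute)
      have "\<bar>n \<bullet> (y - x)\<bar> \<le> norm n * norm (y - x)" by (rule Cauchy_Schwarz_ineq2)
      also have "\<dots> \<le> norm n * \<eta>" using y by (intro mult_left_mono) auto
      finally have "\<bar>n \<bullet> (y - x)\<bar> \<le> \<epsilon>" using \<eta> by simp
      moreover have "\<bar>n \<bullet> x\<bar> \<le> \<epsilon>" using x by (simp add: band_def)
      ultimately have "\<bar>n \<bullet> y\<bar> \<le> 2 * \<epsilon>" unfolding inner_diff_right by linarith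
      also have "2 * \<epsilon> = (\<rho> / 2) / real (Suc k)" by (simp add: \<epsilon>_def field_simps)
      also have "\<dots> \<le> norm y / real (Suc k)"
      proof -
        have "norm x \<le> norm y + norm (y - x)"
          using norm_triangle_ineq2[of x y] by (simp add: norm_minus_commute)
        then have "\<rho> / 2 \<le> norm y" using x y \<eta> by (simp add: band_def)
        then show ?thesis by (intro divide_right_mono) auto
      qed
      finally show "y \<in> K k" by (simp add: K_def)
    qed
  qed
  also have "\<dots> \<le> ennreal e" using k by (intro ennreal_leI) simp
  finally show ?thesis using \<epsilon> that by blast
qed

section \<open>Lower bound by volumes of cones\<close>

definition cone_over :: "'a::euclidean_space set \<Rightarrow> 'a set" where
  "cone_over X = {t *\<^sub>R x | t x. 0 \<le> t \<and> t \<le> 1 \<and> x \<in> X}"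

text \<open>The cone over a set of diameter \<open>D\<close> stays close to the segment from 0 to
  one of its points, so about \<open>1 / D\<close> balls of radius \<open>2 * D\<close> cover it.
  Their total volume has order \<open>D ^ (d - 1)\<close>, the corresponding term of a Hausdorff
  sum. The closure makes the cone over an arbitrary set measurable.\<close>

lemma measure_cone_over_le:
  fixes X :: "'a::euclidean_space set"
  assumes X: "X \<subseteq> sphere 0 \<rho>" "X \<noteq> {}" and D: "0 \<le> D" and diam: "\<And>x y. x \<in> X \<Longrightarrow> y \<in> X \<Longrightarrow> dist x y \<le> D"
  shows "measure lebesgue (closure (cone_over X)) \<le>
    2 ^ DIM('a) * (2 + D) * measure lebesgue (ball (0::'a) 1) * D ^ (DIM('a) - 1)"
    and "closure (cone_over X) \<in> lmeasurable"
proof -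
  let ?d = "DIM('a)"
  define b where "b = measure lebesgue (ball (0 :: 'a) 1)"
  have b: "b > 0" unfolding b_def by (rule measure_ball_unit_pos)
  obtain x0 where x0: "x0 \<in> X" using X by auto
  have nx: "norm x = \<rho>" if "x \<in> X" for x using X that by auto
  have bound: "bounded (cone_over X)"
    unfolding bounded_iff
  proof (intro exI ballI)
    fix y assume "y \<in> cone_over X"
    then obtain t x where "y = t *\<^sub>R x" "0 \<le> t" "t \<le> 1" "x \<in> X" by (auto simp: cone_over_def)
    then show "norm y \<le> \<rho>" using nx[of x] rho by (simp add: mult_left_le_one_le)
  qed
  then have "compact (closure (cone_over X))" by simp
  then show lm: "closure (cone_over X) \<in> lmeasurable" by (rule lmeasurable_compact)
  \<comment> \<open>The spacing \<eta> must be positive, whereas \<open>D\<close> is 0 for a single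
    point. The bound for \<open>D\<close> itself follows as \<eta> decreases to
    \<open>D\<close>.\<close>
  have le: "measure lebesgue (closure (cone_over X)) \<le> 2 ^ ?d * (1 + \<eta>) * b * \<eta> ^ (?d - 1)"
    if \<eta>: "\<eta> > D" for \<eta>
  proof -
    have \<eta>0: "\<eta> > 0" using \<eta> D by simp
    define N where "N = nat \<lfloor>1 / \<eta>\<rfloor>"
    have N: "real N \<le> 1 / \<eta>" using \<eta>0 by (simp add: N_def)
    have sub: "cone_over X \<subseteq> (\<Union>j\<in>{..N}. cball ((real j * \<eta>) *\<^sub>R x0) (2 * \<eta>))"
    proof
      fix y assume "y \<in> cone_over X"
      then obtain t x where y: "y = t *\<^sub>R x" "0 \<le> t" "t \<le> 1" "x \<in> X" by (auto simp: cone_over_def)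
      define j where "j = nat \<lfloor>t / \<eta>\<rfloor>"
      have "t / \<eta> \<le> 1 / \<eta>" using y \<eta>0 by (intro divide_right_mono) auto
      then have jN: "j \<le> N" unfolding j_def N_def by (intro nat_mono floor_mono)
      have "real j \<le> t / \<eta>" "t / \<eta> < real j + 1"
        using y \<eta>0 by (auto simp: j_def)
      then have jt: "real j * \<eta> \<le> t" "t < real j * \<eta> + \<eta>" using \<eta>0 by (auto simp: field_simps)
      have "norm (y - (real j * \<eta>) *\<^sub>R x0) = norm (t *\<^sub>R (x - x0) + (t - real j * \<eta>) *\<^sub>R x0)"
        by (simp add: y algebra_simps)
      also have "\<dots> \<le> t * norm (x - x0) + (t - real j * \<eta>) * norm x0"
        using y jt by (intro order_trans[OF norm_triangle_ineq]) auto
      also have "\<dots> \<le> 1 * \<eta> + \<eta> * 1"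
        using y jt \<eta> \<eta>0 diam[OF y(4) x0] nx[OF x0] rho by (intro add_mono mult_mono) (auto simp: dist_norm)
      finally have "y \<in> cball ((real j * \<eta>) *\<^sub>R x0) (2 * \<eta>)"
        by (simp add: dist_norm norm_minus_commute)
      with jN show "y \<in> (\<Union>j\<in>{..N}. cball ((real j * \<eta>) *\<^sub>R x0) (2 * \<eta>))" by blast
    qed
    have "closure (cone_over X) \<subseteq> (\<Union>j\<in>{..N}. cball ((real j * \<eta>) *\<^sub>R x0) (2 * \<eta>))"
      by (rule closure_minimal[OF sub]) (auto intro!: closed_UN)
    then have "measure lebesgue (closure (cone_over X)) \<le> measure lebesgue (\<Union>j\<in>{..N}. cball ((real j * \<eta>) *\<^sub>R x0) (2 * \<eta>))"
      by (rule measure_mono_fmeasurable) (use lm in \<open>auto intro!: fmeasurable.finite_UN\<close>)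
    also have "\<dots> \<le> (\<Sum>j\<in>{..N}. measure lebesgue (cball ((real j * \<eta>) *\<^sub>R x0) (2 * \<eta>)))"
      by (rule measure_UNION_le) auto
    also have "\<dots> = (\<Sum>j\<in>{..N}. (2 * \<eta>) ^ ?d * b)"
    proof (rule sum.cong[OF refl])
      fix j assume "j \<in> {..N}"
      have "measure lebesgue (cball ((real j * \<eta>) *\<^sub>R x0) (2 * \<eta>)) = measure lebesgue (ball ((real j * \<eta>) *\<^sub>R x0) (2 * \<eta>))"
        using content_cball_conv_ball[of "(real j * \<eta>) *\<^sub>R x0" "2 * \<eta>"] by simp
      then show "measure lebesgue (cball ((real j * \<eta>) *\<^sub>R x0) (2 * \<eta>)) = (2 * \<eta>) ^ ?d * b"
        unfolding b_def using measure_ball_scale[of "2 * \<eta>" "(real j * \<eta>) *\<^sub>R x0"] \<eta>0 by linarith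
    qed
    also have "\<dots> = (real N + 1) * ((2 * \<eta>) ^ ?d * b)" by simp
    also have "\<dots> \<le> (1 / \<eta> + 1) * ((2 * \<eta>) ^ ?d * b)"
      using N b \<eta>0 by (intro mult_right_mono) auto
    also have "(2 * \<eta>) ^ ?d = 2 ^ ?d * (\<eta> * \<eta> ^ (?d - 1))"
      by (simp only: power_mult_distrib power_DIM[where 'a='a, of \<eta>])
    also have "(1 / \<eta> + 1) * (2 ^ ?d * (\<eta> * \<eta> ^ (?d - 1)) * b) = ((1 / \<eta> + 1) * \<eta>) * (2 ^ ?d * \<eta> ^ (?d - 1) * b)"
      by (simp only: mult_ac)
    also have "(1 / \<eta> + 1) * \<eta> = 1 + \<eta>" using \<eta>0 by (simp add: field_simps)
    finally show ?thesis by (simp add: mult_ac)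
  qed
  have "measure lebesgue (closure (cone_over X)) \<le> 2 ^ ?d * (1 + D) * b * D ^ (?d - 1)"
  proof (rule tendsto_lowerbound)
    show "((\<lambda>\<eta>. 2 ^ ?d * (1 + \<eta>) * b * \<eta> ^ (?d - 1)) \<longlongrightarrow> 2 ^ ?d * (1 + D) * b * D ^ (?d - 1)) (at_right D)"
      by (intro tendsto_intros)
    show "\<forall>\<^sub>F \<eta> in at_right D. measure lebesgue (closure (cone_over X)) \<le> 2 ^ ?d * (1 + \<eta>) * b * \<eta> ^ (?d - 1)"
      by (rule eventually_mono[OF eventually_at_right_less]) (rule le)
  qed simp
  also have "\<dots> \<le> 2 ^ ?d * (2 + D) * b * D ^ (?d - 1)"
    using b D by (intro mult_right_mono mult_left_mono) auto
  finally show "measure lebesgue (closure (cone_over X)) \<le>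
    2 ^ DIM('a) * (2 + D) * measure lebesgue (ball (0::'a) 1) * D ^ (DIM('a) - 1)" unfolding b_def .
qed

lemma sphere_nonempty: "sphere (0::'a::euclidean_space) \<rho> \<noteq> {}"
  using rho by simp

text \<open>The cones over the pieces of any fine cover of the sphere fill the ball. Their volumes
  are controlled by the Hausdorff sum, so a null sphere would give a ball of volume 0.\<close>

lemma hausdorff_sphere_pos: "hausdorff_hyp (DIM('a) - 1) (sphere (0::'a::euclidean_space) \<rho>) > 0"
proof (rule ccontr)
  let ?d = "DIM('a)" let ?S = "sphere (0::'a) \<rho>"
  assume "\<not> ?thesis"
  then have H0: "hausdorff_hyp (?d - 1) ?S = 0" by simp
  define b where "b = measure lebesgue (ball (0 :: 'a) 1)"
  have b: "b > 0" unfolding b_def by (rule measure_ball_unit_pos)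
  obtain \<delta> where \<delta>: "\<delta> > 0"
    "\<And>x y::'a. x \<in> ?S \<Longrightarrow> y \<in> ?S \<Longrightarrow> hdist x y \<le> \<delta> \<Longrightarrow> dist x y \<le> 2 * \<sigma> * hdist x y"
    using dist_le_hdist by blast
  define C where "C = 2 ^ ?d * (2 + 2 * \<sigma> * \<delta>) * b * (2 * \<sigma>) ^ (?d - 1)"
  have C: "C > 0" unfolding C_def using b sigma_pos \<delta>
    by (intro mult_pos_pos add_pos_pos zero_less_power) auto
  have "emeasure lebesgue (cball (0::'a) \<rho>) \<le> ennreal C * hausdorff_pre (?d - 1) \<delta> ?S"
    unfolding hausdorff_pre_eq
  proof (rule le_cmult_INF_ennreal[OF C])
    fix E assume E: "E \<in> hcovers \<delta> ?S"
    define U where "U i = closure (cone_over (E i \<inter> ?S))" for i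
    have "cball (0::'a) \<rho> \<subseteq> (\<Union>i. U i)"
    proof
      fix y :: 'a assume y: "y \<in> cball 0 \<rho>"
      obtain s where s: "s \<in> ?S" "y = (norm y / \<rho>) *\<^sub>R s"
      proof (cases "y = 0")
        case True
        then show ?thesis using sphere_nonempty that by fastforce
      next
        case False
        then show ?thesis using rho that[of "(\<rho> / norm y) *\<^sub>R y"] by simp
      qed
      obtain i where "s \<in> E i" using E s(1) by (auto simp: hcovers_def)
      then have "y \<in> cone_over (E i \<inter> ?S)"
        unfolding cone_over_def using s y rho
        by (intro CollectI exI[of _ "norm y / \<rho>"] exI[of _ s]) auto
      then show "y \<in> (\<Union>i. U i)" using closure_subset by (fastforce simp: U_def)
    qed
    then have "emeasure lebesgue (cball (0::'a) \<rho>) \<le> emeasure lebesgue (\<Union>i. U i)"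
      by (rule emeasure_mono) (auto simp: U_def)
    also have "\<dots> \<le> (\<Sum>i. emeasure lebesgue (U i))"
      by (rule emeasure_subadditive_countably) (auto simp: U_def)
    also have "\<dots> \<le> (\<Sum>i. ennreal C * diam_term (?d - 1) (E i))"
    proof (rule suminf_le)
      fix i
      show "emeasure lebesgue (U i) \<le> ennreal C * diam_term (?d - 1) (E i)"
      proof (cases "E i \<inter> ?S = {}")
        case True
        then show ?thesis by (simp add: U_def cone_over_def)
      next
        case False
        have le: "hdiam (E i) \<le> ennreal \<delta>" using E by (auto simp: hcovers_def)
        then have "hdiam (E i) < top" by (rule order.strict_trans1) simp
        then obtain D where D: "D \<ge> 0" "hdiam (E i) = ennreal D" by (cases "hdiam (E i)") auto
        have D\<delta>: "D \<le> \<delta>" using le D \<delta> by simp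
        have diam: "dist x y \<le> 2 * \<sigma> * D" if "x \<in> E i \<inter> ?S" "y \<in> E i \<inter> ?S" for x y
        proof -
          have "ennreal (hdist x y) \<le> ennreal D" unfolding D(2)[symmetric]
            using that by (intro hdist_le_hdiam) auto
          then have *: "hdist x y \<le> D" using D by simp
          then have "dist x y \<le> 2 * \<sigma> * hdist x y"
            using that D\<delta> by (intro \<delta>(2)) auto
          also have "\<dots> \<le> 2 * \<sigma> * D" using * sigma_pos by (intro mult_left_mono) auto
          finally show ?thesis .
        qed
        have D2: "0 \<le> 2 * \<sigma> * D" using sigma_pos D by simp
        have U: "U i \<in> lmeasurable" "measure lebesgue (U i) \<le> 2 ^ ?d * (2 + 2 * \<sigma> * D) * b * (2 * \<sigma> * D) ^ (?d - 1)"
          unfolding U_def b_def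
          using measure_cone_over_le[OF _ False D2 diam] by auto
        have "2 ^ ?d * (2 + 2 * \<sigma> * D) * b * (2 * \<sigma> * D) ^ (?d - 1) \<le> C * D ^ (?d - 1)"
        proof -
          have "2 ^ ?d * (2 + 2 * \<sigma> * D) * b * (2 * \<sigma> * D) ^ (?d - 1)
            \<le> 2 ^ ?d * (2 + 2 * \<sigma> * \<delta>) * b * (2 * \<sigma> * D) ^ (?d - 1)"
            using D\<delta> sigma_pos b D D2 by (intro mult_right_mono mult_left_mono add_left_mono zero_le_power) auto
          then show ?thesis
            unfolding C_def power_mult_distrib[of "2 * \<sigma>" D] by (simp only: mult_ac)
        qed
        then have "measure lebesgue (U i) \<le> C * D ^ (?d - 1)" using U(2) by linarith
        then have "ennreal (measure lebesgue (U i)) \<le> ennreal (C * D ^ (?d - 1))" by (rule ennreal_leI)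
        also have "ennreal (measure lebesgue (U i)) = emeasure lebesgue (U i)"
          using U(1) by (simp add: emeasure_eq_measure2)
        also have "ennreal (C * D ^ (?d - 1)) = ennreal C * diam_term (?d - 1) (E i)"
          using False C D by (auto simp: diam_term_def ennreal_mult ennreal_power)
        finally show ?thesis .
      qed
    qed auto
    finally show "emeasure lebesgue (cball (0::'a) \<rho>) \<le> ennreal C * (\<Sum>i. diam_term (?d - 1) (E i))" by simp
  qed
  also have "\<dots> \<le> ennreal C * hausdorff_hyp (?d - 1) ?S"
    using \<delta> by (intro mult_left_mono hausdorff_pre_le_hyp) auto
  finally have "emeasure lebesgue (cball (0::'a) \<rho>) = 0" using H0 by simp
  then have "measure lebesgue (cball (0::'a) \<rho>) = 0" by (simp add: measure_def)
  then show False using content_cball_pos[of \<rho> "0::'a"] rho by simp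
qed

text \<open>Restricting the outer measure to the sets that satisfy Caratheodory's criterion gives a
  genuine measure, so that identities between indicator functions can be integrated.\<close>

definition sphere_measure :: "'a::euclidean_space measure" where
  "sphere_measure = measure_of (sphere 0 \<rho>)
     (lambda_system (sphere 0 \<rho>) (Pow (sphere 0 \<rho>)) (hausdorff_hyp (DIM('a) - 1)))
     (hausdorff_hyp (DIM('a) - 1))"

lemma outer_measure_space_hausdorff: "outer_measure_space (Pow S) (hausdorff_hyp s)"
  unfolding outer_measure_space_def positive_def increasing_def countably_subadditive_def
  by (auto intro: hausdorff_hyp_mono hausdorff_hyp_countable_subadd)

lemma measure_space_lambda_system:
  "measure_space S (lambda_system S (Pow S) (hausdorff_hyp s)) (hausdorff_hyp s)"
  by (intro sigma_algebra.caratheodory_lemma sigma_algebra_Pow outer_measure_space_hausdorff)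

lemma space_sphere_measure [simp]: "space (sphere_measure :: 'a::euclidean_space measure) = sphere 0 \<rho>"
  unfolding sphere_measure_def by (rule space_measure_of) (auto simp: lambda_system_def)

lemma sets_sphere_measure:
  "sets (sphere_measure :: 'a::euclidean_space measure) =
     lambda_system (sphere 0 \<rho>) (Pow (sphere 0 \<rho>)) (hausdorff_hyp (DIM('a) - 1))"
  unfolding sphere_measure_def
  using measure_space_lambda_system[of "sphere (0::'a) \<rho>" "DIM('a) - 1"]
  unfolding measure_space_def by (intro sigma_algebra.sets_measure_of_eq) blast

lemma emeasure_sphere_measure:
  assumes "A \<in> sets (sphere_measure :: 'a::euclidean_space measure)"
  shows "emeasure sphere_measure A = hausdorff_hyp (DIM('a) - 1) A"
proof -
  have "measure_space (sphere (0::'a) \<rho>) (lambda_system (sphere 0 \<rho>) (Pow (sphere 0 \<rho>)) (hausdorff_hyp (DIM('a) - 1))) (hausdorff_hyp (DIM('a) - 1))"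
    by (rule measure_space_lambda_system)
  then show ?thesis
    unfolding sphere_measure_def using assms unfolding sets_sphere_measure measure_space_def
    by (intro emeasure_measure_of_sigma) blast+
qed

lemma measure_sphere_measure:
  assumes "A \<in> sets (sphere_measure :: 'a::euclidean_space measure)"
  shows "measure sphere_measure A = enn2real (hausdorff_hyp (DIM('a) - 1) A)"
  by (simp add: measure_def emeasure_sphere_measure[OF assms])

lemma sphere_in_sphere_measure: "sphere (0::'a::euclidean_space) \<rho> \<in> sets sphere_measure"
  using sets.top[of "sphere_measure :: 'a measure"] by simp

lemma finite_sphere_measure: "finite_measure (sphere_measure :: 'a::euclidean_space measure)"
proof
  have "emeasure sphere_measure (space (sphere_measure :: 'a measure)) = hausdorff_hyp (DIM('a) - 1) (sphere (0::'a) \<rho>)"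
    by (simp add: emeasure_sphere_measure[OF sphere_in_sphere_measure])
  also have "\<dots> < top" by (rule hausdorff_sphere_finite) simp
  finally show "emeasure sphere_measure (space (sphere_measure :: 'a measure)) \<noteq> \<infinity>" by simp
qed

lemma measure_sphere_pos: "measure sphere_measure (sphere (0::'a::euclidean_space) \<rho>) > 0"
  using hausdorff_sphere_pos[where 'a='a] hausdorff_sphere_finite[of "sphere (0::'a) \<rho>"]
  by (simp add: measure_sphere_measure[OF sphere_in_sphere_measure] enn2real_positive_iff)

text \<open>The sets where \<open>n \<bullet> z \<le> 0\<close> and where
  \<open>n \<bullet> z \<ge> \<epsilon>\<close> lie at positive distance, hence are additive. What
  remains between them lies in a band of measure at most \<open>e\<close>.\<close>

lemma halfspace_in_sphere_measure:
  fixes n :: "'a::euclidean_space"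
  shows "{z \<in> sphere 0 \<rho>. n \<bullet> z \<le> 0} \<in> sets sphere_measure"
proof (cases "n = 0")
  case True
  then have "{z \<in> sphere 0 \<rho>. n \<bullet> z \<le> 0} = sphere 0 \<rho>" by auto
  then show ?thesis by (simp only: sphere_in_sphere_measure)
next
  case False
  let ?S = "sphere (0::'a) \<rho>" let ?H = "hausdorff_hyp (DIM('a) - 1) :: 'a set \<Rightarrow> ennreal"
  define l where "l = {z \<in> ?S. n \<bullet> z \<le> 0}"
  have "?H (l \<inter> X) + ?H ((?S - l) \<inter> X) = ?H X" if X: "X \<subseteq> ?S" for X
  proof (rule antisym)
    have "X = (l \<inter> X) \<union> ((?S - l) \<inter> X)" using X by blast
    then show "?H X \<le> ?H (l \<inter> X) + ?H ((?S - l) \<inter> X)"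
      using hausdorff_hyp_subadd[of "DIM('a) - 1" "l \<inter> X" "(?S - l) \<inter> X"] by simp
    show "?H (l \<inter> X) + ?H ((?S - l) \<inter> X) \<le> ?H X"
    proof (rule ennreal_le_epsilon)
      fix e :: real assume "0 < e"
      then obtain \<epsilon> where \<epsilon>: "\<epsilon> > 0" and band: "?H (band n \<epsilon>) \<le> ennreal e"
        using hausdorff_band_small[OF False] by blast
      define Y where "Y = {z \<in> X. n \<bullet> z \<ge> \<epsilon>}"
      have "\<epsilon> / norm n > 0" using \<epsilon> False by simp
      then obtain \<eta> where \<eta>: "\<eta> > 0"
        "\<And>x y::'a. x \<in> ?S \<Longrightarrow> y \<in> ?S \<Longrightarrow> dist x y \<ge> \<epsilon> / norm n \<Longrightarrow> hdist x y \<ge> \<eta>"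
        using hdist_ge_of_dist_ge[where 'a='a] by blast
      have "?H (l \<inter> X) + ?H Y \<le> ?H (l \<inter> X \<union> Y)"
      proof (rule hausdorff_hyp_separated[OF \<eta>(1)])
        fix x y assume x: "x \<in> l \<inter> X" and y: "y \<in> Y"
        have "\<epsilon> \<le> n \<bullet> (y - x)" using x y by (simp add: l_def Y_def inner_diff_right)
        also have "\<dots> \<le> norm n * norm (y - x)" by (rule norm_cauchy_schwarz)
        finally have "\<epsilon> / norm n \<le> dist x y" using False
          by (simp add: divide_le_eq dist_norm norm_minus_commute mult.commute)
        then show "\<eta> \<le> hdist x y" using x y X by (intro \<eta>(2)) (simp_all add: Y_def l_def subset_iff)
      qed
      also have "\<dots> \<le> ?H X" by (rule hausdorff_hyp_mono) (auto simp: Y_def)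
      finally have 1: "?H (l \<inter> X) + ?H Y \<le> ?H X" .
      have "?H ((?S - l) \<inter> X) \<le> ?H (Y \<union> band n \<epsilon>)"
        by (rule hausdorff_hyp_mono) (auto simp: Y_def l_def band_def)
      also have "\<dots> \<le> ?H Y + ?H (band n \<epsilon>)" by (rule hausdorff_hyp_subadd)
      also have "\<dots> \<le> ?H Y + ennreal e" using band by (rule add_left_mono)
      finally have "?H (l \<inter> X) + ?H ((?S - l) \<inter> X) \<le> ?H (l \<inter> X) + (?H Y + ennreal e)"
        by (rule add_left_mono)
      also have "\<dots> = (?H (l \<inter> X) + ?H Y) + ennreal e" by (simp add: add.assoc)
      also have "\<dots> \<le> ?H X + ennreal e" using 1 by (rule add_right_mono)
      finally show "?H (l \<inter> X) + ?H ((?S - l) \<inter> X) \<le> ?H X + ennreal e" .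
    qed
  qed
  then show ?thesis
    unfolding sets_sphere_measure lambda_system_def l_def[symmetric] by (auto simp: l_def)
qed

lemma hyperplane_null_sphere_measure:
  fixes n :: "'a::euclidean_space"
  assumes "n \<noteq> 0"
  shows "{z \<in> sphere 0 \<rho>. n \<bullet> z = 0} \<in> null_sets sphere_measure"
proof -
  have "{z \<in> sphere 0 \<rho>. n \<bullet> z = 0} = {z \<in> sphere 0 \<rho>. n \<bullet> z \<le> 0} \<inter> {z \<in> sphere 0 \<rho>. (-n) \<bullet> z \<le> 0}"
    by auto
  then have meas: "{z \<in> sphere 0 \<rho>. n \<bullet> z = 0} \<in> sets sphere_measure"
    using sets.Int[OF halfspace_in_sphere_measure[of n] halfspace_in_sphere_measure[of "-n"]] by (simp only:)
  have "hausdorff_hyp (DIM('a) - 1) {z \<in> sphere 0 \<rho>. n \<bullet> z = 0} \<le> 0 + ennreal e" if e: "e > 0" for e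
  proof -
    obtain \<epsilon> where \<epsilon>: "\<epsilon> > 0" "hausdorff_hyp (DIM('a) - 1) (band n \<epsilon>) \<le> ennreal e"
      using hausdorff_band_small[OF assms e] by blast
    have "hausdorff_hyp (DIM('a) - 1) {z \<in> sphere 0 \<rho>. n \<bullet> z = 0} \<le> hausdorff_hyp (DIM('a) - 1) (band n \<epsilon>)"
      using \<epsilon>(1) by (intro hausdorff_hyp_mono) (auto simp: band_def)
    also note \<epsilon>(2)
    finally show ?thesis by (simp only: add_0)
  qed
  then have "hausdorff_hyp (DIM('a) - 1) {z \<in> sphere 0 \<rho>. n \<bullet> z = 0} \<le> 0"
    by (rule ennreal_le_epsilon)
  then show ?thesis using meas by (intro null_setsI) (simp_all add: emeasure_sphere_measure)
qed

lemma hausdorff_sphere_uminus: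
  assumes "A \<subseteq> sphere (0::'a::euclidean_space) \<rho>"
  shows "hausdorff_hyp s (uminus ` A) = hausdorff_hyp s A"
proof (rule hausdorff_hyp_isometry[where g = uminus])
  show A: "A \<subseteq> hyp_space" using assms sphere_subset_hyp by blast
  show "- x \<in> hyp_space" if "x \<in> A" for x using subsetD[OF A that] by simp
qed (simp_all add: hdist_def)

end

text \<open>A dilation scales chords exactly, so \<open>sinh\<close> of half the hyperbolic distance
  is multiplied by \<Lambda>, the ratio of the hyperbolic sines of the two hyperbolic radii. At
  small scale the distances themselves are multiplied by at most \<open>\<Lambda> * (1 + e)\<close>,
  and \<open>e\<close> tends to 0.\<close>

lemma hausdorff_hyp_scaling_le:
  fixes A :: "'a::euclidean_space set"
  assumes rho: "0 < \<rho>" "\<rho> < 1" and rho': "0 < \<rho>'" "\<rho>' < 1" and A: "A \<subseteq> sphere 0 \<rho>"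
  defines "\<Lambda> \<equiv> (\<rho>' / sqrt (1 - \<rho>'\<^sup>2)) / (\<rho> / sqrt (1 - \<rho>\<^sup>2))"
  shows "enn2real (hausdorff_hyp (DIM('a) - 1) ((*\<^sub>R) (\<rho>' / \<rho>) ` A)) \<le> \<Lambda> ^ (DIM('a) - 1) * enn2real (hausdorff_hyp (DIM('a) - 1) A)"
proof -
  interpret S: hyp_sphere \<rho> using rho by unfold_locales
  interpret S': hyp_sphere \<rho>' using rho' by unfold_locales
  let ?f = "(*\<^sub>R) (\<rho>' / \<rho>) :: 'a \<Rightarrow> 'a" let ?H = "hausdorff_hyp (DIM('a) - 1) :: 'a set \<Rightarrow> ennreal"
  have \<Lambda>: "\<Lambda> > 0" unfolding \<Lambda>_def using S.sigma_pos S'.sigma_pos rho rho' by (intro divide_pos_pos)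
  have f: "?f ` A \<subseteq> sphere 0 \<rho>'" using A rho rho' by auto
  have fin: "?H A < top" using A by (rule S.hausdorff_sphere_finite)
  have le: "enn2real (?H (?f ` A)) \<le> (\<Lambda> * (1 + e)) ^ (DIM('a) - 1) * enn2real (?H A)" if e: "e > 0" for e
  proof -
    obtain \<delta> :: real where \<delta>: "\<delta> > 0" "\<And>x. 0 \<le> x \<Longrightarrow> x \<le> \<delta> \<Longrightarrow> sinh x \<le> (1 + e) * x"
      using sinh_le_near_0[OF e] by blast
    have L: "\<Lambda> * (1 + e) > 0" using \<Lambda> e by simp
    have "?H (?f ` A) \<le> ennreal ((\<Lambda> * (1 + e)) ^ (DIM('a) - 1)) * ?H A"
    proof (rule hausdorff_hyp_lipschitz[OF L \<delta>(1)])
      show "?f ` A \<subseteq> hyp_space" using f S'.sphere_subset_hyp by blast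
      fix x y assume xy: "x \<in> A" "y \<in> A" "hdist x y \<le> \<delta>"
      have x: "x \<in> sphere 0 \<rho>" and y: "y \<in> sphere 0 \<rho>" using xy A by blast+
      have fx: "?f x \<in> sphere 0 \<rho>'" and fy: "?f y \<in> sphere 0 \<rho>'" using xy f by blast+
      have "dist (?f x) (?f y) = (\<rho>' / \<rho>) * dist x y"
        using rho rho' by (simp add: dist_norm flip: scaleR_diff_right)
      then have "sinh (hdist (?f x) (?f y) / 2) = \<Lambda> * sinh (hdist x y / 2)"
        unfolding S'.sinh_half_hdist[OF fx fy] S.sinh_half_hdist[OF x y] \<Lambda>_def
        using S.sigma_pos S'.sigma_pos rho rho' by simp
      moreover have "hdist (?f x) (?f y) / 2 \<le> sinh (hdist (?f x) (?f y) / 2)"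
        using S'.hdist_nonneg_sphere[OF fx fy] by (intro sinh_ge_self) simp
      moreover have "\<Lambda> * sinh (hdist x y / 2) \<le> \<Lambda> * ((1 + e) * (hdist x y / 2))"
        using S.hdist_nonneg_sphere[OF x y] xy(3) \<Lambda> by (intro mult_left_mono \<delta>(2)) auto
      ultimately show "hdist (?f x) (?f y) \<le> \<Lambda> * (1 + e) * hdist x y" by simp
    qed
    then have "enn2real (?H (?f ` A)) \<le> enn2real (ennreal ((\<Lambda> * (1 + e)) ^ (DIM('a) - 1)) * ?H A)"
      using fin by (intro enn2real_mono) (auto simp: ennreal_mult_less_top)
    also have "\<dots> = (\<Lambda> * (1 + e)) ^ (DIM('a) - 1) * enn2real (?H A)"
      using L by (simp add: enn2real_mult)
    finally show ?thesis .
  qed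
  have "enn2real (?H (?f ` A)) \<le> (\<Lambda> * (1 + 0)) ^ (DIM('a) - 1) * enn2real (?H A)"
  proof (rule tendsto_lowerbound)
    show "((\<lambda>e. (\<Lambda> * (1 + e)) ^ (DIM('a) - 1) * enn2real (?H A)) \<longlongrightarrow> (\<Lambda> * (1 + 0)) ^ (DIM('a) - 1) * enn2real (?H A)) (at_right 0)"
      by (intro tendsto_intros)
    show "\<forall>\<^sub>F e in at_right 0. enn2real (?H (?f ` A)) \<le> (\<Lambda> * (1 + e)) ^ (DIM('a) - 1) * enn2real (?H A)"
      by (rule eventually_mono[OF eventually_at_right_less]) (rule le)
  qed simp
  then show ?thesis by simp
qed

lemma hausdorff_hyp_scaling:
  fixes A :: "'a::euclidean_space set"
  assumes rho: "0 < \<rho>" "\<rho> < 1" and rho': "0 < \<rho>'" "\<rho>' < 1" and A: "A \<subseteq> sphere 0 \<rho>"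
  defines "\<Lambda> \<equiv> (\<rho>' / sqrt (1 - \<rho>'\<^sup>2)) / (\<rho> / sqrt (1 - \<rho>\<^sup>2))"
  shows "enn2real (hausdorff_hyp (DIM('a) - 1) ((*\<^sub>R) (\<rho>' / \<rho>) ` A)) = \<Lambda> ^ (DIM('a) - 1) * enn2real (hausdorff_hyp (DIM('a) - 1) A)"
proof (rule antisym)
  let ?f = "(*\<^sub>R) (\<rho>' / \<rho>) :: 'a \<Rightarrow> 'a" let ?H = "hausdorff_hyp (DIM('a) - 1) :: 'a set \<Rightarrow> ennreal"
  interpret S: hyp_sphere \<rho> using rho by unfold_locales
  interpret S': hyp_sphere \<rho>' using rho' by unfold_locales
  have \<Lambda>: "\<Lambda> > 0" unfolding \<Lambda>_def using S.sigma_pos S'.sigma_pos rho rho' by (intro divide_pos_pos)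
  show "enn2real (?H (?f ` A)) \<le> \<Lambda> ^ (DIM('a) - 1) * enn2real (?H A)"
    unfolding \<Lambda>_def by (rule hausdorff_hyp_scaling_le[OF rho rho' A])
  have f: "?f ` A \<subseteq> sphere 0 \<rho>'" using A rho rho' by auto
  \<comment> \<open>The reverse inequality is the same bound for the inverse dilation, whose factor
    is \<open>inverse \<Lambda>\<close>.\<close>
  have "(*\<^sub>R) (\<rho> / \<rho>') ` ?f ` A = A" using rho rho' by (simp add: image_image)
  moreover have "(\<rho> / sqrt (1 - \<rho>\<^sup>2)) / (\<rho>' / sqrt (1 - \<rho>'\<^sup>2)) = inverse \<Lambda>" by (simp add: \<Lambda>_def mult.commute)
  ultimately have "enn2real (?H A) \<le> inverse \<Lambda> ^ (DIM('a) - 1) * enn2real (?H (?f ` A))"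
    using hausdorff_hyp_scaling_le[OF rho' rho f] by simp
  then have "\<Lambda> ^ (DIM('a) - 1) * enn2real (?H A) \<le> \<Lambda> ^ (DIM('a) - 1) * (inverse \<Lambda> ^ (DIM('a) - 1) * enn2real (?H (?f ` A)))"
    using \<Lambda> by (intro mult_left_mono) auto
  also have "\<dots> = (\<Lambda> * inverse \<Lambda>) ^ (DIM('a) - 1) * enn2real (?H (?f ` A))"
    by (simp only: power_mult_distrib mult.assoc)
  also have "\<dots> = enn2real (?H (?f ` A))" using \<Lambda> by simp
  finally show "\<Lambda> ^ (DIM('a) - 1) * enn2real (?H A) \<le> enn2real (?H (?f ` A))" .
qed

section \<open>Solid angles of polyhedral cones\<close>

lemma sphere_fraction_cong:
  assumes "\<And>y. y \<in> hsphere x r \<Longrightarrow> y \<in> P \<longleftrightarrow> y \<in> Q"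
  shows "sphere_fraction P x r = sphere_fraction Q x r"
proof -
  have "hsphere x r \<inter> P = hsphere x r \<inter> Q" using assms by blast
  then show ?thesis by (simp only: sphere_fraction_def)
qed

section \<open>Sphere fractions under boosts and dilations\<close>

lemma hsphere_boost:
  fixes a z :: "'a::euclidean_space"
  assumes a: "a \<in> hyp_space" and z: "z \<in> hyp_space"
  shows "hsphere (boost a z) r \<inter> P = boost a ` (hsphere z r \<inter> {w \<in> hyp_space. boost a w \<in> P})"
proof (intro equalityI subsetI)
  fix y assume y: "y \<in> hsphere (boost a z) r \<inter> P"
  define w where "w = boost (-a) y"
  have yh: "y \<in> hyp_space" using y by (simp add: hsphere_def)
  have w: "w \<in> hyp_space" unfolding w_def using a yh by (intro boost_in_hyp) simp_all
  have bw: "boost a w = y" unfolding w_def by (rule boost_boost_uminus[OF a yh])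
  have "hdist z w = hdist (boost a z) (boost a w)" by (rule hdist_boost[OF a z w, symmetric])
  also have "\<dots> = r" using y bw by (simp add: hsphere_def)
  finally have "w \<in> hsphere z r \<inter> {w \<in> hyp_space. boost a w \<in> P}"
    using w y bw by (simp add: hsphere_def)
  then show "y \<in> boost a ` (hsphere z r \<inter> {w \<in> hyp_space. boost a w \<in> P})"
    unfolding bw[symmetric] by (rule imageI)
next
  fix y assume "y \<in> boost a ` (hsphere z r \<inter> {w \<in> hyp_space. boost a w \<in> P})"
  then obtain w where w: "w \<in> hyp_space" "hdist z w = r" "boost a w \<in> P" "y = boost a w"
    by (auto simp: hsphere_def)
  then show "y \<in> hsphere (boost a z) r \<inter> P"
    using boost_in_hyp[OF a w(1)] hdist_boost[OF a z w(1)] by (simp add: hsphere_def)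
qed

lemma hausdorff_hyp_boost:
  assumes a: "a \<in> hyp_space" and A: "A \<subseteq> hyp_space"
  shows "hausdorff_hyp s (boost a ` A) = hausdorff_hyp s A"
proof (rule hausdorff_hyp_isometry[OF _ A])
  show "boost a x \<in> hyp_space" if "x \<in> A" for x using boost_in_hyp[OF a] A that by blast
  show "hdist (boost a x) (boost a y) = hdist x y" if "x \<in> A" "y \<in> A" for x y
    using hdist_boost[OF a] A that by blast
  show "boost (-a) (boost a x) = x" if "x \<in> A" for x using boost_uminus_boost[OF a] A that by blast
qed

lemma sphere_fraction_boost:
  fixes a z :: "'a::euclidean_space"
  assumes a: "a \<in> hyp_space" and z: "z \<in> hyp_space"
  shows "sphere_fraction P (boost a z) r = sphere_fraction {w \<in> hyp_space. boost a w \<in> P} z r"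
proof -
  have 1: "hausdorff_hyp s (hsphere (boost a z) r \<inter> P) = hausdorff_hyp s (hsphere z r \<inter> {w \<in> hyp_space. boost a w \<in> P})" for s P
    unfolding hsphere_boost[OF a z] by (rule hausdorff_hyp_boost[OF a]) blast
  have "hsphere z r \<inter> {w \<in> hyp_space. boost a w \<in> UNIV} = hsphere z r" by (auto simp: hsphere_def)
  then have 2: "hausdorff_hyp s (hsphere (boost a z) r) = hausdorff_hyp s (hsphere z r)" for s
    using 1[of s UNIV] by (simp only: Int_UNIV_right)
  show ?thesis unfolding sphere_fraction_def 1 2 ..
qed

text \<open>The polar cone of \<open>N\<close>: a polyhedral cone given by its outer
  normals.\<close>

definition normal_cone :: "'a::euclidean_space set \<Rightarrow> 'a set" where
  "normal_cone N = {z. \<forall>n\<in>N. n \<bullet> z \<le> 0}"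

text \<open>Radius 1 is an arbitrary representative: \<open>sphere_fraction_normal_cone\<close>
  shows that all positive radii give the same fraction.\<close>

definition solid_angle :: "'a::euclidean_space set \<Rightarrow> real" where
  "solid_angle N = sphere_fraction (normal_cone N) 0 1"

lemma tanh_in_01: "r > 0 \<Longrightarrow> 0 < tanh r \<and> tanh r < (1::real)"
  by (simp add: tanh_real_lt_1)

text \<open>Dilations map a cone to itself, and the power of \<Lambda> cancels between numerator and
  denominator.\<close>

lemma sphere_fraction_normal_cone:
  fixes N :: "'a::euclidean_space set"
  assumes r: "r > 0"
  shows "sphere_fraction (normal_cone N) 0 r = solid_angle N"
proof -
  let ?H = "\<lambda>A::'a set. enn2real (hausdorff_hyp (DIM('a) - 1) A)"
  let ?K = "normal_cone N"
  define f :: "'a \<Rightarrow> 'a" where "f = (*\<^sub>R) (tanh 1 / tanh r)"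
  define \<Lambda> where "\<Lambda> = (tanh 1 / sqrt (1 - (tanh 1)\<^sup>2)) / (tanh r / sqrt (1 - (tanh r)\<^sup>2))"
  have t: "0 < tanh r" "tanh r < 1" "0 < tanh (1::real)" "tanh (1::real) < 1"
    using tanh_in_01[OF r] tanh_in_01[of 1] by auto
  interpret S: hyp_sphere "tanh r" using t by unfold_locales
  interpret S1: hyp_sphere "tanh 1" using t by unfold_locales
  have \<Lambda>: "\<Lambda> > 0" unfolding \<Lambda>_def using S.sigma_pos S1.sigma_pos t by (intro divide_pos_pos)
  have scale: "?H (f ` A) = \<Lambda> ^ (DIM('a) - 1) * ?H A" if "A \<subseteq> sphere 0 (tanh r)" for A
    unfolding f_def \<Lambda>_def by (rule hausdorff_hyp_scaling[OF t that])
  have imf: "f ` (sphere 0 (tanh r) \<inter> normal_cone M) = sphere 0 (tanh 1) \<inter> normal_cone M" for M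
  proof (intro equalityI subsetI)
    fix y assume "y \<in> f ` (sphere 0 (tanh r) \<inter> normal_cone M)"
    then obtain x where x: "norm x = tanh r" "\<forall>n\<in>M. n \<bullet> x \<le> 0" "y = f x"
      by (auto simp: normal_cone_def)
    then have "norm y = tanh 1" using t by (simp add: f_def)
    moreover have "n \<bullet> y \<le> 0" if "n \<in> M" for n
      using x that t by (simp add: f_def mult_nonneg_nonpos divide_nonpos_pos)
    ultimately show "y \<in> sphere 0 (tanh 1) \<inter> normal_cone M" by (simp add: normal_cone_def)
  next
    fix y :: 'a assume y: "y \<in> sphere 0 (tanh 1) \<inter> normal_cone M"
    define x where "x = (tanh r / tanh 1) *\<^sub>R y"
    have "norm x = tanh r" using y t by (simp add: x_def)
    moreover have "n \<bullet> x \<le> 0" if "n \<in> M" for n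
      using y that t by (simp add: x_def normal_cone_def mult_nonneg_nonpos divide_nonpos_pos)
    moreover have "y = f x" using t by (simp add: f_def x_def)
    ultimately show "y \<in> f ` (sphere 0 (tanh r) \<inter> normal_cone M)"
      by (auto simp: normal_cone_def)
  qed
  have 1: "?H (sphere 0 (tanh 1) \<inter> ?K) = \<Lambda> ^ (DIM('a) - 1) * ?H (sphere 0 (tanh r) \<inter> ?K)"
    unfolding imf[symmetric] by (rule scale) blast
  have "normal_cone {} = (UNIV :: 'a set)" by (simp add: normal_cone_def)
  then have 2: "?H (sphere 0 (tanh 1)) = \<Lambda> ^ (DIM('a) - 1) * ?H (sphere 0 (tanh r))"
    using imf[of "{}"] scale[of "sphere 0 (tanh r)"] by simp
  show ?thesis
    unfolding solid_angle_def sphere_fraction_def hsphere_0[OF r] hsphere_0[OF zero_less_one] 1 2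
    using \<Lambda> by simp
qed

text \<open>\<open>hsphere 0 1\<close> is the Euclidean sphere of radius \<open>tanh 1\<close>, so
  all solid angles become ratios in one fixed finite measure.\<close>

interpretation unit: hyp_sphere "tanh 1"
  using tanh_in_01[of 1] by unfold_locales auto

lemma normal_cone_in_sets:
  assumes "finite N"
  shows "{z \<in> sphere 0 (tanh 1). z \<in> normal_cone N} \<in> sets (unit.sphere_measure :: 'a::euclidean_space measure)"
  using assms
proof (induction N)
  case empty
  then show ?case using unit.sphere_in_sphere_measure by (simp add: normal_cone_def sphere_def)
next
  case (insert n N)
  have "{z \<in> sphere 0 (tanh 1). z \<in> normal_cone (insert n N)} =
    {z \<in> sphere 0 (tanh 1). n \<bullet> z \<le> 0} \<inter> {z \<in> sphere 0 (tanh 1). z \<in> normal_cone N}"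
    by (auto simp: normal_cone_def)
  then show ?case using sets.Int[OF unit.halfspace_in_sphere_measure[of n] insert.IH] by (simp only:)
qed

lemma solid_angle_eq_measure:
  assumes "finite (N :: 'a::euclidean_space set)"
  shows "solid_angle N = measure unit.sphere_measure {z \<in> sphere (0::'a) (tanh 1). z \<in> normal_cone N}
     / measure unit.sphere_measure (sphere (0::'a) (tanh 1))"
proof -
  have "{z \<in> sphere (0::'a) (tanh 1). z \<in> normal_cone N} = sphere 0 (tanh 1) \<inter> normal_cone N" by auto
  then show ?thesis
    unfolding solid_angle_def sphere_fraction_def hsphere_0[OF zero_less_one]
    using unit.measure_sphere_measure[OF normal_cone_in_sets[OF assms]]
      unit.measure_sphere_measure[OF unit.sphere_in_sphere_measure[where 'a='a]]
    by simp
qed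

lemma solid_angle_uminus:
  fixes N :: "'a::euclidean_space set"
  shows "solid_angle (uminus ` N) = solid_angle N"
proof -
  have "hsphere 0 1 \<inter> normal_cone (uminus ` N) = uminus ` (hsphere 0 1 \<inter> normal_cone N)"
  proof (intro equalityI subsetI)
    fix y :: 'a assume y: "y \<in> hsphere 0 1 \<inter> normal_cone (uminus ` N)"
    then have "- y \<in> hsphere 0 1 \<inter> normal_cone N"
      by (simp add: hsphere_0 normal_cone_def)
    then have "- (- y) \<in> uminus ` (hsphere 0 1 \<inter> normal_cone N)" by (rule imageI)
    then show "y \<in> uminus ` (hsphere 0 1 \<inter> normal_cone N)" by simp
  qed (auto simp: hsphere_0 normal_cone_def)
  moreover have "hausdorff_hyp s (uminus ` (hsphere 0 1 \<inter> normal_cone N)) = hausdorff_hyp s (hsphere 0 1 \<inter> normal_cone N)" for s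
    by (rule unit.hausdorff_sphere_uminus) (simp add: hsphere_0)
  ultimately show ?thesis unfolding solid_angle_def sphere_fraction_def by simp
qed

lemma solid_angle_halfspace:
  fixes n :: "'a::euclidean_space"
  assumes "n \<noteq> 0"
  shows "solid_angle {n} = 1 / 2"
proof -
  let ?M = "unit.sphere_measure :: 'a measure"
  let ?S = "sphere (0::'a) (tanh 1)"
  interpret M: finite_measure ?M by (rule unit.finite_sphere_measure)
  define A where "A = {z \<in> ?S. z \<in> normal_cone {n}}"
  define B where "B = {z \<in> ?S. z \<in> normal_cone {- n}}"
  have AB: "A \<in> sets ?M" "B \<in> sets ?M" unfolding A_def B_def by (intro normal_cone_in_sets; simp)+
  have "A \<inter> B = {z \<in> ?S. n \<bullet> z = 0}" "A \<union> B = ?S" by (auto simp: A_def B_def normal_cone_def)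
  then have null: "A \<inter> B \<in> null_sets ?M" and un: "A \<union> B = ?S"
    using unit.hyperplane_null_sphere_measure[OF assms] by simp_all
  \<comment> \<open>The two closed halves overlap only in a null hyperplane section, so their
    measures add up to the whole.\<close>
  have "measure ?M ?S = measure ?M A + measure ?M B"
    unfolding un[symmetric]
    using measure_Un_null_set[of ?M] M.finite_measure_Union'[OF AB] measure_Diff_null_set[OF AB(2) null]
    by (metis Diff_Int Int_commute Diff_cancel Un_empty_left sup_bot_left)
  moreover have "measure ?M A = solid_angle {n} * measure ?M ?S"
    unfolding A_def using unit.measure_sphere_pos[where 'a='a] by (simp add: solid_angle_eq_measure)
  moreover have "measure ?M B = solid_angle {n} * measure ?M ?S"
    unfolding B_def using unit.measure_sphere_pos[where 'a='a] solid_angle_uminus[of "{n}"]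
    by (simp add: solid_angle_eq_measure)
  ultimately have "measure ?M ?S * (2 * solid_angle {n} - 1) = 0" by (simp add: algebra_simps)
  then show ?thesis using unit.measure_sphere_pos[where 'a='a] by simp
qed

text \<open>The angle of a cone of half-spaces is the same at all points where every one of them is
  tight. This makes \<open>interior_angle\<close> independent of the center, and it allows the angle
  of an edge or facet to be evaluated at a vertex on it. The proof moves \<open>v\<close> to the
  origin, which turns \<open>x\<close> into a point \<open>z\<close> orthogonal to all the tilted
  normals.\<close>

lemma solid_angle_tilt_line:
  fixes h :: "'i \<Rightarrow> 'a::euclidean_space"
  assumes x: "x \<in> hyp_space" and v: "v \<in> hyp_space"
    and hx: "\<And>i. i \<in> I \<Longrightarrow> h i \<bullet> x = b i" and hv: "\<And>i. i \<in> I \<Longrightarrow> h i \<bullet> v = b i"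
  shows "solid_angle ((\<lambda>i. tilt x (h i)) ` I) = solid_angle ((\<lambda>i. tilt v (h i)) ` I)"
proof -
  define W where "W = {y. \<forall>i\<in>I. h i \<bullet> y \<le> b i}"
  define z where "z = boost (-v) x"
  have z: "z \<in> hyp_space" unfolding z_def using v x by (intro boost_in_hyp) simp_all
  have xz: "x = boost v z" unfolding z_def by (rule boost_boost_uminus[OF v x, symmetric])
  have W: "w \<in> hyp_space \<Longrightarrow> boost y w \<in> W \<longleftrightarrow> w \<in> normal_cone ((\<lambda>i. tilt y (h i)) ` I)"
    if y: "y \<in> hyp_space" "\<And>i. i \<in> I \<Longrightarrow> h i \<bullet> y = b i" for y w
    using inner_boost_le_iff_tilt[OF y(1) _ y(2)] by (auto simp: W_def normal_cone_def)
  have zero: "(0::'a) \<in> hyp_space" by simp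
  have hs: "y \<in> hsphere u r \<Longrightarrow> y \<in> hyp_space" for y u :: 'a and r by (simp add: hsphere_def)
  have perp: "tilt v (h i) \<bullet> z = 0" if i: "i \<in> I" for i
  proof -
    have "tilt v (h i) \<bullet> z \<le> 0"
      using inner_boost_le_iff_tilt[OF v z hv[OF i]] hx[OF i] xz by simp
    moreover have "tilt v (- h i) \<bullet> z \<le> 0"
      using inner_boost_le_iff_tilt[OF v z, of "- h i" "- b i"] hv[OF i] hx[OF i] xz by simp
    moreover have "tilt v (- h i) = - tilt v (h i)" by (simp add: tilt_def)
    ultimately show ?thesis by simp
  qed
  have "solid_angle ((\<lambda>i. tilt x (h i)) ` I) = sphere_fraction {w \<in> hyp_space. boost x w \<in> W} 0 1"
    unfolding solid_angle_def by (rule sphere_fraction_cong) (use W[OF x hx] hs in blast)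
  also have "\<dots> = sphere_fraction W x 1"
    using sphere_fraction_boost[OF x zero, of W 1] by simp
  also have "\<dots> = sphere_fraction {w \<in> hyp_space. boost v w \<in> W} z 1"
    unfolding xz by (rule sphere_fraction_boost[OF v z])
  also have "\<dots> = sphere_fraction (normal_cone ((\<lambda>i. tilt v (h i)) ` I)) z 1"
    by (rule sphere_fraction_cong) (use W[OF v hv] hs in blast)
  also have "\<dots> = sphere_fraction {w \<in> hyp_space. boost z w \<in> normal_cone ((\<lambda>i. tilt v (h i)) ` I)} 0 1"
    using sphere_fraction_boost[OF z zero] by simp
  \<comment> \<open>Since \<open>z\<close> is orthogonal to the normals, \<open>tilt z\<close> fixes
    them, so \<open>boost z\<close> preserves the cone inside the ball.\<close>
  also have "\<dots> = sphere_fraction (normal_cone ((\<lambda>i. tilt v (h i)) ` I)) 0 1"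
  proof (rule sphere_fraction_cong)
    fix y :: 'a assume "y \<in> hsphere 0 1"
    then have y: "y \<in> hyp_space" by (rule hs)
    have "tilt v (h i) \<bullet> boost z y \<le> 0 \<longleftrightarrow> tilt v (h i) \<bullet> y \<le> 0" if "i \<in> I" for i
      using inner_boost_le_iff_tilt[OF z y perp[OF that]] by (simp add: tilt_def[of z] perp[OF that])
    then show "y \<in> {w \<in> hyp_space. boost z w \<in> normal_cone ((\<lambda>i. tilt v (h i)) ` I)} \<longleftrightarrow>
      y \<in> normal_cone ((\<lambda>i. tilt v (h i)) ` I)"
      using y by (simp add: normal_cone_def)
  qed
  finally show ?thesis unfolding solid_angle_def .
qed

text \<open>Near \<open>x\<close> only the inequalities that are tight at \<open>x\<close> matter;
  moving \<open>x\<close> to the origin makes these homogeneous, and then the radius drops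
  out.\<close>

lemma sphere_fraction_eventually:
  fixes h :: "'i \<Rightarrow> 'a::euclidean_space"
  assumes x: "x \<in> hyp_space" "x \<in> P" and fin: "finite I" and P: "P = {y. \<forall>i\<in>I. h i \<bullet> y \<le> b i}"
  shows "\<forall>\<^sub>F r in at_right 0. sphere_fraction P x r = solid_angle ((\<lambda>i. tilt x (h i)) ` {i \<in> I. h i \<bullet> x = b i})"
proof -
  \<comment> \<open>The linear coefficient from \<open>inner_boost_le_iff\<close>; on the sphere of
    Euclidean radius \<open>tanh r\<close> it contributes at most
    \<open>norm (c i) * tanh r\<close>.\<close>
  define c where "c i = cofactor x *\<^sub>R h i + ((h i \<bullet> x) / (1 + cofactor x) - b i) *\<^sub>R x" for i
  have ev: "\<forall>\<^sub>F r in at_right 0. norm (c i) * tanh r < b i - h i \<bullet> x" if i: "i \<in> I" "h i \<bullet> x \<noteq> b i" for i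
  proof -
    have pos: "0 < b i - h i \<bullet> x" using x(2) i by (auto simp: P less_le)
    have t: "((\<lambda>r. norm (c i) * tanh r) \<longlongrightarrow> norm (c i) * tanh 0) (at_right 0)"
      by (intro tendsto_intros) auto
    show ?thesis by (rule order_tendstoD(2)[OF t]) (use pos in simp)
  qed
  have "\<forall>\<^sub>F r in at_right 0. \<forall>i\<in>{i \<in> I. h i \<bullet> x \<noteq> b i}. norm (c i) * tanh r < b i - h i \<bullet> x"
    using fin ev by (intro eventually_ball_finite) auto
  then have "\<forall>\<^sub>F r in at_right 0. (\<forall>i\<in>{i \<in> I. h i \<bullet> x \<noteq> b i}. norm (c i) * tanh r < b i - h i \<bullet> x) \<and> 0 < r"
    using eventually_at_right_less by (rule eventually_conj)
  then show ?thesis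
  proof (rule eventually_mono)
    fix r :: real
    assume r: "(\<forall>i\<in>{i \<in> I. h i \<bullet> x \<noteq> b i}. norm (c i) * tanh r < b i - h i \<bullet> x) \<and> 0 < r"
    let ?N = "(\<lambda>i. tilt x (h i)) ` {i \<in> I. h i \<bullet> x = b i}"
    have "sphere_fraction P x r = sphere_fraction {w \<in> hyp_space. boost x w \<in> P} 0 r"
      using sphere_fraction_boost[OF x(1), of 0 P r] by simp
    also have "\<dots> = sphere_fraction (normal_cone ?N) 0 r"
    proof (rule sphere_fraction_cong)
      fix y :: 'a assume y: "y \<in> hsphere 0 r"
      then have yh: "y \<in> hyp_space" by (simp add: hsphere_def)
      have ny: "norm y = tanh r" using y r by (simp add: hsphere_0)
      have 1: "h i \<bullet> boost x y \<le> b i" if "i \<in> I" "h i \<bullet> x \<noteq> b i" for i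
      proof -
        have "c i \<bullet> y \<le> norm (c i) * norm y" by (rule norm_cauchy_schwarz)
        also have "\<dots> < b i - h i \<bullet> x" using r that ny by simp
        finally show ?thesis unfolding inner_boost_le_iff[OF x(1) yh] c_def by linarith
      qed
      have 2: "h i \<bullet> boost x y \<le> b i \<longleftrightarrow> tilt x (h i) \<bullet> y \<le> 0" if "h i \<bullet> x = b i" for i
        by (rule inner_boost_le_iff_tilt[OF x(1) yh that])
      show "y \<in> {w \<in> hyp_space. boost x w \<in> P} \<longleftrightarrow> y \<in> normal_cone ?N"
        using yh 1 2 by (auto simp: P normal_cone_def)
    qed
    also have "\<dots> = solid_angle ?N" using r by (intro sphere_fraction_normal_cone) simp
    finally show "sphere_fraction P x r = solid_angle ?N" .
  qed
qed

lemma interior_angle_eqI: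
  assumes "rel_interior F \<noteq> {}"
    and "\<And>x. x \<in> rel_interior F \<Longrightarrow> \<forall>\<^sub>F r in at_right 0. sphere_fraction P x r = \<alpha>"
  shows "interior_angle F P = \<alpha>"
  unfolding interior_angle_def
proof (rule the_equality)
  show "\<forall>x\<in>rel_interior F. \<forall>\<^sub>F r in at_right 0. sphere_fraction P x r = \<alpha>" using assms(2) by blast
  fix \<beta> assume \<beta>: "\<forall>x\<in>rel_interior F. \<forall>\<^sub>F r in at_right 0. sphere_fraction P x r = \<beta>"
  obtain x where x: "x \<in> rel_interior F" using assms(1) by blast
  have "\<forall>\<^sub>F r::real in at_right 0. \<alpha> = \<beta>"
    using assms(2)[OF x] \<beta>[rule_format, OF x] by eventually_elim simp
  then show "\<beta> = \<alpha>" by (simp add: eventually_const_iff)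
qed

section \<open>Faces of full-dimensional polytopes\<close>

lemma convex_hull_subset_bij:
  fixes C :: "'a::euclidean_space set"
  assumes C: "\<not> affine_dependent C"
  shows "bij_betw (\<lambda>c. convex hull c) {c. c \<subseteq> C \<and> card c = k + 1}
     {T. T face_of convex hull C \<and> aff_dim T = int k}"
proof -
  have fin: "finite C" using C by (rule aff_independent_finite)
  have ind: "\<not> affine_dependent c" if "c \<subseteq> C" for c
    using C that affine_dependent_subset by blast
  have dim: "aff_dim (convex hull c) = int (card c) - 1" if "c \<subseteq> C" for c
    using aff_dim_affine_independent[OF ind[OF that]] by (simp add: aff_dim_convex_hull)
  show ?thesis
  proof (rule bij_betw_imageI)
    show "inj_on (\<lambda>c. convex hull c) {c. c \<subseteq> C \<and> card c = k + 1}"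
    proof (rule inj_onI)
      fix c c' assume c: "c \<in> {c. c \<subseteq> C \<and> card c = k + 1}" "c' \<in> {c. c \<subseteq> C \<and> card c = k + 1}"
        and eq: "convex hull c = convex hull c'"
      \<comment> \<open>An affinely independent set is recovered from its hull as the set of extreme
        points.\<close>
      have "c = {x. x extreme_point_of (convex hull c)}"
        using c extreme_point_of_convex_hull_affine_independent[OF ind[of c]] by auto
      also have "\<dots> = c'"
        using c extreme_point_of_convex_hull_affine_independent[OF ind[of c']] unfolding eq by auto
      finally show "c = c'" .
    qed
    show "(\<lambda>c. convex hull c) ` {c. c \<subseteq> C \<and> card c = k + 1} = {T. T face_of convex hull C \<and> aff_dim T = int k}"
    proof (intro equalityI subsetI)
      fix T assume "T \<in> (\<lambda>c. convex hull c) ` {c. c \<subseteq> C \<and> card c = k + 1}"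
      then obtain c where c: "c \<subseteq> C" "card c = k + 1" "T = convex hull c" by blast
      then show "T \<in> {T. T face_of convex hull C \<and> aff_dim T = int k}"
        using dim[OF c(1)] face_of_convex_hull_affine_independent[OF C, of T] by auto
    next
      fix T assume T: "T \<in> {T. T face_of convex hull C \<and> aff_dim T = int k}"
      then obtain c where c: "c \<subseteq> C" "T = convex hull c"
        using face_of_convex_hull_affine_independent[OF C] by blast
      then have "card c = k + 1" using dim[OF c(1)] T by simp
      then show "T \<in> (\<lambda>c. convex hull c) ` {c. c \<subseteq> C \<and> card c = k + 1}" using c by blast
    qed
  qed
qed

lemma card_faces_simplex:
  fixes F :: "'a::euclidean_space set"
  assumes F: "int n simplex F"
  shows "card {T. T face_of F \<and> aff_dim T = int k} = (n + 1) choose (k + 1)"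
proof -
  obtain C where C: "\<not> affine_dependent C" "int (card C) = int n + 1" "F = convex hull C"
    using F by (auto simp: simplex_def)
  have "card {T. T face_of F \<and> aff_dim T = int k} = card {c. c \<subseteq> C \<and> card c = k + 1}"
    using bij_betw_same_card[OF convex_hull_subset_bij[OF C(1)]] C(3) by metis
  also have "\<dots> = card C choose (k + 1)"
    by (rule n_subsets[OF aff_independent_finite[OF C(1)]])
  also have "card C = n + 1" using C(2) by linarith
  finally show ?thesis .
qed

lemma card_edges_triangle_at_vertex:
  fixes F :: "'a::euclidean_space set"
  assumes F: "2 simplex F" and v: "{v} face_of F"
  shows "card {e. e face_of F \<and> aff_dim e = 1 \<and> v \<in> e} = 2"
proof -
  obtain C where C: "\<not> affine_dependent C" "int (card C) = 2 + 1" "F = convex hull C"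
    using F by (auto simp: simplex_def)
  have fin: "finite C" "card C = 3" using C aff_independent_finite by auto
  have vC: "v \<in> C"
    using v C extreme_point_of_convex_hull_affine_independent[OF C(1)] by (simp add: face_of_singleton)
  have ind: "\<not> affine_dependent c" if "c \<subseteq> C" for c
    using C that affine_dependent_subset by blast
  \<comment> \<open>\<open>v\<close> is extreme in \<open>F\<close>, hence in every smaller hull
    that contains it, and an extreme point of a hull is one of the generators.\<close>
  have vc: "v \<in> convex hull c \<longleftrightarrow> v \<in> c" if c: "c \<subseteq> C" for c
  proof
    assume "v \<in> convex hull c"
    moreover have "convex hull c \<subseteq> F" unfolding C(3) by (rule hull_mono[OF c])
    moreover have "v extreme_point_of F" using v by (simp add: face_of_singleton)
    ultimately have "v extreme_point_of (convex hull c)"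
      unfolding extreme_point_of_def by blast
    then show "v \<in> c" using extreme_point_of_convex_hull by blast
  qed (rule hull_inc)
  have b: "bij_betw (\<lambda>c. convex hull c) {c. c \<subseteq> C \<and> card c = 1 + 1}
     {T. T face_of F \<and> aff_dim T = int 1}"
    unfolding C(3) by (rule convex_hull_subset_bij[OF C(1)])
  have "{e. e face_of F \<and> aff_dim e = 1 \<and> v \<in> e} = (\<lambda>c. convex hull c) ` {c. c \<subseteq> C \<and> card c = 2 \<and> v \<in> c}"
  proof (intro equalityI subsetI)
    fix e assume e: "e \<in> {e. e face_of F \<and> aff_dim e = 1 \<and> v \<in> e}"
    then have "e \<in> {T. T face_of F \<and> aff_dim T = int 1}" by simp
    then obtain c where c: "c \<subseteq> C" "card c = 1 + 1" "e = convex hull c"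
      using b unfolding bij_betw_def by blast
    then show "e \<in> (\<lambda>c. convex hull c) ` {c. c \<subseteq> C \<and> card c = 2 \<and> v \<in> c}" using e vc by auto
  next
    fix e assume "e \<in> (\<lambda>c. convex hull c) ` {c. c \<subseteq> C \<and> card c = 2 \<and> v \<in> c}"
    then obtain c where c: "c \<subseteq> C" "card c = 1 + 1" "v \<in> c" "e = convex hull c" by auto
    then have "e \<in> {T. T face_of F \<and> aff_dim T = int 1}" using b unfolding bij_betw_def by blast
    then show "e \<in> {e. e face_of F \<and> aff_dim e = 1 \<and> v \<in> e}" using c vc by auto
  qed
  moreover have "inj_on (\<lambda>c. convex hull c) {c. c \<subseteq> C \<and> card c = 2 \<and> v \<in> c}"
    using b unfolding bij_betw_def by (elim conjE) (rule inj_on_subset, auto)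
  ultimately have "card {e. e face_of F \<and> aff_dim e = 1 \<and> v \<in> e} = card {c. c \<subseteq> C \<and> card c = 2 \<and> v \<in> c}"
    by (simp add: card_image)
  also have "{c. c \<subseteq> C \<and> card c = 2 \<and> v \<in> c} = insert v ` {c. c \<subseteq> C - {v} \<and> card c = 1}"
  proof (intro equalityI subsetI)
    fix c assume c: "c \<in> {c. c \<subseteq> C \<and> card c = 2 \<and> v \<in> c}"
    then have "c = insert v (c - {v})" "c - {v} \<subseteq> C - {v}" "card (c - {v}) = 1" by auto
    then show "c \<in> insert v ` {c. c \<subseteq> C - {v} \<and> card c = 1}" by blast
  next
    fix c assume "c \<in> insert v ` {c. c \<subseteq> C - {v} \<and> card c = 1}"
    then obtain c' where c': "c' \<subseteq> C - {v}" "card c' = 1" "c = insert v c'" by blast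
    then have "finite c'" "v \<notin> c'" using fin finite_subset by blast+
    then show "c \<in> {c. c \<subseteq> C \<and> card c = 2 \<and> v \<in> c}" using c' vC by auto
  qed
  also have "card \<dots> = card {c. c \<subseteq> C - {v} \<and> card c = 1}"
    by (rule card_image) (auto simp: inj_on_def)
  also have "\<dots> = card (C - {v}) choose 1" using fin by (intro n_subsets) auto
  also have "\<dots> = 2" using fin vC by simp
  finally show ?thesis .
qed

section \<open>Facet normals and ridges\<close>

locale full_polytope =
  fixes P :: "'a::euclidean_space set"
  assumes polytope: "polytope P" and int_ne: "interior P \<noteq> {}"
begin

lemma polyhedron: "polyhedron P" using polytope by (rule polytope_imp_polyhedron)
lemma convexP: "convex P" using polytope by (rule polytope_imp_convex)
lemma closedP: "closed P" using polytope by (rule polytope_imp_closed)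

lemma aff_dim_P: "aff_dim P = DIM('a)"
  using int_ne by (simp add: aff_dim_nonempty_interior)

definition facets :: "'a set set" where "facets = {F. F facet_of P}"

lemma facets_face_of: "F \<in> facets \<Longrightarrow> F face_of P"
  by (simp add: facets_def facet_of_def)

lemma finite_facets: "finite facets"
  unfolding facets_def by (rule finite_polyhedron_facets[OF polyhedron])

lemma facets_aff_dim: "F \<in> facets \<Longrightarrow> aff_dim F = DIM('a) - 1"
  by (simp add: facets_def facet_of_def aff_dim_P)

lemma facets_eq: "facets = {F. F face_of P \<and> aff_dim F = int (DIM('a) - 1)}"
proof -
  have "int (DIM('a) - 1) = int DIM('a) - 1" by (simp add: of_nat_diff)
  then show ?thesis by (auto simp: facets_def facet_of_def aff_dim_P)
qed

text \<open>Normal and offset of a facet are determined only up to a common positive factor; one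
  choice is fixed so that they become functions of the facet.\<close>

definition support :: "'a set \<Rightarrow> 'a \<times> real" where
  "support F = (SOME (a, b). a \<noteq> 0 \<and> P \<subseteq> {x. a \<bullet> x \<le> b} \<and> F = P \<inter> {x. a \<bullet> x = b})"

definition normal :: "'a set \<Rightarrow> 'a" where "normal F = fst (support F)"
definition offset :: "'a set \<Rightarrow> real" where "offset F = snd (support F)"

lemma support:
  assumes "F \<in> facets"
  shows "normal F \<noteq> 0 \<and> P \<subseteq> {x. normal F \<bullet> x \<le> offset F} \<and> F = P \<inter> {x. normal F \<bullet> x = offset F}"
proof -
  obtain a b where "a \<noteq> 0" "P \<subseteq> {x. a \<bullet> x \<le> b}" "F = P \<inter> {x. a \<bullet> x = b}"
    using facet_of_polyhedron[OF polyhedron] assms unfolding facets_def by blast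
  then have "\<exists>p. case p of (a, b) \<Rightarrow> a \<noteq> 0 \<and> P \<subseteq> {x. a \<bullet> x \<le> b} \<and> F = P \<inter> {x. a \<bullet> x = b}"
    by (intro exI[of _ "(a, b)"]) simp
  then have "case support F of (a, b) \<Rightarrow> a \<noteq> 0 \<and> P \<subseteq> {x. a \<bullet> x \<le> b} \<and> F = P \<inter> {x. a \<bullet> x = b}"
    unfolding support_def by (rule someI_ex)
  then show ?thesis unfolding normal_def offset_def by (simp add: case_prod_beta)
qed

lemma normal_nonzero: "F \<in> facets \<Longrightarrow> normal F \<noteq> 0"
  and normal_le: "F \<in> facets \<Longrightarrow> y \<in> P \<Longrightarrow> normal F \<bullet> y \<le> offset F"
  and in_facet_iff: "F \<in> facets \<Longrightarrow> y \<in> P \<Longrightarrow> y \<in> F \<longleftrightarrow> normal F \<bullet> y = offset F"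
  and facet_on: "F \<in> facets \<Longrightarrow> y \<in> F \<Longrightarrow> normal F \<bullet> y = offset F"
  using support by blast+

lemma normal_less_interior:
  assumes "F \<in> facets" "p \<in> interior P"
  shows "normal F \<bullet> p < offset F"
proof -
  have "interior P \<subseteq> interior {x. normal F \<bullet> x \<le> offset F}"
    using support[OF assms(1)] by (intro interior_mono) blast
  also have "\<dots> = {x. normal F \<bullet> x < offset F}"
    using normal_nonzero[OF assms(1)] by (rule interior_halfspace_le)
  finally show ?thesis using assms(2) by blast
qed

text \<open>A segment from an interior point to a point outside \<open>P\<close> crosses the
  boundary in some facet. The inequality of that facet is strict at the interior end, so it must be
  violated at the other end.\<close>

lemma P_eq_halfspaces: "P = {y. \<forall>F\<in>facets. normal F \<bullet> y \<le> offset F}"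
proof (intro equalityI subsetI)
  fix y assume y: "y \<in> {y. \<forall>F\<in>facets. normal F \<bullet> y \<le> offset F}"
  obtain p where p: "p \<in> interior P" using int_ne by blast
  show "y \<in> P"
  proof (rule ccontr)
    assume yP: "y \<notin> P"
    have "p \<in> P" using p interior_subset by blast
    then have "closed_segment p y \<inter> frontier P \<noteq> {}"
      using yP by (intro connected_Int_frontier) auto
    then obtain z where z: "z \<in> closed_segment p y" "z \<in> frontier P" by blast
    have "rel_frontier P = frontier P"
      using rel_frontier_nonempty_interior[OF int_ne] .
    then have "z \<in> \<Union> {F. F facet_of P}"
      using z(2) rel_frontier_of_polyhedron[OF polyhedron] by simp
    then obtain F where F: "F \<in> facets" "z \<in> F" by (auto simp: facets_def)
    obtain u where u: "0 \<le> u" "u \<le> 1" "z = (1 - u) *\<^sub>R p + u *\<^sub>R y"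
      using z(1) by (auto simp: closed_segment_def)
    have "z \<noteq> y" using z(2) yP closedP frontier_subset_closed by blast
    then have "u < 1" using u by (cases "u = 1") auto
    have "normal F \<bullet> z = (1 - u) * (normal F \<bullet> p) + u * (normal F \<bullet> y)"
      by (simp add: u inner_add_right)
    also have "\<dots> < (1 - u) * offset F + u * offset F"
      using normal_less_interior[OF F(1) p] \<open>u < 1\<close> u y F(1)
      by (intro add_less_le_mono mult_strict_left_mono mult_left_mono) auto
    finally have "normal F \<bullet> z < offset F" by (simp add: algebra_simps)
    then show False using facet_on[OF F] by simp
  qed
qed (use normal_le in blast)

lemma interior_iff: "y \<in> interior P \<longleftrightarrow> (\<forall>F\<in>facets. normal F \<bullet> y < offset F)"
proof
  assume "\<forall>F\<in>facets. normal F \<bullet> y < offset F"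
  then have "y \<in> (\<Inter>F\<in>facets. {x. normal F \<bullet> x < offset F})" by blast
  moreover have "open (\<Inter>F\<in>facets. {x. normal F \<bullet> x < offset F})"
    using finite_facets by (intro open_INT) (auto simp: open_halfspace_lt)
  moreover have "(\<Inter>F\<in>facets. {x. normal F \<bullet> x < offset F}) \<subseteq> P"
    by (subst P_eq_halfspaces) (auto simp: less_imp_le)
  ultimately show "y \<in> interior P" by (meson interiorI)
qed (use normal_less_interior in blast)

text \<open>Identifies the tight inequalities at a relative interior point of \<open>G\<close> with
  the facets above \<open>G\<close>, because a face that meets the relative interior of a subset
  contains that subset.\<close>

lemma facet_iff_rel_interior:
  assumes "G face_of P" "x \<in> rel_interior G" "F \<in> facets"
  shows "normal F \<bullet> x = offset F \<longleftrightarrow> G \<subseteq> F"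
proof
  have GP: "G \<subseteq> P" using assms(1) by (rule face_of_imp_subset)
  have xG: "x \<in> G" using assms(2) rel_interior_subset by blast
  assume "normal F \<bullet> x = offset F"
  then have "x \<in> F" using in_facet_iff[OF assms(3)] xG GP by blast
  then show "G \<subseteq> F"
    using subset_of_face_of[OF facets_face_of[OF assms(3)] GP] assms(2) by blast
next
  assume "G \<subseteq> F"
  then have "x \<in> F" using assms(2) rel_interior_subset by blast
  then show "normal F \<bullet> x = offset F" by (rule facet_on[OF assms(3)])
qed

lemma face_eq_of_subset:
  assumes "G face_of P" "H face_of P" "G \<subseteq> H" "aff_dim G = aff_dim H"
  shows "G = H"
proof (rule ccontr)
  assume "G \<noteq> H"
  have "G face_of H" using assms face_of_subset face_of_imp_subset by blast
  then have "aff_dim G < aff_dim H"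
    using face_of_aff_dim_lt[OF face_of_imp_convex[OF assms(2)]] \<open>G \<noteq> H\<close> by blast
  then show False using assms(4) by simp
qed

lemma affine_hull_facet:
  assumes "F \<in> facets"
  shows "affine hull F = {x. normal F \<bullet> x = offset F}"
proof (rule affine_dim_equal)
  show "affine hull F \<subseteq> {x. normal F \<bullet> x = offset F}"
    using facet_on[OF assms] by (intro hull_minimal) (auto simp: affine_hyperplane)
  show "affine hull F \<noteq> {}" using assms by (auto simp: facets_def facet_of_def)
  show "aff_dim (affine hull F) = aff_dim {x. normal F \<bullet> x = offset F}"
    using facets_aff_dim[OF assms] normal_nonzero[OF assms] by (simp add: aff_dim_hyperplane)
qed (auto simp: affine_hyperplane)

text \<open>If \<open>F1\<close>, \<open>F2\<close>, \<open>F3\<close> contain the ridge \<open>R\<close>, then a point of \<open>F3\<close> has nonnegative coordinates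
  relative to \<open>R\<close> and interior points of \<open>F1\<close> and \<open>F2\<close>; the normal of \<open>F3\<close> forces them to vanish.\<close>

lemma ridge_not_in_three_facets:
  assumes R: "R face_of P" "aff_dim R = int DIM('a) - 2" "R \<noteq> {}"
    and F1: "F1 \<in> facets" "R \<subseteq> F1" and F2: "F2 \<in> facets" "R \<subseteq> F2" and F3: "F3 \<in> facets" "R \<subseteq> F3"
    and ne: "F1 \<noteq> F2" "F1 \<noteq> F3" "F2 \<noteq> F3"
  shows False
proof -
  obtain p where p: "p \<in> R" using R by blast
  have nsub: "\<not> F \<subseteq> G" if "F \<in> facets" "G \<in> facets" "F \<noteq> G" for F G
    using face_eq_of_subset[OF facets_face_of facets_face_of] facets_aff_dim that by metis
  have sub: "F \<subseteq> P" if "F \<in> facets" for F using facets_face_of[OF that] by (rule face_of_imp_subset)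
  have ex: "\<exists>y. y \<in> rel_interior F" if "F \<in> facets" for F
  proof -
    have "F \<noteq> {}" using that by (auto simp: facets_def facet_of_def)
    then show ?thesis
      using rel_interior_eq_empty[OF face_of_imp_convex[OF facets_face_of[OF that]]] by blast
  qed
  obtain y1 where y1: "y1 \<in> rel_interior F1" using ex[OF F1(1)] by blast
  obtain y2 where y2: "y2 \<in> rel_interior F2" using ex[OF F2(1)] by blast
  have y1F: "y1 \<in> F1" "y1 \<in> P" and y2F: "y2 \<in> F2" "y2 \<in> P"
    using y1 y2 rel_interior_subset sub F1 F2 by blast+
  have off: "normal G \<bullet> y < offset G"
    if "F \<in> facets" "G \<in> facets" "F \<noteq> G" "y \<in> rel_interior F" for F G y
  proof -
    have "y \<in> P" using that(4) rel_interior_subset sub[OF that(1)] by blast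
    then have "normal G \<bullet> y \<le> offset G" by (rule normal_le[OF that(2)])
    moreover have "normal G \<bullet> y \<noteq> offset G"
      using facet_iff_rel_interior[OF facets_face_of[OF that(1)] that(4,2)] nsub[OF that(1-3)] by blast
    ultimately show ?thesis by simp
  qed
  have onp: "normal F1 \<bullet> p = offset F1" "normal F2 \<bullet> p = offset F2" "normal F3 \<bullet> p = offset F3"
    using p F1 F2 F3 facet_on by blast+
  have hull: "affine hull R \<subseteq> {x. normal F \<bullet> x = offset F}" if "F \<in> facets" "R \<subseteq> F" for F
    using facet_on[OF that(1)] that(2) by (intro hull_minimal) (auto simp: affine_hyperplane)
  have "y1 \<notin> affine hull R"
    using hull[OF F2] off[OF F1(1) F2(1) ne(1) y1] by auto
  then have d1: "aff_dim (insert y1 R) = int DIM('a) - 1"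
    using R(2) by (simp add: aff_dim_insert)
  have "affine hull (insert y1 R) \<subseteq> {x. normal F1 \<bullet> x = offset F1}"
    using facet_on[OF F1(1)] F1(2) y1F by (intro hull_minimal) (auto simp: affine_hyperplane)
  then have "y2 \<notin> affine hull (insert y1 R)"
    using off[OF F2(1) F1(1) ne(1)[symmetric] y2] by auto
  then have d2: "aff_dim (insert y2 (insert y1 R)) = int DIM('a)"
    using d1 by (simp add: aff_dim_insert)
  then have full: "affine hull (insert y2 (insert y1 R)) = UNIV"
    by (simp add: aff_dim_eq_full)
  obtain y3 where y3: "y3 \<in> F3" "y3 \<notin> F1" using nsub[OF F3(1) F1(1) ne(2)[symmetric]] by blast
  have y3P: "y3 \<in> P" using y3 sub[OF F3(1)] by blast
  define D where "D = (\<lambda>x. x - p) ` R"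
  have "insert y2 (insert y1 R) = insert p (insert y2 (insert y1 R))" using p by blast
  moreover have "y3 \<in> affine hull (insert y2 (insert y1 R))" using full by simp
  ultimately have "y3 \<in> affine hull (insert p (insert y2 (insert y1 R)))" by metis
  then have "y3 - p \<in> span ((\<lambda>x. x - p) ` insert y2 (insert y1 R))"
    unfolding affine_hull_insert_span_gen by (auto simp: image_def algebra_simps)
  then have "y3 - p \<in> span (insert (y2 - p) (insert (y1 - p) D))" by (simp add: D_def)
  then obtain t where "y3 - p - t *\<^sub>R (y2 - p) \<in> span (insert (y1 - p) D)"
    using span_breakdown_eq by blast
  then obtain s where s: "y3 - p - t *\<^sub>R (y2 - p) - s *\<^sub>R (y1 - p) \<in> span D"
    using span_breakdown_eq by blast
  \<comment> \<open>\<open>w\<close> is the part along \<open>R\<close>, orthogonal to the normals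
    of all facets above \<open>R\<close>. The normal of \<open>F1\<close> then isolates the
    coordinate \<open>t\<close> along \<open>y2\<close>, and that of \<open>F2\<close> the
    coordinate \<open>s\<close> along \<open>y1\<close>.\<close>
  define w where "w = y3 - p - t *\<^sub>R (y2 - p) - s *\<^sub>R (y1 - p)"
  have y3eq: "y3 = p + w + t *\<^sub>R (y2 - p) + s *\<^sub>R (y1 - p)" by (simp add: w_def)
  have perp: "normal F \<bullet> w = 0" if "F \<in> facets" "R \<subseteq> F" for F
  proof -
    have "normal F \<bullet> x = 0" if "x \<in> D" for x
      using that facet_on[OF \<open>F \<in> facets\<close>] \<open>R \<subseteq> F\<close> p by (auto simp: D_def inner_diff_right subset_iff)
    moreover have "w \<in> span D" using s by (simp add: w_def)
    ultimately show ?thesis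
      using orthogonal_to_span[of w D "normal F"] by (auto simp: orthogonal_def)
  qed
  have val: "normal F \<bullet> y3 = offset F + t * (normal F \<bullet> y2 - offset F) + s * (normal F \<bullet> y1 - offset F)"
    if "F \<in> facets" "R \<subseteq> F" for F
  proof -
    have "normal F \<bullet> p = offset F" using that p facet_on by blast
    then show ?thesis using perp[OF that]
      by (simp add: y3eq inner_add_right inner_diff_right)
  qed
  have t: "t \<ge> 0"
    using val[OF F1] facet_on[OF F1(1) y1F(1)] normal_le[OF F1(1) y3P] off[OF F2(1) F1(1) ne(1)[symmetric] y2]
    by (simp add: mult_le_0_iff)
  have s0: "s \<ge> 0"
    using val[OF F2] facet_on[OF F2(1) y2F(1)] normal_le[OF F2(1) y3P] off[OF F1(1) F2(1) ne(1) y1]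
    by (simp add: mult_le_0_iff)
  have "t * (normal F3 \<bullet> y2 - offset F3) + s * (normal F3 \<bullet> y1 - offset F3) = 0"
    using val[OF F3] facet_on[OF F3(1) y3(1)] by simp
  moreover have "t * (normal F3 \<bullet> y2 - offset F3) \<le> 0" "s * (normal F3 \<bullet> y1 - offset F3) \<le> 0"
    using t s0 off[OF F2(1) F3(1) ne(3) y2] off[OF F1(1) F3(1) ne(2) y1]
    by (auto intro!: mult_nonneg_nonpos)
  ultimately have "t * (normal F3 \<bullet> y2 - offset F3) = 0" by linarith
  then have "t = 0" using off[OF F2(1) F3(1) ne(3) y2] by simp
  then have "normal F1 \<bullet> y3 = offset F1"
    using val[OF F1] facet_on[OF F1(1) y1F(1)] by simp
  then have "y3 \<in> F1" using in_facet_iff[OF F1(1) y3P] by blast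
  then show False using y3 by blast
qed

text \<open>A proper face is the intersection of the facets above it; a single one would have too
  large a dimension, and three are impossible.\<close>

lemma ridge_two_facets:
  assumes R: "R face_of P" "aff_dim R = int DIM('a) - 2" "R \<noteq> {}"
  obtains F G where "F \<noteq> G" "{H \<in> facets. R \<subseteq> H} = {F, G}"
proof -
  define T where "T = {H \<in> facets. R \<subseteq> H}"
  have "R \<noteq> P" using R(2) aff_dim_P by auto
  then have RT: "R = \<Inter>T"
    using face_of_polyhedron[OF polyhedron R(1) R(3)] by (simp add: T_def facets_def)
  have "T \<noteq> {}"
    using face_of_polyhedron_subset_facet[OF polyhedron R(1) R(3) \<open>R \<noteq> P\<close>] by (auto simp: T_def facets_def)
  then obtain F where F: "F \<in> T" by blast
  have "T \<noteq> {F}"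
  proof
    assume "T = {F}"
    then have "R = F" using RT by simp
    then show False using F facets_aff_dim[of F] R(2) by (auto simp: T_def)
  qed
  then obtain G where G: "G \<in> T" "F \<noteq> G" using F by blast
  have "T \<subseteq> {F, G}"
  proof
    fix H assume H: "H \<in> T"
    show "H \<in> {F, G}"
    proof (rule ccontr)
      assume "H \<notin> {F, G}"
      then show False
        using ridge_not_in_three_facets[OF R, of F G H] F G H by (auto simp: T_def)
    qed
  qed
  then have "T = {F, G}" using F G by blast
  then show ?thesis using that G(2) by (simp add: T_def)
qed

lemma finite_faces_dim: "finite (faces_dim i P)"
  using finite_polytope_faces[OF polytope] unfolding faces_dim_def by (rule rev_finite_subset) auto

subsection \<open>Silhouette edges at a vertex\<close>

definition vertices :: "'a set" where "vertices = {u. u extreme_point_of P}"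

lemma finite_vertices: "finite vertices"
  unfolding vertices_def by (rule finite_polyhedron_extreme_points[OF polyhedron])

lemma P_eq_hull: "P = convex hull vertices"
  unfolding vertices_def
  by (rule Krein_Milman_Minkowski[OF polytope_imp_compact[OF polytope] convexP])

lemma vertices_subset: "vertices \<subseteq> P"
  by (auto simp: vertices_def extreme_point_of_def)

lemma halfspace_of_vertices:
  assumes "\<And>u. u \<in> vertices \<Longrightarrow> g \<bullet> u \<le> b" "y \<in> P"
  shows "g \<bullet> y \<le> b"
proof -
  have "P \<subseteq> {y. g \<bullet> y \<le> b}"
    using assms(1) by (subst P_eq_hull, intro hull_minimal) (auto simp: convex_halfspace_le)
  then show ?thesis using assms(2) by blast
qed

lemma interior_strict:
  assumes "g \<noteq> 0" "\<And>y. y \<in> P \<Longrightarrow> g \<bullet> y \<le> b" "p \<in> interior P"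
  shows "g \<bullet> p < b"
proof -
  have "interior P \<subseteq> interior {x. g \<bullet> x \<le> b}" using assms(2) by (intro interior_mono) blast
  then show ?thesis using assms(3) interior_halfspace_le[OF assms(1)] by blast
qed

text \<open>\<open>x\<close> is a viewing direction at the vertex \<open>v\<close>; a facet at \<open>v\<close> is seen or not according to the
  sign of \<open>normal F \<bullet> x\<close>.\<close>

definition silhouette :: "'a \<Rightarrow> 'a set \<Rightarrow> bool" where
  "silhouette x e \<longleftrightarrow> (\<exists>F\<in>facets. \<exists>G\<in>facets. e \<subseteq> F \<and> e \<subseteq> G \<and> normal F \<bullet> x < 0 \<and> normal G \<bullet> x > 0)"

lemma edge_other_vertex:
  assumes e: "e face_of P" "aff_dim e = 1"
  obtains u where "u \<in> vertices" "u \<in> e" "u \<noteq> v"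
proof -
  have "compact e" using face_of_imp_compact[OF convexP _ e(1)] polytope_imp_compact[OF polytope] by blast
  then have "e = convex hull {u. u extreme_point_of e}"
    by (rule Krein_Milman_Minkowski[OF _ face_of_imp_convex[OF e(1)]])
  moreover have "aff_dim (convex hull {u. u extreme_point_of e}) \<le> 0" if "{u. u extreme_point_of e} \<subseteq> {v}"
    using aff_dim_subset[OF that] by (simp add: aff_dim_convex_hull)
  ultimately have "\<not> {u. u extreme_point_of e} \<subseteq> {v}" using e(2) by force
  then obtain u where u: "u extreme_point_of e" "u \<noteq> v" by blast
  then have "u \<in> e" "u \<in> vertices"
    using extreme_point_of_face[OF e(1)] by (auto simp: vertices_def)
  then show ?thesis using that u(2) by blast
qed

text \<open>From a relative interior point of \<open>e\<close>, a short move along \<open>x\<close>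
  would satisfy all facet inequalities strictly and so enter the interior. But it stays in the
  supporting hyperplane of \<open>g\<close>, which misses the interior.\<close>

lemma supporting_face_sees_facet:
  assumes e: "e face_of P" "e \<noteq> {}" and g: "g \<noteq> 0" "\<And>y. y \<in> P \<Longrightarrow> g \<bullet> y \<le> b" "\<And>y. y \<in> e \<Longrightarrow> g \<bullet> y = b"
    and x: "g \<bullet> x = 0" "\<And>F. F \<in> facets \<Longrightarrow> e \<subseteq> F \<Longrightarrow> normal F \<bullet> x < 0"
  shows False
proof -
  obtain p where p: "p \<in> rel_interior e"
    using rel_interior_eq_empty[OF face_of_imp_convex[OF e(1)]] e(2) by blast
  have pe: "p \<in> e" "p \<in> P" using p rel_interior_subset face_of_imp_subset[OF e(1)] by blast+
  have ev: "\<forall>\<^sub>F t in at_right 0. normal F \<bullet> (p + t *\<^sub>R x) < offset F" if F: "F \<in> facets" for F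
  proof (cases "e \<subseteq> F")
    case True
    have "normal F \<bullet> p = offset F" using facet_on[OF F] True pe by blast
    then show ?thesis
      using x(2)[OF F True]
      by (intro eventually_mono[OF eventually_at_right_less]) (simp add: inner_add_right mult_pos_neg)
  next
    case False
    then have "normal F \<bullet> p \<noteq> offset F" using facet_iff_rel_interior[OF e(1) p F] by blast
    then have lt: "normal F \<bullet> p < offset F" using normal_le[OF F pe(2)] by simp
    have t: "((\<lambda>t. normal F \<bullet> (p + t *\<^sub>R x)) \<longlongrightarrow> normal F \<bullet> (p + 0 *\<^sub>R x)) (at_right 0)"
      by (intro tendsto_intros)
    show ?thesis by (rule order_tendstoD(2)[OF t]) (use lt in simp)
  qed
  have "\<forall>\<^sub>F t in at_right (0::real). \<forall>F\<in>facets. normal F \<bullet> (p + t *\<^sub>R x) < offset F"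
    using finite_facets ev by (intro eventually_ball_finite) auto
  then obtain t :: real where t: "\<forall>F\<in>facets. normal F \<bullet> (p + t *\<^sub>R x) < offset F"
    using eventually_happens[of _ "at_right (0::real)"] by auto
  then have pt: "p + t *\<^sub>R x \<in> interior P" by (simp add: interior_iff)
  have "g \<bullet> (p + t *\<^sub>R x) < b" by (rule interior_strict[OF g(1) _ pt]) (rule g(2))
  then show False using g(3)[OF pe(1)] x(1) by (simp add: inner_add_right)
qed

text \<open>The edge on which the slope of \<open>c\<close> against \<open>w\<close> attains its
  maximum \<open>M\<close>, cut out by the supporting normal \<open>c - M *\<^sub>R w\<close>. The
  last clause says that no other edge at \<open>v\<close> is supported by a combination of
  \<open>c\<close> and \<open>w\<close> with positive weight on \<open>c\<close>; it limits each
  sign of \<open>c\<close> to one silhouette edge.\<close>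

definition extremal_edge :: "'a \<Rightarrow> 'a \<Rightarrow> 'a \<Rightarrow> real \<Rightarrow> 'a set \<Rightarrow> bool" where
  "extremal_edge v c w M e \<longleftrightarrow>
     e = P \<inter> {y. (c - M *\<^sub>R w) \<bullet> (y - v) = 0} \<and>
     (\<forall>y\<in>interior P. (c - M *\<^sub>R w) \<bullet> (y - v) < 0) \<and>
     (\<forall>e' \<alpha> \<beta>. e' face_of P \<and> aff_dim e' = 1 \<and> v \<in> e' \<and> \<alpha> > 0 \<and>
        (\<forall>y\<in>P. (\<alpha> *\<^sub>R c + \<beta> *\<^sub>R w) \<bullet> (y - v) \<le> 0) \<and>
        (\<forall>y\<in>e'. (\<alpha> *\<^sub>R c + \<beta> *\<^sub>R w) \<bullet> (y - v) = 0) \<longrightarrow> e' = e)"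

text \<open>The choice of \<open>M\<close> as the maximal slope makes
  \<open>c - M *\<^sub>R w\<close> nonpositive on all \<open>u - v\<close>, with equality at a
  maximizing vertex. Hence it supports \<open>P\<close> along a face that contains \<open>v\<close>
  and another vertex, and genericity of \<open>x\<close> excludes that this face is a facet.\<close>

lemma supporting_edge:
  assumes d3: "DIM('a) = 3" and v: "v \<in> vertices"
    and generic: "\<And>F. F \<in> facets \<Longrightarrow> v \<in> F \<Longrightarrow> normal F \<bullet> x \<noteq> 0"
    and w: "w \<bullet> x = 0" "\<And>u. u \<in> vertices \<Longrightarrow> u \<noteq> v \<Longrightarrow> w \<bullet> (u - v) > 0"
    and c: "c \<noteq> 0" "c \<bullet> x = 0" "c \<bullet> w = 0"
    and ex: "vertices - {v} \<noteq> {}"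
  shows "\<exists>M e. e face_of P \<and> aff_dim e = 1 \<and> v \<in> e \<and> silhouette x e \<and> extremal_edge v c w M e"
proof -
  define s where "s u = (c \<bullet> (u - v)) / (w \<bullet> (u - v))" for u
  define M where "M = Max (s ` (vertices - {v}))"
  define g where "g = c - M *\<^sub>R w"
  define e where "e = P \<inter> {y. g \<bullet> y = g \<bullet> v}"
  have sw: "s u * (w \<bullet> (u - v)) = c \<bullet> (u - v)" if "u \<in> vertices" "u \<noteq> v" for u
    using w(2)[OF that] by (simp add: s_def)
  have finV: "finite (s ` (vertices - {v}))" "s ` (vertices - {v}) \<noteq> {}"
    using finite_vertices ex by auto
  have sM: "s u \<le> M" if "u \<in> vertices" "u \<noteq> v" for u
    unfolding M_def using that finV by (intro Max_ge) auto
  have "M \<in> s ` (vertices - {v})" unfolding M_def by (rule Max_in[OF finV])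
  then obtain u0 where u0: "u0 \<in> vertices" "u0 \<noteq> v" "s u0 = M" by blast
  have gs: "g \<bullet> (u - v) = (s u - M) * (w \<bullet> (u - v))" if "u \<in> vertices" "u \<noteq> v" for u
    by (simp add: g_def inner_diff_left left_diff_distrib sw[OF that])
  have gv: "g \<bullet> u \<le> g \<bullet> v" if u: "u \<in> vertices" for u
  proof (cases "u = v")
    case False
    have "(s u - M) * (w \<bullet> (u - v)) \<le> 0"
      using sM[OF u False] w(2)[OF u False] by (intro mult_nonpos_nonneg) auto
    then show ?thesis using gs[OF u False] by (simp add: inner_diff_right)
  qed simp
  have gP: "g \<bullet> y \<le> g \<bullet> v" if "y \<in> P" for y
    using halfspace_of_vertices[OF gv that] .
  have "g \<bullet> c = c \<bullet> c" using c(3) inner_commute[of w c] by (simp add: g_def inner_diff_left)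
  then have g0: "g \<noteq> 0" using c(1) by auto
  have gx: "g \<bullet> x = 0" using w(1) c(2) by (simp add: g_def inner_diff_left)
  have vP: "v \<in> P" using v vertices_subset by blast
  have eface: "e face_of P"
    unfolding e_def by (rule face_of_Int_supporting_hyperplane_le[OF convexP gP])
  have ve: "v \<in> e" using vP by (simp add: e_def)
  have u0e: "u0 \<in> e"
    using u0 gs[OF u0(1,2)] vertices_subset by (auto simp: e_def inner_diff_right)
  have dim1: "aff_dim e \<ge> 1"
  proof -
    have "aff_dim {u0, v} \<le> aff_dim e" using ve u0e by (intro aff_dim_subset) auto
    then show ?thesis using u0(2) by (simp add: aff_dim_2)
  qed
  have sub: "e \<subseteq> {y. g \<bullet> y = g \<bullet> v}" by (auto simp: e_def)
  have dim2: "aff_dim e \<le> 2"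
    using aff_dim_subset[OF sub] g0 d3 by (simp add: aff_dim_hyperplane)
  \<comment> \<open>The contact plane is parallel to \<open>x\<close>, so a facet in it would have a
    normal orthogonal to \<open>x\<close>.\<close>
  have "aff_dim e \<noteq> 2"
  proof
    assume e2: "aff_dim e = 2"
    then have ef: "e \<in> facets" using eface d3 by (simp add: facets_eq)
    have "affine hull e = {y. g \<bullet> y = g \<bullet> v}"
    proof (rule affine_dim_equal)
      show "affine hull e \<subseteq> {y. g \<bullet> y = g \<bullet> v}"
        using sub by (intro hull_minimal) (auto simp: affine_hyperplane)
      show "affine hull e \<noteq> {}" using ve by auto
      show "aff_dim (affine hull e) = aff_dim {y. g \<bullet> y = g \<bullet> v}"
        using e2 g0 d3 by (simp add: aff_dim_hyperplane)
    qed (auto simp: affine_hyperplane)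
    then have "v + x \<in> affine hull e" using gx by (simp add: inner_add_right)
    then have "normal e \<bullet> (v + x) = offset e" using affine_hull_facet[OF ef] by simp
    then have "normal e \<bullet> x = 0" using facet_on[OF ef ve] by (simp add: inner_add_right)
    then show False using generic[OF ef ve] by simp
  qed
  then have edim: "aff_dim e = 1" using dim1 dim2 by simp
  have "e \<noteq> {}" using ve by blast
  have "aff_dim e = int DIM('a) - 2" using edim d3 by simp
  then obtain F G where FG: "F \<noteq> G" "{H \<in> facets. e \<subseteq> H} = {F, G}"
    using ridge_two_facets[OF eface _ \<open>e \<noteq> {}\<close>] by blast
  have "F \<in> {H \<in> facets. e \<subseteq> H}" "G \<in> {H \<in> facets. e \<subseteq> H}" unfolding FG(2) by simp_all
  then have F: "F \<in> facets" "e \<subseteq> F" and G: "G \<in> facets" "e \<subseteq> G" by simp_all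
  have only: "H = F \<or> H = G" if "H \<in> facets" "e \<subseteq> H" for H
  proof -
    have "H \<in> {H \<in> facets. e \<subseteq> H}" using that by simp
    then show ?thesis unfolding FG(2) by simp
  qed
  have nz: "normal F \<bullet> x \<noteq> 0" "normal G \<bullet> x \<noteq> 0" using generic F G ve by blast+
  have ge: "g \<bullet> y = g \<bullet> v" if "y \<in> e" for y using that by (simp add: e_def)
  have no: False if "g \<bullet> x' = 0" "normal F \<bullet> x' < 0" "normal G \<bullet> x' < 0" for x'
  proof (rule supporting_face_sees_facet[OF eface \<open>e \<noteq> {}\<close> g0 _ _ that(1)])
    show "g \<bullet> y \<le> g \<bullet> v" if "y \<in> P" for y by (rule gP[OF that])
    show "g \<bullet> y = g \<bullet> v" if "y \<in> e" for y by (rule ge[OF that])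
    show "normal H \<bullet> x' < 0" if "H \<in> facets" "e \<subseteq> H" for H
      using only[OF that] \<open>normal F \<bullet> x' < 0\<close> \<open>normal G \<bullet> x' < 0\<close> by (elim disjE) simp_all
  qed
  \<comment> \<open>Neither \<open>x\<close> nor \<open>-x\<close> can point strictly inward at both
    facets of \<open>e\<close>, so the two signs differ.\<close>
  have n1: "\<not> (normal F \<bullet> x < 0 \<and> normal G \<bullet> x < 0)" using no[OF gx] by blast
  have n2: "\<not> (normal F \<bullet> x > 0 \<and> normal G \<bullet> x > 0)" using no[of "- x"] gx by auto
  have sil: "silhouette x e"
  proof (cases "normal F \<bullet> x < 0")
    case True
    then have "normal G \<bullet> x > 0" using n1 nz by linarith
    with True show ?thesis using F G unfolding silhouette_def by blast
  next
    case False
    then have "normal F \<bullet> x > 0" using nz by linarith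
    moreover from this have "normal G \<bullet> x < 0" using n2 nz by linarith
    ultimately show ?thesis using F G unfolding silhouette_def by blast
  qed
  have "extremal_edge v c w M e"
    unfolding extremal_edge_def
  proof (intro conjI ballI allI impI)
    show "e = P \<inter> {y. (c - M *\<^sub>R w) \<bullet> (y - v) = 0}"
      unfolding e_def g_def by (simp add: inner_diff_right)
    show "(c - M *\<^sub>R w) \<bullet> (y - v) < 0" if "y \<in> interior P" for y
      using interior_strict[OF g0 gP that] by (simp add: g_def[symmetric] inner_diff_right)
  next
    fix e' \<alpha> \<beta>
    assume A: "e' face_of P \<and> aff_dim e' = 1 \<and> v \<in> e' \<and> \<alpha> > 0 \<and>
        (\<forall>y\<in>P. (\<alpha> *\<^sub>R c + \<beta> *\<^sub>R w) \<bullet> (y - v) \<le> 0) \<and>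
        (\<forall>y\<in>e'. (\<alpha> *\<^sub>R c + \<beta> *\<^sub>R w) \<bullet> (y - v) = 0)"
    then have e': "e' face_of P" "aff_dim e' = 1" "v \<in> e'" and \<alpha>: "\<alpha> > 0" by blast+
    have le: "(\<alpha> *\<^sub>R c + \<beta> *\<^sub>R w) \<bullet> (y - v) \<le> 0" if "y \<in> P" for y
      using A that by blast
    have eq: "(\<alpha> *\<^sub>R c + \<beta> *\<^sub>R w) \<bullet> (y - v) = 0" if "y \<in> e'" for y
      using A that by blast
    \<comment> \<open>Tightness at \<open>u\<close> forces its slope to be -\<beta>/\<alpha>, and
      the inequality at \<open>u0\<close> then makes that slope at least \<open>M\<close>. So the
      competing normal is a multiple of \<open>g\<close>.\<close>
    obtain u where u: "u \<in> vertices" "u \<in> e'" "u \<noteq> v" using edge_other_vertex[OF e'(1,2)] by blast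
    have lin: "(\<alpha> *\<^sub>R c + \<beta> *\<^sub>R w) \<bullet> (y - v) = (\<alpha> * s y + \<beta>) * (w \<bullet> (y - v))"
      if "y \<in> vertices" "y \<noteq> v" for y
      by (simp add: inner_add_left distrib_right mult.assoc sw[OF that])
    have su: "\<alpha> * s u + \<beta> = 0" using eq[OF u(2)] lin[OF u(1,3)] w(2)[OF u(1,3)] by simp
    have "\<alpha> * s u0 + \<beta> \<le> 0"
    proof -
      have "(\<alpha> * s u0 + \<beta>) * (w \<bullet> (u0 - v)) \<le> 0"
        using le[of u0] lin[OF u0(1,2)] u0(1) vertices_subset by auto
      then show ?thesis using w(2)[OF u0(1,2)] by (simp add: mult_le_0_iff)
    qed
    then have "\<alpha> * s u0 \<le> \<alpha> * s u" using su by simp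
    then have "M \<le> s u" using \<alpha> u0(3) by simp
    then have sM': "s u = M" using sM[OF u(1,3)] by simp
    have \<beta>: "\<beta> = - \<alpha> * M" using su sM' by simp
    have g\<alpha>: "\<alpha> *\<^sub>R c + \<beta> *\<^sub>R w = \<alpha> *\<^sub>R g" by (simp add: g_def \<beta> algebra_simps)
    have "e' \<subseteq> e"
    proof
      fix y assume y: "y \<in> e'"
      have "\<alpha> * (g \<bullet> (y - v)) = 0" using eq[OF y] unfolding g\<alpha> by simp
      then have "g \<bullet> (y - v) = 0" using \<alpha> by simp
      then show "y \<in> e" using y face_of_imp_subset[OF e'(1)] by (auto simp: e_def inner_diff_right)
    qed
    then show "e' = e" using face_eq_of_subset[OF e'(1) eface] e'(2) edim by simp
  qed
  then show ?thesis using eface edim ve sil by blast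
qed

text \<open>\<open>x\<close>, \<open>w\<close>, \<open>c\<close> form an orthogonal basis; a nonzero
  remainder would be a fourth orthogonal vector.\<close>

lemma orthogonal_decomposition_3:
  fixes x w c g :: 'a
  assumes d3: "DIM('a) = 3" and nz: "x \<noteq> 0" "w \<noteq> 0" "c \<noteq> 0"
    and orth: "w \<bullet> x = 0" "c \<bullet> x = 0" "c \<bullet> w = 0" and g: "g \<bullet> x = 0"
  obtains \<alpha> \<beta> where "g = \<alpha> *\<^sub>R c + \<beta> *\<^sub>R w"
proof -
  define \<alpha> where "\<alpha> = (g \<bullet> c) / (c \<bullet> c)"
  define \<beta> where "\<beta> = (g \<bullet> w) / (w \<bullet> w)"
  define u where "u = g - (\<alpha> *\<^sub>R c + \<beta> *\<^sub>R w)"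
  have ux: "u \<bullet> x = 0" using orth g by (simp add: u_def inner_diff_left inner_add_left)
  have uc: "u \<bullet> c = 0" using orth nz by (simp add: u_def inner_diff_left inner_add_left \<alpha>_def inner_commute[of w c])
  have uw: "u \<bullet> w = 0" using orth nz by (simp add: u_def inner_diff_left inner_add_left \<beta>_def)
  have "u = 0"
  proof (rule ccontr)
    assume u0: "u \<noteq> 0"
    have ne: "x \<noteq> w" "x \<noteq> c" "w \<noteq> c" "u \<noteq> x" "u \<noteq> c" "u \<noteq> w"
      using nz orth u0 ux uc uw by auto
    have "pairwise orthogonal {x, w, c, u}"
    proof -
      have "x \<bullet> w = 0" "x \<bullet> c = 0" "w \<bullet> c = 0" "x \<bullet> u = 0" "c \<bullet> u = 0" "w \<bullet> u = 0"
        using orth ux uc uw by (simp_all only: inner_commute)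
      then show ?thesis using orth ux uc uw by (auto simp: pairwise_insert orthogonal_def)
    qed
    then have "independent {x, w, c, u}"
      using nz u0 by (intro pairwise_orthogonal_independent) auto
    then have "card {x, w, c, u} \<le> DIM('a)" using independent_bound by blast
    then show False using ne d3 by (simp add: card_insert_if eq_commute)
  qed
  then show ?thesis using that by (simp add: u_def)
qed

text \<open>Projecting along \<open>x\<close> turns the cone at \<open>v\<close> into a planar cone; its two boundary rays are the
  images of the silhouette edges, on which the slope \<open>c \<bullet> (u - v) / (w \<bullet> (u - v))\<close> is extremal.\<close>

lemma card_silhouette:
  assumes d3: "DIM('a) = 3" and v: "v \<in> vertices"
    and generic: "\<And>F. F \<in> facets \<Longrightarrow> v \<in> F \<Longrightarrow> normal F \<bullet> x \<noteq> 0"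
    and Fn: "Fn \<in> facets" "v \<in> Fn" "normal Fn \<bullet> x < 0" and Fp: "Fp \<in> facets" "v \<in> Fp" "normal Fp \<bullet> x > 0"
  shows "card {e. e face_of P \<and> aff_dim e = 1 \<and> v \<in> e \<and> silhouette x e} = 2"
proof -
  have vP: "v \<in> P" using v vertices_subset by blast
  have x0: "x \<noteq> 0" using Fn by auto
  have ex: "vertices - {v} \<noteq> {}"
  proof
    assume "vertices - {v} = {}"
    then have "vertices \<subseteq> {v}" by blast
    then have "aff_dim P \<le> 0"
      using aff_dim_subset[of vertices "{v}"] by (subst P_eq_hull) (simp add: aff_dim_convex_hull)
    then show False using aff_dim_P d3 by simp
  qed
  define Q where "Q = convex hull ((\<lambda>u. u - v) ` (vertices - {v}))"
  have Qv: "v + q \<in> convex hull (vertices - {v})" if q: "q \<in> Q" for q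
  proof -
    have "Q = (\<lambda>u. u - v) ` (convex hull (vertices - {v}))"
      unfolding Q_def using convex_hull_translation[of "-v" "vertices - {v}"] by simp
    then obtain u where "u \<in> convex hull (vertices - {v})" "q = u - v" using q by blast
    then show ?thesis by simp
  qed
  have hullP: "convex hull (vertices - {v}) \<subseteq> P" by (subst P_eq_hull) (intro hull_mono, blast)
  \<comment> \<open>Positive \<open>t\<close> violates \<open>Fp\<close> and negative
    \<open>t\<close> violates \<open>Fn\<close>; \<open>t = 0\<close> would make the extreme point
    \<open>v\<close> a convex combination of the other vertices.\<close>
  have notQ: "t *\<^sub>R x \<notin> Q" for t
  proof
    assume "t *\<^sub>R x \<in> Q"
    then have tH: "v + t *\<^sub>R x \<in> convex hull (vertices - {v})" by (rule Qv)
    then have tP: "v + t *\<^sub>R x \<in> P" using hullP by blast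
    have "t = 0"
    proof (rule ccontr)
      assume "t \<noteq> 0"
      then consider "t > 0" | "t < 0" by linarith
      then show False
      proof cases
        case 1
        then have "t * (normal Fp \<bullet> x) > 0" using Fp by simp
        then show False using normal_le[OF Fp(1) tP] facet_on[OF Fp(1,2)] by (simp add: inner_add_right)
      next
        case 2
        then have "t * (normal Fn \<bullet> x) > 0" using Fn by (simp add: mult_neg_neg)
        then show False using normal_le[OF Fn(1) tP] facet_on[OF Fn(1,2)] by (simp add: inner_add_right)
      qed
    qed
    then have "v \<in> convex hull (vertices - {v})" using tH by simp
    then have "v extreme_point_of (convex hull (vertices - {v}))"
      using v hullP unfolding vertices_def extreme_point_of_def by blast
    then have "v \<in> vertices - {v}" by (rule extreme_point_of_convex_hull)
    then show False by blast
  qed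
  \<comment> \<open>A functional bounded above on the line through \<open>x\<close> vanishes there,
    so separation yields \<open>w\<close> orthogonal to \<open>x\<close> and positive on all
    \<open>u - v\<close>. It is the denominator of the slope.\<close>
  have "\<exists>w b. (\<forall>y\<in>span {x}. w \<bullet> y < b) \<and> (\<forall>y\<in>Q. w \<bullet> y > b)"
  proof (rule separating_hyperplane_closed_compact)
    show "convex (span {x})" by (simp add: subspace_imp_convex)
    show "compact Q" unfolding Q_def using finite_vertices by (intro finite_imp_compact_convex_hull) simp
    show "span {x} \<inter> Q = {}" using notQ by (auto simp: span_singleton)
    show "Q \<noteq> {}" using ex by (simp add: Q_def)
  qed (auto simp: Q_def closed_subspace)
  then obtain w b where wb: "\<And>y. y \<in> span {x} \<Longrightarrow> w \<bullet> y < b" "\<And>y. y \<in> Q \<Longrightarrow> w \<bullet> y > b" by blast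
  have b0: "b > 0" using wb(1)[of 0] by (simp add: span_zero)
  have wx: "w \<bullet> x = 0"
  proof (rule ccontr)
    assume n: "w \<bullet> x \<noteq> 0"
    have "(b / (w \<bullet> x)) *\<^sub>R x \<in> span {x}" by (intro span_scale span_base) simp
    then have "w \<bullet> ((b / (w \<bullet> x)) *\<^sub>R x) < b" by (rule wb(1))
    then show False using n by simp
  qed
  have wpos: "w \<bullet> (u - v) > 0" if "u \<in> vertices" "u \<noteq> v" for u
  proof -
    have "u - v \<in> Q" unfolding Q_def using that by (intro hull_inc) auto
    then show ?thesis using wb(2) b0 by force
  qed
  have w0: "w \<noteq> 0" using ex wpos by force
  have "dim {x, w} < DIM('a)"
    using dim_le_card[of "{x, w}" "{x, w}"] card_length[of "[x, w]"] d3
    by (simp add: span_superset card_insert_if split: if_splits)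
  then obtain c where c: "c \<noteq> 0" "\<And>y. y \<in> span {x, w} \<Longrightarrow> orthogonal c y"
    using orthogonal_to_subspace_exists by blast
  have cx: "c \<bullet> x = 0" "c \<bullet> w = 0"
    using c(2)[of x] c(2)[of w] by (simp_all add: span_base orthogonal_def)
  have mc: "- c \<noteq> 0" "(- c) \<bullet> x = 0" "(- c) \<bullet> w = 0" using c(1) cx by simp_all
  obtain M1 e1 where e1: "e1 face_of P" "aff_dim e1 = 1" "v \<in> e1" "silhouette x e1"
    and x1: "extremal_edge v c w M1 e1"
    using supporting_edge[OF d3 v generic wx wpos c(1) cx ex] by blast
  obtain M2 e2 where e2: "e2 face_of P" "aff_dim e2 = 1" "v \<in> e2" "silhouette x e2"
    and x2: "extremal_edge v (- c) w M2 e2"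
    using supporting_edge[OF d3 v generic wx wpos mc ex] by blast
  obtain z where z: "z \<in> interior P" using int_ne by blast
  \<comment> \<open>A common edge would force \<open>M2 = - M1\<close>, making the two supporting
    normals opposite, yet both are negative at interior points.\<close>
  have "e1 \<noteq> e2"
  proof
    assume eq: "e1 = e2"
    obtain u where u: "u \<in> vertices" "u \<in> e1" "u \<noteq> v" using edge_other_vertex[OF e1(1,2)] by blast
    have "(c - M1 *\<^sub>R w) \<bullet> (u - v) = 0" using u(2) x1 unfolding extremal_edge_def by blast
    moreover have "(- c - M2 *\<^sub>R w) \<bullet> (u - v) = 0" using u(2) x2 eq unfolding extremal_edge_def by blast
    ultimately have "(M1 + M2) * (w \<bullet> (u - v)) = 0" by (simp add: inner_diff_left algebra_simps)
    then have "M2 = - M1" using wpos[OF u(1,3)] by simp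
    moreover have "(c - M1 *\<^sub>R w) \<bullet> (z - v) < 0" using z x1 unfolding extremal_edge_def by blast
    moreover have "(- c - M2 *\<^sub>R w) \<bullet> (z - v) < 0" using z x2 unfolding extremal_edge_def by blast
    ultimately show False by (simp add: inner_diff_left)
  qed
  have "e = e1 \<or> e = e2" if e: "e face_of P" "aff_dim e = 1" "v \<in> e" "silhouette x e" for e
  proof -
    obtain F G where F: "F \<in> facets" "e \<subseteq> F" "normal F \<bullet> x < 0" and G: "G \<in> facets" "e \<subseteq> G" "normal G \<bullet> x > 0"
      using e(4) unfolding silhouette_def by blast
    \<comment> \<open>The combination of the two facet normals that kills \<open>x\<close>. Its
      coefficients are positive, so it supports \<open>P\<close> along \<open>e\<close> and can be
      compared with the extremal normals in the plane of \<open>c\<close> and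
      \<open>w\<close>.\<close>
    define g where "g = (normal G \<bullet> x) *\<^sub>R normal F + (- (normal F \<bullet> x)) *\<^sub>R normal G"
    have gx: "g \<bullet> x = 0" by (simp add: g_def inner_add_left inner_diff_left mult.commute)
    have vF: "normal F \<bullet> v = offset F" "normal G \<bullet> v = offset G"
      using e(3) F G facet_on by blast+
    have gy: "g \<bullet> (y - v) = (normal G \<bullet> x) * (normal F \<bullet> y - offset F) + (- (normal F \<bullet> x)) * (normal G \<bullet> y - offset G)" for y
      by (simp add: g_def inner_add_left inner_diff_left inner_diff_right vF algebra_simps)
    have gP: "g \<bullet> (y - v) \<le> 0" if "y \<in> P" for y
      unfolding gy using F(3) G(3) normal_le[OF F(1) that] normal_le[OF G(1) that]
      by (intro add_nonpos_nonpos mult_nonneg_nonpos) auto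
    have ge: "g \<bullet> (y - v) = 0" if "y \<in> e" for y
    proof -
      have "normal F \<bullet> y = offset F" "normal G \<bullet> y = offset G" using that F G facet_on by blast+
      then show ?thesis unfolding gy by simp
    qed
    have gz: "g \<bullet> (z - v) < 0"
      unfolding gy using F(3) G(3) normal_less_interior[OF F(1) z] normal_less_interior[OF G(1) z]
      by (intro add_neg_neg mult_pos_neg) auto
    obtain \<alpha> \<beta> where ab: "g = \<alpha> *\<^sub>R c + \<beta> *\<^sub>R w"
      using orthogonal_decomposition_3[OF d3 x0 w0 c(1) wx cx gx] by blast
    have ab': "g = (- \<alpha>) *\<^sub>R - c + \<beta> *\<^sub>R w" using ab by simp
    \<comment> \<open>Otherwise \<open>g\<close> is a multiple of \<open>w\<close>; it vanishes on
      \<open>e\<close> while \<open>w\<close> is positive at the other vertex of \<open>e\<close>,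
      so \<open>g\<close> would be 0.\<close>
    have "\<alpha> \<noteq> 0"
    proof
      assume "\<alpha> = 0"
      obtain u where u: "u \<in> vertices" "u \<in> e" "u \<noteq> v" using edge_other_vertex[OF e(1,2)] by blast
      have "\<beta> * (w \<bullet> (u - v)) = 0" using ge[OF u(2)] ab \<open>\<alpha> = 0\<close> by simp
      then have "\<beta> = 0" using wpos[OF u(1,3)] by simp
      then show False using gz ab \<open>\<alpha> = 0\<close> by simp
    qed
    then consider "\<alpha> > 0" | "- \<alpha> > 0" by linarith
    then show ?thesis
    proof cases
      case 1
      have "\<forall>y\<in>P. (\<alpha> *\<^sub>R c + \<beta> *\<^sub>R w) \<bullet> (y - v) \<le> 0" "\<forall>y\<in>e. (\<alpha> *\<^sub>R c + \<beta> *\<^sub>R w) \<bullet> (y - v) = 0"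
        using gP ge unfolding ab by blast+
      then have "e = e1" using x1 e(1-3) 1 unfolding extremal_edge_def by blast
      then show ?thesis by simp
    next
      case 2
      have "\<forall>y\<in>P. ((- \<alpha>) *\<^sub>R - c + \<beta> *\<^sub>R w) \<bullet> (y - v) \<le> 0" "\<forall>y\<in>e. ((- \<alpha>) *\<^sub>R - c + \<beta> *\<^sub>R w) \<bullet> (y - v) = 0"
        using gP ge unfolding ab' by blast+
      then have "e = e2" using x2 e(1-3) 2 unfolding extremal_edge_def by blast
      then show ?thesis by simp
    qed
  qed
  then have "{e. e face_of P \<and> aff_dim e = 1 \<and> v \<in> e \<and> silhouette x e} = {e1, e2}"
    using e1 e2 by blast
  then show ?thesis using \<open>e1 \<noteq> e2\<close> by simp
qed

end

section \<open>Interior angles of hyperbolic polytopes\<close>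

text \<open>A bound on \<open>hdist c x\<close> keeps \<open>cofactor x\<close> away from 0, hence
  \<open>norm x\<close> away from 1.\<close>

lemma hbounded_imp_norm_bound:
  fixes P :: "'a::euclidean_space set"
  assumes "hbounded P"
  obtains \<rho> where "\<rho> < 1" "\<And>x. x \<in> P \<Longrightarrow> norm x \<le> \<rho>"
proof -
  obtain c R where P: "P \<subseteq> hyp_space" and c: "c \<in> hyp_space" and R: "\<And>x. x \<in> P \<Longrightarrow> hdist c x \<le> R"
    using assms unfolding hbounded_def by blast
  define k where "k = (1 - norm c) / (cosh R * cofactor c)"
  have nc: "norm c < 1" using c by simp
  have k: "k > 0" unfolding k_def using nc cofactor_pos[OF c] cosh_real_pos[of R] by simp
  have bound: "norm x \<le> sqrt (1 - k\<^sup>2)" if x: "x \<in> P" for x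
  proof -
    have xh: "x \<in> hyp_space" using x P by blast
    have sx: "cofactor x > 0" and sc: "cofactor c > 0" using cofactor_pos xh c by blast+
    define q where "q = (1 - c \<bullet> x) / (cofactor c * cofactor x)"
    have h: "hdist c x = arcosh q" by (simp add: hdist_def q_def cofactor_def)
    have "q \<le> cosh R"
    \<comment> \<open>\<open>cosh\<close> inverts \<open>arcosh\<close> only from 1 on; below 1 the
      bound is immediate from \<open>cosh R \<ge> 1\<close>.\<close>
    proof (cases "q \<ge> 1")
      case True
      have "arcosh q \<le> R" using R[OF x] h by simp
      moreover have "arcosh q \<ge> 0" using True by simp
      ultimately have "cosh (arcosh q) \<le> cosh R" by (simp add: cosh_real_nonneg_le_iff)
      then show ?thesis using True by simp
    next
      case False
      then show ?thesis using cosh_real_ge_1[of R] by linarith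
    qed
    then have "1 - c \<bullet> x \<le> cosh R * (cofactor c * cofactor x)"
      using sx sc by (simp add: q_def divide_le_eq)
    moreover have "c \<bullet> x \<le> norm c * norm x" by (rule norm_cauchy_schwarz)
    moreover have "norm c * norm x \<le> norm c * 1" using xh by (intro mult_left_mono) auto
    ultimately have "1 - norm c \<le> cofactor x * (cosh R * cofactor c)" by (simp add: mult_ac)
    then have "k \<le> cofactor x"
      unfolding k_def using sc cosh_real_pos[of R] by (simp add: divide_le_eq)
    then have "k\<^sup>2 \<le> (cofactor x)\<^sup>2" using k by (intro power_mono) auto
    then have "(norm x)\<^sup>2 \<le> 1 - k\<^sup>2" using cofactor_sq[OF xh] by (simp add: dot_square_norm)
    then show ?thesis by (rule real_le_rsqrt)
  qed
  have "sqrt (1 - k\<^sup>2) < 1" using k by (simp add: real_sqrt_lt_1_iff)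
  then show ?thesis using bound that by blast
qed

text \<open>The Euclidean polyhedron \<open>K\<close> of the same inequalities cannot leave the
  ball: a segment from \<open>P\<close> to a point outside would contain points of \<open>P\<close>
  with norm arbitrarily close to 1.\<close>

lemma hyp_polytope_imp_polytope:
  fixes P :: "'a::euclidean_space set"
  assumes "hyp_polytope P"
  shows "polytope P" "P \<subseteq> hyp_space"
proof -
  obtain \<H> where H: "finite \<H>" "\<And>H. H \<in> \<H> \<Longrightarrow> hyp_halfspace H" and P: "P = hyp_space \<inter> \<Inter>\<H>"
    and bd: "hbounded P" and int: "interior P \<noteq> {}"
    using assms unfolding hyp_polytope_def by blast
  show sub: "P \<subseteq> hyp_space" using P by blast
  obtain \<rho> where \<rho>: "\<rho> < 1" "\<And>x. x \<in> P \<Longrightarrow> norm x \<le> \<rho>"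
    using hbounded_imp_norm_bound[OF bd] by blast
  have "\<forall>H\<in>\<H>. \<exists>a b. H = {x \<in> hyp_space. a \<bullet> x \<le> b}"
    using H(2) unfolding hyp_halfspace_def by blast
  then obtain a b where ab: "\<And>H. H \<in> \<H> \<Longrightarrow> H = {x \<in> hyp_space. a H \<bullet> x \<le> b H}" by metis
  define K where "K = \<Inter> ((\<lambda>H. {x. a H \<bullet> x \<le> b H}) ` \<H>)"
  have polyK: "polyhedron K"
    unfolding K_def using H(1) by (intro polyhedron_Inter) (auto intro: polyhedron_halfspace_le)
  have PK: "x \<in> P \<longleftrightarrow> x \<in> K" if "x \<in> hyp_space" for x
    using that ab unfolding P K_def by blast
  have "K \<subseteq> P"
  proof
    fix x assume x: "x \<in> K"
    obtain p where p: "p \<in> P" using int interior_subset by blast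
    have pK: "p \<in> K" using p sub PK by blast
    have "norm x < 1"
    proof (rule ccontr)
      assume n: "\<not> norm x < 1"
      \<comment> \<open>A value strictly between the norm bound of \<open>P\<close> and 1; the
        segment attains it at a point of \<open>K\<close> inside the ball, hence in
        \<open>P\<close>.\<close>
      define m where "m = (\<rho> + 1) / 2"
      have "\<exists>t\<ge>0. t \<le> 1 \<and> norm ((1 - t) *\<^sub>R p + t *\<^sub>R x) = m"
      proof (rule IVT')
        show "norm ((1 - 0) *\<^sub>R p + 0 *\<^sub>R x) \<le> m" using \<rho>(2)[OF p] \<rho>(1) by (simp add: m_def)
        show "m \<le> norm ((1 - 1) *\<^sub>R p + 1 *\<^sub>R x)" using n \<rho>(1) by (simp add: m_def)
        show "continuous_on {0..1} (\<lambda>t. norm ((1 - t) *\<^sub>R p + t *\<^sub>R x))" by (intro continuous_intros)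
      qed simp
      then obtain t where t: "t \<ge> 0" "t \<le> 1" "norm ((1 - t) *\<^sub>R p + t *\<^sub>R x) = m" by blast
      have "(1 - t) *\<^sub>R p + t *\<^sub>R x \<in> K"
        using polyhedron_imp_convex[OF polyK] pK x t(1,2) by (intro convexD) auto
      moreover have "(1 - t) *\<^sub>R p + t *\<^sub>R x \<in> hyp_space" using t(3) \<rho>(1) by (simp add: m_def)
      ultimately have "m \<le> \<rho>" using PK \<rho>(2) t(3) by metis
      then show False using \<rho>(1) by (simp add: m_def)
    qed
    then show "x \<in> P" using PK x by simp
  qed
  then have "P = K" using PK sub by blast
  moreover have "bounded P" using \<rho>(2) by (auto simp: bounded_iff)
  ultimately show "polytope P" using polyK by (simp add: polytope_eq_bounded_polyhedron)
qed

locale klein_polytope = full_polytope +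
  assumes in_hyp: "P \<subseteq> hyp_space"
begin

text \<open>Here \<open>v\<close> may be any point of \<open>G\<close>, in particular a vertex,
  although the angle is defined at relative interior points. All angles around a vertex can thus be
  compared on the same sphere.\<close>

lemma interior_angle_eq:
  assumes G: "G face_of P" "v \<in> G"
  shows "interior_angle G P = solid_angle ((\<lambda>F. tilt v (normal F)) ` {F \<in> facets. G \<subseteq> F})"
proof (rule interior_angle_eqI)
  show "rel_interior G \<noteq> {}"
    using rel_interior_eq_empty[OF face_of_imp_convex[OF G(1)]] G(2) by blast
  fix x assume x: "x \<in> rel_interior G"
  have GP: "G \<subseteq> P" using G(1) by (rule face_of_imp_subset)
  have xG: "x \<in> G" using x rel_interior_subset by blast
  have xP: "x \<in> P" "x \<in> hyp_space" and vh: "v \<in> hyp_space" using xG G(2) GP in_hyp by blast+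
  have "{F \<in> facets. normal F \<bullet> x = offset F} = {F \<in> facets. G \<subseteq> F}"
    using facet_iff_rel_interior[OF G(1) x] by blast
  moreover have "solid_angle ((\<lambda>F. tilt x (normal F)) ` {F \<in> facets. G \<subseteq> F})
    = solid_angle ((\<lambda>F. tilt v (normal F)) ` {F \<in> facets. G \<subseteq> F})"
    by (rule solid_angle_tilt_line[OF xP(2) vh, where b = offset]) (use xG G(2) facet_on in blast)+
  ultimately show "\<forall>\<^sub>F r in at_right 0. sphere_fraction P x r = solid_angle ((\<lambda>F. tilt v (normal F)) ` {F \<in> facets. G \<subseteq> F})"
    using sphere_fraction_eventually[OF xP(2,1) finite_facets P_eq_halfspaces] by simp
qed

lemma facets_above_facet:
  assumes "F \<in> facets"
  shows "{G \<in> facets. F \<subseteq> G} = {F}"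
  using face_eq_of_subset[OF facets_face_of facets_face_of] facets_aff_dim assms by fastforce

lemma interior_angle_facet:
  assumes F: "F \<in> facets"
  shows "interior_angle F P = 1 / 2"
proof -
  obtain v where v: "v \<in> F" using F by (auto simp: facets_def facet_of_def)
  have "v \<in> hyp_space" using v facets_face_of[OF F] face_of_imp_subset in_hyp by blast
  then have "tilt v (normal F) \<noteq> 0" using tilt_eq_0_iff normal_nonzero[OF F] by blast
  then show ?thesis
    unfolding interior_angle_eq[OF facets_face_of[OF F] v] facets_above_facet[OF F]
    by (simp add: solid_angle_halfspace)
qed

lemma faces_dim_facets: "faces_dim (DIM('a) - 1) P = facets"
  by (simp add: faces_dim_def facets_eq)

lemma angle_sum_facets: "angle_sum (DIM('a) - 1) P = real (card facets) / 2"
  unfolding angle_sum_def faces_dim_facets by (simp add: interior_angle_facet)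

text \<open>Only the term \<open>j = d - 1\<close> occurs, and the relation says that the facet
  angles sum to half the number of facets.\<close>

lemma angle_relation_facets: "angle_relation (DIM('a) - 1) P"
proof -
  have "(-1::real) ^ DIM('a) = - ((-1) ^ (DIM('a) - 1))"
    using power_DIM[where 'a='a, of "-1"] by simp
  then show ?thesis
    unfolding angle_relation_def f_num_def faces_dim_facets atLeastAtMost_singleton
    by (simp add: angle_sum_facets del: One_nat_def)
qed

end

section \<open>Incidence counts in simplicial polytopes\<close>

locale simplicial_klein_polytope = klein_polytope +
  assumes simplicial: "\<And>F. F facet_of P \<Longrightarrow> \<exists>n. n simplex F"
begin

lemma facet_simplex: "F \<in> facets \<Longrightarrow> int (DIM('a) - 1) simplex F"
  using simplicial[of F] aff_dim_simplex[of _ F] facets_aff_dim[of F]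
  by (auto simp: facets_def of_nat_diff)

lemma faces_dim_in_face:
  assumes "G face_of P"
  shows "{R \<in> faces_dim i P. R \<subseteq> G} = {R. R face_of G \<and> aff_dim R = int i}"
  using face_of_face[OF assms] by (auto simp: faces_dim_def)

lemma card_faces_dim_in_facet:
  assumes "F \<in> facets"
  shows "card {R \<in> faces_dim i P. R \<subseteq> F} = DIM('a) choose (i + 1)"
  unfolding faces_dim_in_face[OF facets_face_of[OF assms]]
  using card_faces_simplex[OF facet_simplex[OF assms], of i] by simp

lemma card_facets_over_ridge:
  assumes "DIM('a) \<ge> 2" "R \<in> faces_dim (DIM('a) - 2) P"
  shows "card {F \<in> facets. R \<subseteq> F} = 2"
proof -
  have "int (DIM('a) - 2) = int DIM('a) - 2" using assms(1) by simp
  then have R: "R face_of P" "aff_dim R = int DIM('a) - 2" "R \<noteq> {}"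
    using assms by (auto simp: faces_dim_def)
  obtain F G where "F \<noteq> G" "{H \<in> facets. R \<subseteq> H} = {F, G}" using ridge_two_facets[OF R] by blast
  then show ?thesis by simp
qed

lemma ridge_facet_double_count:
  assumes "DIM('a) \<ge> 2"
  shows "DIM('a) * card facets = 2 * card (faces_dim (DIM('a) - 2) P)"
proof -
  let ?R = "faces_dim (DIM('a) - 2) P"
  have "(\<Sum>F\<in>facets. card {R \<in> ?R. R \<subseteq> F}) = 2 * card ?R"
    using card_facets_over_ridge[OF assms]
    by (intro sum_multicount finite_facets finite_faces_dim) blast
  moreover have "card {R \<in> ?R. R \<subseteq> F} = DIM('a)" if "F \<in> facets" for F
  proof -
    have "DIM('a) - 2 + 1 = DIM('a) - 1" using assms by simp
    moreover have "DIM('a) choose (DIM('a) - 1) = DIM('a) choose 1"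
      using assms binomial_symmetric[of 1 "DIM('a)"] by simp
    ultimately show ?thesis using card_faces_dim_in_facet[OF that, of "DIM('a) - 2"] by simp
  qed
  ultimately show ?thesis by (simp add: mult.commute)
qed

text \<open>The ridge angle sums on the two sides cancel. What remains says that the number of
  ridges is \<open>d\<close> times the facet angle sum, which is the double count of incident ridges
  and facets.\<close>

lemma angle_relation_ridges:
  assumes d: "DIM('a) \<ge> 2"
  shows "angle_relation (DIM('a) - 2) P"
proof -
  obtain m where m: "DIM('a) = Suc (Suc m)" using d by (metis add_2_eq_Suc le_Suc_ex)
  have "real DIM('a) * real (card facets) = 2 * real (card (faces_dim (DIM('a) - 2) P))"
    using ridge_facet_double_count[OF d] by (metis of_nat_mult of_nat_numeral)
  moreover have "real (card facets) = 2 * angle_sum (Suc m) P" using angle_sum_facets m by simp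
  ultimately have f: "real (f_num m P) = real (Suc (Suc m)) * angle_sum (Suc m) P"
    using m by (simp add: f_num_def)
  have "{m..Suc m} = {m, Suc m}" by auto
  then show ?thesis
    unfolding angle_relation_def m by (simp add: f binomial_eq_0 algebra_simps)
qed

end

section \<open>Angles at the vertices of a 3-dimensional polytope\<close>

context full_polytope
begin

definition edges_at :: "'a \<Rightarrow> 'a set set" where "edges_at v = {e \<in> faces_dim 1 P. v \<in> e}"
definition facets_at :: "'a \<Rightarrow> 'a set set" where "facets_at v = {F \<in> facets. v \<in> F}"

lemma finite_edges_at: "finite (edges_at v)"
  unfolding edges_at_def using finite_faces_dim by simp

lemma finite_facets_at: "finite (facets_at v)"
  unfolding facets_at_def using finite_facets by simp

lemma facets_at_nonempty:
  assumes d3: "DIM('a) = 3" and v: "v \<in> vertices"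
  shows "facets_at v \<noteq> {}"
proof -
  have "{v} face_of P" using v by (simp add: vertices_def face_of_singleton)
  moreover have "{v} \<noteq> P"
  proof
    assume "{v} = P"
    then have "aff_dim P = aff_dim {v}" by simp
    then show False using aff_dim_P d3 by simp
  qed
  ultimately show ?thesis
    using face_of_polyhedron_subset_facet[OF polyhedron, of "{v}"] by (auto simp: facets_at_def facets_def)
qed

text \<open>Almost everywhere on the sphere of directions at a vertex, this is the alternating sum of the
  indicator functions of the tangent cones of the faces at the vertex.\<close>

lemma tangent_cone_count:
  assumes d3: "DIM('a) = 3" and v: "v \<in> vertices"
    and generic: "\<And>F. F \<in> facets_at v \<Longrightarrow> normal F \<bullet> x \<noteq> 0"
    and two: "\<And>F. F \<in> facets_at v \<Longrightarrow> card {e \<in> edges_at v. e \<subseteq> F} = 2"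
  shows "of_bool (\<forall>F\<in>facets_at v. normal F \<bullet> x \<le> 0) + of_bool (\<forall>F\<in>facets_at v. normal F \<bullet> x \<ge> 0) =
    (\<Sum>e\<in>edges_at v. of_bool (\<forall>F\<in>facets. e \<subseteq> F \<longrightarrow> normal F \<bullet> x \<le> 0)) -
    (\<Sum>F\<in>facets_at v. of_bool (normal F \<bullet> x \<le> 0)) + (1::real)"
proof -
  define I where "I = {F \<in> facets_at v. normal F \<bullet> x \<le> 0}"
  define inn where "inn e \<longleftrightarrow> (\<forall>F\<in>facets. e \<subseteq> F \<longrightarrow> normal F \<bullet> x \<le> 0)" for e
  have finI: "finite I" unfolding I_def using finite_facets_at by simp
  \<comment> \<open>An edge lies in two facets, of which \<open>I\<close> contains both, one
    (exactly for silhouette edges) or none. Counting incidences also by facets, each with two edges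
    at \<open>v\<close>, gives \<open>main\<close>.\<close>
  have cnt: "real (card {F \<in> I. e \<subseteq> F}) = 2 * of_bool (inn e) + of_bool (silhouette x e)" if e: "e \<in> edges_at v" for e
  proof -
    have e': "e face_of P" "aff_dim e = int DIM('a) - 2" "e \<noteq> {}" and ve: "v \<in> e"
      using e d3 by (auto simp: edges_at_def faces_dim_def)
    obtain F G where FG: "F \<noteq> G" "{H \<in> facets. e \<subseteq> H} = {F, G}" using ridge_two_facets[OF e'] by blast
    have mem: "H \<in> facets \<and> e \<subseteq> H \<longleftrightarrow> H = F \<or> H = G" for H
    proof -
      have "H \<in> facets \<and> e \<subseteq> H \<longleftrightarrow> H \<in> {H \<in> facets. e \<subseteq> H}" by simp
      also have "\<dots> \<longleftrightarrow> H = F \<or> H = G" unfolding FG(2) by simp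
      finally show ?thesis .
    qed
    have "F \<in> facets" "e \<subseteq> F" "G \<in> facets" "e \<subseteq> G" using mem[of F] mem[of G] by simp_all
    then have at: "F \<in> facets_at v" "G \<in> facets_at v" unfolding facets_at_def using ve by blast+
    have "inn e \<longleftrightarrow> (\<forall>H. (H \<in> facets \<and> e \<subseteq> H) \<longrightarrow> normal H \<bullet> x \<le> 0)" unfolding inn_def by blast
    then have inn: "inn e \<longleftrightarrow> normal F \<bullet> x \<le> 0 \<and> normal G \<bullet> x \<le> 0" unfolding mem by auto
    have "silhouette x e \<longleftrightarrow> (\<exists>H K. (H \<in> facets \<and> e \<subseteq> H) \<and> (K \<in> facets \<and> e \<subseteq> K) \<and> normal H \<bullet> x < 0 \<and> normal K \<bullet> x > 0)"
      unfolding silhouette_def by blast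
    also have "\<dots> \<longleftrightarrow> (normal F \<bullet> x < 0 \<and> normal G \<bullet> x > 0) \<or> (normal G \<bullet> x < 0 \<and> normal F \<bullet> x > 0)"
      unfolding mem by auto
    finally have sil: "silhouette x e \<longleftrightarrow> (normal F \<bullet> x < 0 \<and> normal G \<bullet> x > 0) \<or> (normal G \<bullet> x < 0 \<and> normal F \<bullet> x > 0)" .
    have "{H \<in> I. e \<subseteq> H} = {H. (H \<in> facets \<and> e \<subseteq> H) \<and> normal H \<bullet> x \<le> 0}"
      unfolding I_def facets_at_def using ve by blast
    also have "\<dots> = {H \<in> {F, G}. normal H \<bullet> x \<le> 0}" unfolding mem by simp
    also have "real (card \<dots>) = of_bool (normal F \<bullet> x \<le> 0) + of_bool (normal G \<bullet> x \<le> 0)"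
    proof -
      have "{H \<in> {F, G}. normal H \<bullet> x \<le> 0} =
        (if normal F \<bullet> x \<le> 0 then {F} else {}) \<union> (if normal G \<bullet> x \<le> 0 then {G} else {})" by auto
      then show ?thesis using FG(1) by simp
    qed
    also have "\<dots> = 2 * of_bool (inn e) + of_bool (silhouette x e)"
      unfolding inn sil using generic[OF at(1)] generic[OF at(2)] by (auto simp: of_bool_def)
    finally show ?thesis .
  qed
  have "(\<Sum>F\<in>I. card {e \<in> edges_at v. e \<subseteq> F}) = (\<Sum>e\<in>edges_at v. card {F \<in> I. e \<subseteq> F})"
    by (rule sum_multicount_gen[OF finI finite_edges_at]) simp
  moreover have "(\<Sum>F\<in>I. card {e \<in> edges_at v. e \<subseteq> F}) = 2 * card I"
    using two by (simp add: I_def)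
  ultimately have "real (2 * card I) = real (\<Sum>e\<in>edges_at v. card {F \<in> I. e \<subseteq> F})" by simp
  then have "2 * real (card I) = (\<Sum>e\<in>edges_at v. real (card {F \<in> I. e \<subseteq> F}))" by simp
  also have "\<dots> = 2 * (\<Sum>e\<in>edges_at v. of_bool (inn e)) + (\<Sum>e\<in>edges_at v. of_bool (silhouette x e))"
    by (simp add: cnt sum.distrib sum_distrib_left)
  finally have main: "2 * real (card I) = 2 * (\<Sum>e\<in>edges_at v. of_bool (inn e)) + (\<Sum>e\<in>edges_at v. of_bool (silhouette x e))" .
  have cI: "(\<Sum>F\<in>facets_at v. of_bool (normal F \<bullet> x \<le> 0)) = real (card I)"
    unfolding I_def using finite_facets_at by (simp add: of_bool_def sum.If_cases Int_def)
  have neg_pos: "(\<exists>F\<in>facets_at v. normal F \<bullet> x < 0) \<and> (\<exists>F\<in>facets_at v. normal F \<bullet> x > 0)"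
    if "silhouette x e" "e \<in> edges_at v" for e
    using that unfolding silhouette_def edges_at_def facets_at_def by blast
  have ne: "facets_at v \<noteq> {}" by (rule facets_at_nonempty[OF d3 v])
  show ?thesis
  \<comment> \<open>With mixed signs there are two silhouette edges and \<open>x\<close> lies in
    neither cone. Otherwise all signs agree: there is no silhouette edge, and \<open>x\<close> lies
    in exactly one of the two opposite cones.\<close>
  proof (cases "(\<exists>F\<in>facets_at v. normal F \<bullet> x < 0) \<and> (\<exists>F\<in>facets_at v. normal F \<bullet> x > 0)")
    case True
    then obtain Fn Fp where Fn: "Fn \<in> facets" "v \<in> Fn" "normal Fn \<bullet> x < 0" and Fp: "Fp \<in> facets" "v \<in> Fp" "normal Fp \<bullet> x > 0"
      by (auto simp: facets_at_def)
    have gen: "normal F \<bullet> x \<noteq> 0" if "F \<in> facets" "v \<in> F" for F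
      using generic that by (simp add: facets_at_def)
    have "(\<Sum>e\<in>edges_at v. of_bool (silhouette x e)) = real (card {e \<in> edges_at v. silhouette x e})"
      using finite_edges_at by (simp add: of_bool_def sum.If_cases Int_def)
    also have "{e \<in> edges_at v. silhouette x e} = {e. e face_of P \<and> aff_dim e = 1 \<and> v \<in> e \<and> silhouette x e}"
      by (auto simp: edges_at_def faces_dim_def)
    also have "real (card \<dots>) = 2" using card_silhouette[OF d3 v gen Fn Fp] by simp
    finally have "real (card I) = (\<Sum>e\<in>edges_at v. of_bool (inn e)) + 1" using main by simp
    moreover have "\<not> (\<forall>F\<in>facets_at v. normal F \<bullet> x \<le> 0)" "\<not> (\<forall>F\<in>facets_at v. normal F \<bullet> x \<ge> 0)"
      using True by (auto simp: not_le)
    ultimately show ?thesis unfolding cI inn_def by simp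
  next
    case False
    then have "(\<Sum>e\<in>edges_at v. of_bool (silhouette x e)) = (0::real)"
      using neg_pos by (intro sum.neutral) auto
    then have "real (card I) = (\<Sum>e\<in>edges_at v. of_bool (inn e))" using main by simp
    moreover have "of_bool (\<forall>F\<in>facets_at v. normal F \<bullet> x \<le> 0) + of_bool (\<forall>F\<in>facets_at v. normal F \<bullet> x \<ge> 0) = (1::real)"
    proof -
      obtain F0 where F0: "F0 \<in> facets_at v" using ne by blast
      consider "\<forall>F\<in>facets_at v. normal F \<bullet> x > 0" | "\<forall>F\<in>facets_at v. normal F \<bullet> x < 0"
      proof (cases "\<exists>F\<in>facets_at v. normal F \<bullet> x < 0")
        case True
        have "normal F \<bullet> x < 0" if "F \<in> facets_at v" for F
        proof -
          have "\<not> normal F \<bullet> x > 0" using True False that by blast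
          then show ?thesis using generic[OF that] by linarith
        qed
        then show thesis using that by blast
      next
        case F: False
        have "normal F \<bullet> x > 0" if "F \<in> facets_at v" for F
        proof -
          have "\<not> normal F \<bullet> x < 0" using F that by blast
          then show ?thesis using generic[OF that] by linarith
        qed
        then show thesis using that by blast
      qed
      then show ?thesis
      proof cases
        case 1
        then have "\<forall>F\<in>facets_at v. normal F \<bullet> x \<ge> 0" "\<not> (\<forall>F\<in>facets_at v. normal F \<bullet> x \<le> 0)"
          using F0 by (auto simp: not_le less_imp_le)
        then show ?thesis by (simp only: of_bool_eq simp_thms) simp
      next
        case 2
        then have "\<forall>F\<in>facets_at v. normal F \<bullet> x \<le> 0" "\<not> (\<forall>F\<in>facets_at v. normal F \<bullet> x \<ge> 0)"
          using F0 by (auto simp: not_le less_imp_le)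
        then show ?thesis by (simp only: of_bool_eq simp_thms) simp
      qed
    qed
    ultimately show ?thesis unfolding cI inn_def by simp
  qed
qed

end

context klein_polytope
begin

abbreviation normals_at :: "'a \<Rightarrow> 'a set \<Rightarrow> 'a set" where
  "normals_at v G \<equiv> (\<lambda>F. tilt v (normal F)) ` {F \<in> facets. G \<subseteq> F}"

text \<open>Integrates \<open>tangent_cone_count\<close> over the sphere of directions at
  \<open>v\<close>, with \<open>v\<close> moved to the origin. The directions that are not generic
  lie in finitely many hyperplanes, hence form a null set.\<close>

lemma vertex_angle:
  assumes d3: "DIM('a) = 3" and v: "v \<in> vertices"
    and two: "\<And>F. F \<in> facets_at v \<Longrightarrow> card {e \<in> edges_at v. e \<subseteq> F} = 2"
  shows "2 * interior_angle {v} P =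
    (\<Sum>e\<in>edges_at v. interior_angle e P) - real (card (facets_at v)) / 2 + 1"
proof -
  let ?M = "unit.sphere_measure :: 'a measure"
  let ?S = "sphere (0::'a) (tanh 1)"
  interpret M: finite_measure ?M by (rule unit.finite_sphere_measure)
  define C where "C N = {z \<in> ?S. z \<in> normal_cone N}" for N
  have vh: "v \<in> hyp_space" using v vertices_subset in_hyp by blast
  have fin: "finite (normals_at v G)" for G using finite_facets by simp
  have Cm: "C N \<in> sets ?M" if "finite N" for N unfolding C_def by (rule normal_cone_in_sets[OF that])
  have mC: "measure ?M (C N) = solid_angle N * measure ?M ?S" if "finite N" for N
    unfolding C_def using unit.measure_sphere_pos[where 'a='a] by (simp add: solid_angle_eq_measure[OF that])
  have vface: "{v} face_of P" using v by (simp add: vertices_def face_of_singleton)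
  have eface: "e face_of P" "v \<in> e" if "e \<in> edges_at v" for e
    using that by (auto simp: edges_at_def faces_dim_def)
  have Fat: "F \<in> facets" "v \<in> F" if "F \<in> facets_at v" for F using that by (auto simp: facets_at_def)
  have fv: "{F \<in> facets. {v} \<subseteq> F} = facets_at v" by (auto simp: facets_at_def)
  let ?ind = "\<lambda>N z. indicator (C N) z :: real"
  \<comment> \<open>The second cone is the antipode of the first and has the same angle, whence the
    factor 2.\<close>
  let ?L = "\<lambda>z. ?ind (normals_at v {v}) z + ?ind (uminus ` normals_at v {v}) z"
  let ?R = "\<lambda>z. (\<Sum>e\<in>edges_at v. ?ind (normals_at v e) z) - (\<Sum>F\<in>facets_at v. ?ind (normals_at v F) z) + indicator ?S z"
  have ig: "integrable ?M (indicator A :: 'a \<Rightarrow> real)" if "A \<in> sets ?M" for A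
  proof (rule integrable_real_indicator[OF that])
    show "emeasure ?M A < \<infinity>" by (metis M.emeasure_finite infinity_ennreal_def top.not_eq_extremum)
  qed
  have int: "integrable ?M (?ind N)" if "finite N" for N by (rule ig[OF Cm[OF that]])
  have intS: "integrable ?M (indicator ?S :: 'a \<Rightarrow> real)"
    by (rule ig[OF unit.sphere_in_sphere_measure])
  have Lint: "(LINT z|?M. ?ind N z) = solid_angle N * measure ?M ?S" if "finite N" for N
  proof -
    have "C N \<inter> ?S = C N" by (auto simp: C_def)
    then show ?thesis using mC[OF that] Cm[OF that] by simp
  qed
  have nul: "(\<Union>F\<in>facets_at v. {z \<in> ?S. tilt v (normal F) \<bullet> z = 0}) \<in> null_sets ?M"
  proof (rule null_sets.finite_UN)
    show "finite (facets_at v)" by (rule finite_facets_at)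
    show "{z \<in> ?S. tilt v (normal F) \<bullet> z = 0} \<in> null_sets ?M" if "F \<in> facets_at v" for F
      by (rule unit.hyperplane_null_sphere_measure) (use tilt_eq_0_iff[OF vh] normal_nonzero Fat(1)[OF that] in blast)
  qed
  have AE: "AE z in ?M. ?L z = ?R z"
  proof (rule AE_I'[OF nul], clarify)
    fix z assume zS: "z \<in> space ?M" and ne: "?L z \<noteq> ?R z"
    show "z \<in> (\<Union>F\<in>facets_at v. {z \<in> ?S. tilt v (normal F) \<bullet> z = 0})"
    proof (rule ccontr)
      assume nz: "z \<notin> (\<Union>F\<in>facets_at v. {z \<in> ?S. tilt v (normal F) \<bullet> z = 0})"
      have z: "z \<in> ?S" using zS by simp
      \<comment> \<open>Self-adjointness of \<open>tilt v\<close> moves it from the normals to the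
        direction, so the count with the original normals applies at \<open>x\<close>.\<close>
      define x where "x = tilt v z"
      have tx: "tilt v (normal F) \<bullet> z = normal F \<bullet> x" for F by (simp add: x_def inner_tilt)
      have gen: "normal F \<bullet> x \<noteq> 0" if "F \<in> facets_at v" for F
        using nz z that by (auto simp: tx)
      have i1: "?ind (normals_at v G) z = of_bool (\<forall>F\<in>facets. G \<subseteq> F \<longrightarrow> normal F \<bullet> x \<le> 0)" for G
        using z by (auto simp: C_def normal_cone_def tx indicator_def)
      have iv: "?ind (normals_at v {v}) z = of_bool (\<forall>F\<in>facets_at v. normal F \<bullet> x \<le> 0)"
        unfolding fv using z by (auto simp: C_def normal_cone_def tx indicator_def)
      have iu: "?ind (uminus ` normals_at v {v}) z = of_bool (\<forall>F\<in>facets_at v. normal F \<bullet> x \<ge> 0)"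
        unfolding fv using z by (auto simp: C_def normal_cone_def tx indicator_def)
      have iF: "?ind (normals_at v F) z = of_bool (normal F \<bullet> x \<le> 0)" if "F \<in> facets_at v" for F
        unfolding facets_above_facet[OF Fat(1)[OF that]] using z
        by (auto simp: C_def normal_cone_def tx indicator_def)
      have iFs: "(\<Sum>F\<in>facets_at v. ?ind (normals_at v F) z) = (\<Sum>F\<in>facets_at v. of_bool (normal F \<bullet> x \<le> 0))"
        by (rule sum.cong[OF refl iF])
      have "?L z = ?R z"
        unfolding iv iu iFs unfolding i1 using tangent_cone_count[OF d3 v gen two] z by simp
      then show False using ne by blast
    qed
  qed
  have intL: "integrable ?M ?L"
    by (intro Bochner_Integration.integrable_add int fin finite_imageI[OF fin])
  have intR: "integrable ?M ?R"
    by (intro Bochner_Integration.integrable_add Bochner_Integration.integrable_diff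
        Bochner_Integration.integrable_sum int fin intS)
  have "(LINT z|?M. ?L z) = (LINT z|?M. ?R z)"
    by (rule integral_cong_AE[OF borel_measurable_integrable[OF intL] borel_measurable_integrable[OF intR] AE])
  moreover have "(LINT z|?M. ?L z) = 2 * solid_angle (normals_at v {v}) * measure ?M ?S"
  proof -
    have "(LINT z|?M. ?L z) = (LINT z|?M. ?ind (normals_at v {v}) z) + (LINT z|?M. ?ind (uminus ` normals_at v {v}) z)"
      by (rule Bochner_Integration.integral_add[OF int[OF fin] int[OF finite_imageI[OF fin]]])
    then show ?thesis
      unfolding Lint[OF fin] Lint[OF finite_imageI[OF fin]] solid_angle_uminus by simp
  qed
  moreover have "(LINT z|?M. ?R z) = ((\<Sum>e\<in>edges_at v. solid_angle (normals_at v e)) -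
      (\<Sum>F\<in>facets_at v. solid_angle (normals_at v F)) + 1) * measure ?M ?S"
  proof -
    have iS: "integrable ?M (\<lambda>z. \<Sum>e\<in>A. ?ind (normals_at v e) z)" for A
      by (intro Bochner_Integration.integrable_sum int fin)
    have LS: "(LINT z|?M. (\<Sum>e\<in>A. ?ind (normals_at v e) z)) = (\<Sum>e\<in>A. solid_angle (normals_at v e)) * measure ?M ?S" for A
    proof -
      have "(LINT z|?M. (\<Sum>e\<in>A. ?ind (normals_at v e) z)) = (\<Sum>e\<in>A. LINT z|?M. ?ind (normals_at v e) z)"
        by (rule Bochner_Integration.integral_sum) (rule int[OF fin])
      then show ?thesis unfolding Lint[OF fin] sum_distrib_right .
    qed
    have "(LINT z|?M. ?R z) = (LINT z|?M. (\<Sum>e\<in>edges_at v. ?ind (normals_at v e) z) - (\<Sum>F\<in>facets_at v. ?ind (normals_at v F) z))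
        + (LINT z|?M. indicator ?S z)"
      by (rule Bochner_Integration.integral_add[OF Bochner_Integration.integrable_diff[OF iS iS] intS])
    also have "(LINT z|?M. (\<Sum>e\<in>edges_at v. ?ind (normals_at v e) z) - (\<Sum>F\<in>facets_at v. ?ind (normals_at v F) z)) =
      (\<Sum>e\<in>edges_at v. solid_angle (normals_at v e)) * measure ?M ?S - (\<Sum>F\<in>facets_at v. solid_angle (normals_at v F)) * measure ?M ?S"
      unfolding Bochner_Integration.integral_diff[OF iS iS] LS ..
    also have "(LINT z|?M. indicator ?S z) = measure ?M ?S" using unit.sphere_in_sphere_measure by simp
    finally show ?thesis by (simp only: distrib_right left_diff_distrib mult_1)
  qed
  ultimately have "2 * solid_angle (normals_at v {v}) =
     (\<Sum>e\<in>edges_at v. solid_angle (normals_at v e)) - (\<Sum>F\<in>facets_at v. solid_angle (normals_at v F)) + 1"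
    using unit.measure_sphere_pos[where 'a='a] by simp
  moreover have "solid_angle (normals_at v F) = 1 / 2" if "F \<in> facets_at v" for F
    using interior_angle_eq[OF facets_face_of Fat(2)] interior_angle_facet Fat(1) that by metis
  moreover have "solid_angle (normals_at v e) = interior_angle e P" if "e \<in> edges_at v" for e
    using interior_angle_eq[OF eface] that by metis
  moreover have "solid_angle (normals_at v {v}) = interior_angle {v} P"
    using interior_angle_eq[OF vface] by simp
  ultimately show ?thesis by simp
qed

end

section \<open>Summation over the vertices\<close>

context simplicial_klein_polytope
begin

lemma faces_dim_0: "faces_dim 0 P = (\<lambda>v. {v}) ` vertices"
proof (intro equalityI subsetI)
  fix T assume T: "T \<in> faces_dim 0 P"
  then obtain a where "T = {a}" using aff_dim_eq_0[of T] by (auto simp: faces_dim_def)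
  then show "T \<in> (\<lambda>v. {v}) ` vertices" using T by (auto simp: faces_dim_def vertices_def face_of_singleton)
qed (auto simp: faces_dim_def vertices_def face_of_singleton)

lemma card_vertices_in_face:
  assumes G: "G face_of P" and S: "int n simplex G"
  shows "card {v \<in> vertices. v \<in> G} = n + 1"
proof -
  have "{R \<in> faces_dim 0 P. R \<subseteq> G} = (\<lambda>v. {v}) ` {v \<in> vertices. v \<in> G}"
    unfolding faces_dim_0 by auto
  then have "card {R \<in> faces_dim 0 P. R \<subseteq> G} = card {v \<in> vertices. v \<in> G}"
    by (simp add: card_image)
  then show ?thesis
    unfolding faces_dim_in_face[OF G] using card_faces_simplex[OF S, of 0] by simp
qed

lemma edge_simplex:
  assumes "e \<in> faces_dim 1 P"
  shows "int 1 simplex e"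
proof -
  have e: "e face_of P" "aff_dim e = 1" using assms by (auto simp: faces_dim_def)
  have "polytope e" using face_of_polytope_polytope[OF polytope e(1)] .
  then obtain n where "n simplex e" using polytope_lowdim_imp_simplex[of e] e(2) by auto
  then show ?thesis using aff_dim_simplex[of n e] e(2) by simp
qed

lemma card_edges_at_in_facet:
  assumes d3: "DIM('a) = 3" and v: "v \<in> vertices" and F: "F \<in> facets_at v"
  shows "card {e \<in> edges_at v. e \<subseteq> F} = 2"
proof -
  have FF: "F \<in> facets" "v \<in> F" using F by (auto simp: facets_at_def)
  have "2 simplex F" using facet_simplex[OF FF(1)] d3 by simp
  moreover have "{v} face_of F"
    using v FF facets_face_of[OF FF(1)] face_of_face[of F P "{v}"] by (simp add: vertices_def face_of_singleton)
  moreover have "{e \<in> edges_at v. e \<subseteq> F} = {e. e face_of F \<and> aff_dim e = 1 \<and> v \<in> e}"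
    using faces_dim_in_face[OF facets_face_of[OF FF(1)], of 1] by (auto simp: edges_at_def)
  ultimately show ?thesis using card_edges_triangle_at_vertex by metis
qed

text \<open>Summing \<open>vertex_angle\<close> over all vertices counts every edge twice and every
  triangle three times: 2\<alpha>_0 = 2\<alpha>_1 - 3f_2/2 + f_0. Since f_2 = 2\<alpha>_2, this is
  the relation.\<close>

lemma angle_relation_vertices:
  assumes d3: "DIM('a) = 3"
  shows "angle_relation 0 P"
proof -
  have sum0: "angle_sum 0 P = (\<Sum>v\<in>vertices. interior_angle {v} P)"
    unfolding angle_sum_def faces_dim_0 by (simp add: sum.reindex)
  have f0: "f_num 0 P = card vertices" unfolding f_num_def faces_dim_0 by (simp add: card_image)
  have "2 * angle_sum 0 P = (\<Sum>v\<in>vertices. (\<Sum>e\<in>edges_at v. interior_angle e P) - real (card (facets_at v)) / 2 + 1)"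
    unfolding sum0 sum_distrib_left
    using vertex_angle[OF d3 _ card_edges_at_in_facet[OF d3]] by (intro sum.cong) auto
  also have "\<dots> = (\<Sum>v\<in>vertices. \<Sum>e\<in>edges_at v. interior_angle e P) - (\<Sum>v\<in>vertices. real (card (facets_at v))) / 2 + real (card vertices)"
    by (simp add: sum.distrib sum_subtractf sum_divide_distrib)
  also have "(\<Sum>v\<in>vertices. \<Sum>e\<in>edges_at v. interior_angle e P) = 2 * angle_sum 1 P"
  proof -
    have "(\<Sum>v\<in>vertices. \<Sum>e\<in>edges_at v. interior_angle e P) =
      (\<Sum>e\<in>faces_dim 1 P. \<Sum>v\<in>{v \<in> vertices. v \<in> e}. interior_angle e P)"
      unfolding edges_at_def by (rule sum.swap_restrict[OF finite_vertices finite_faces_dim])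
    also have "\<dots> = (\<Sum>e\<in>faces_dim 1 P. 2 * interior_angle e P)"
    proof (rule sum.cong[OF refl])
      fix e assume e: "e \<in> faces_dim 1 P"
      have "card {v \<in> vertices. v \<in> e} = 1 + 1"
        using e by (intro card_vertices_in_face edge_simplex) (auto simp: faces_dim_def)
      then show "(\<Sum>v\<in>{v \<in> vertices. v \<in> e}. interior_angle e P) = 2 * interior_angle e P" by simp
    qed
    finally show ?thesis by (simp add: angle_sum_def sum_distrib_left)
  qed
  also have "(\<Sum>v\<in>vertices. real (card (facets_at v))) = 3 * real (card facets)"
  proof -
    have "(\<Sum>v\<in>vertices. card {F \<in> facets. v \<in> F}) = 3 * card facets"
    proof (rule sum_multicount[OF finite_vertices finite_facets], intro ballI)
      fix F assume F: "F \<in> facets"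
      show "card {v \<in> vertices. v \<in> F} = 3"
        using card_vertices_in_face[OF facets_face_of[OF F] facet_simplex[OF F]] d3 by simp
    qed
    then have "real (\<Sum>v\<in>vertices. card (facets_at v)) = real (3 * card facets)" by (simp only: facets_at_def)
    then show ?thesis by simp
  qed
  finally have "2 * angle_sum 0 P = 2 * angle_sum 1 P - 3 * real (card facets) / 2 + real (f_num 0 P)"
    by (simp add: f0)
  moreover have "angle_sum 2 P = real (card facets) / 2" using angle_sum_facets d3 by simp
  ultimately have "2 * angle_sum 0 P - 2 * angle_sum 1 P + 3 * angle_sum 2 P = real (f_num 0 P)" by simp
  moreover have "{0..2} = {0, 1, 2::nat}" by auto
  ultimately show ?thesis unfolding angle_relation_def d3 by (simp add: algebra_simps)
qed

end

theorem mainTheorem10: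
  fixes P :: "'a::euclidean_space set" and d :: nat
  assumes "d = DIM('a)"
    and "simplicial_hyp_polytope P"
  shows "(d \<ge> 1 \<longrightarrow> angle_relation (d - 1) P) \<and>
         (d \<ge> 2 \<longrightarrow> angle_relation (d - 2) P) \<and>
         (d = 3 \<longrightarrow> (\<forall>k\<in>{0..2}. angle_relation k P))"
proof -
  have P: "hyp_polytope P" "\<And>F. F facet_of P \<Longrightarrow> \<exists>n. n simplex F"
    using assms(2) by (auto simp: simplicial_hyp_polytope_def)
  interpret simplicial_klein_polytope P
    using hyp_polytope_imp_polytope[OF P(1)] P by unfold_locales (auto simp: hyp_polytope_def)
  \<comment> \<open>For \<open>d = 3\<close> the values 1 and 2 of \<open>k\<close> are already
    covered as \<open>d - 2\<close> and \<open>d - 1\<close>.\<close>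
  have k: "{0..2} = {0, 3 - 2, 3 - 1 :: nat}" by auto
  show ?thesis
    using angle_relation_facets angle_relation_ridges angle_relation_vertices unfolding assms(1) k by auto
qed

end
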